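(* Let $n\ge 2$, let $1\le p_1,p_2<\frac{2n}{n+1}$, and let $0<p\le\infty$ be given by $\frac1p=\frac1{p_1}+\frac1{p_2}$. If $\delta>n\,\alpha(p_1,p_2)-1$, then the bilinear Bochner-Riesz operator $S^{\delta}$ is bounded from $L^{p_1}(\mathbb{R}^n)\times L^{p_2}(\mathbb{R}^n)$ into $L^p(\mathbb{R}^n)$.
   Context: The Fourier transform on $\mathbb{R}^n$ is $\widehat f(\xi)=\int_{\mathbb{R}^n}e^{-2\pi i x\cdot\xi}f(x)\,dx$. For $\delta\ge 0$ and Schwartz functions $f,g$ on $\mathbb{R}^n$, the bilinear Bochner-Riesz operator is $$S^{\delta}(f,g)(x)=\iint_{|\xi|^2+|\eta|^2\le 1}(1-|\xi|^2-|\eta|^2)^{\delta}\,\widehat f(\xi)\,\widehat g(\eta)\,e^{2\pi i x\cdot(\xi+\eta)}\,d\xi\,d\eta .$$ "Bounded from $L^{p_1}\times L^{p_2}$ to $L^p$" means that there is a constant $C$ with $\|S^\delta(f,g)\|_p\le C\|f\|_{p_1}\|g\|_{p_2}$ for all Schwartz $f,g$. Set $a_n=\frac{n+1}{2n}$ and $b_n=\frac{n+1}{2n}+\frac{n-1}{n^2+n}$. For $1\le p_1,p_2<\frac{2n}{n+1}$ define $$\alpha(p_1,p_2)=\begin{cases}\frac{4}{n+1}, & (\frac1{p_1},\frac1{p_2})\in(a_n,b_n)\times(a_n,b_n),\\[2pt] \frac{2}{n+1}-\frac{n-1}{2n}+\frac1{p_2}, & (\frac1{p_1},\frac1{p_2})\in(a_n,b_n)\times[b_n,1],\\[2pt]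 \frac{2}{n+1}-\frac{n-1}{2n}+\frac1{p_1}, & (\frac1{p_1},\frac1{p_2})\in[b_n,1]\times(a_n,b_n),\\[2pt] \frac1{p_1}+\frac1{p_2}-\frac{n-1}{n}, & (\frac1{p_1},\frac1{p_2})\in[b_n,1]\times[b_n,1].\end{cases}$$ *)

theory Defs
  imports "HOL-Analysis.Analysis"
begin

text \<open>Partial derivatives; \<open>partials [i1, ..., ik] f\<close> is the iterated one of order \<open>k\<close>.
  They carry their usual meaning only where the differentiated function is differentiable,
  which \<open>schwartz\<close> demands at every stage.\<close>

definition partial_deriv :: "'n \<Rightarrow> (real ^ 'n \<Rightarrow> complex) \<Rightarrow> real ^ 'n \<Rightarrow> complex" where
  "partial_deriv i f x = frechet_derivative f (at x) (axis i 1)"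

definition partials :: "'n list \<Rightarrow> (real ^ 'n \<Rightarrow> complex) \<Rightarrow> real ^ 'n \<Rightarrow> complex" where
  "partials is f = foldr partial_deriv is f"

text \<open>The first conjunct says that \<open>f\<close> is infinitely differentiable: all iterated partial
  derivatives exist, and being differentiable they are in particular continuous. The second
  one is rapid decay of every derivative.\<close>

definition schwartz :: "(real ^ 'n \<Rightarrow> complex) \<Rightarrow> bool" where
  "schwartz f \<longleftrightarrow>
     (\<forall>is. partials is f differentiable_on UNIV) \<and>
     (\<forall>is k. \<exists>B. \<forall>x. norm x ^ k * norm (partials is f x) \<le> B)"

definition fourier :: "(real ^ 'n \<Rightarrow> complex) \<Rightarrow> real ^ 'n \<Rightarrow> complex" where
  "fourier f \<xi> = (LINT x|lborel. exp (- 2 * of_real pi * \<i> * of_real (x \<bullet> \<xi>)) * f x)"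

definition bochner_riesz ::
    "real \<Rightarrow> (real ^ 'n \<Rightarrow> complex) \<Rightarrow> (real ^ 'n \<Rightarrow> complex) \<Rightarrow> real ^ 'n \<Rightarrow> complex" where
  "bochner_riesz \<delta> f g x =
     (LINT (\<xi>, \<eta>):{(\<xi>, \<eta>). (norm \<xi>)\<^sup>2 + (norm \<eta>)\<^sup>2 \<le> 1}|lborel.
        of_real ((1 - (norm \<xi>)\<^sup>2 - (norm \<eta>)\<^sup>2) powr \<delta>) * fourier f \<xi> * fourier g \<eta> *
        exp (2 * of_real pi * \<i> * of_real (x \<bullet> (\<xi> + \<eta>))))"

text \<open>The (quasi-)norm of \<open>L\<^sup>p\<close> for \<open>0 < p < \<infinity>\<close>. It takes the value \<open>\<infinity>\<close> on functions
  outside \<open>L\<^sup>p\<close>, so that an upper bound by a finite quantity implies membership.\<close>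

definition Lp_norm :: "real \<Rightarrow> (real ^ 'n \<Rightarrow> complex) \<Rightarrow> ennreal" where
  "Lp_norm p f =
     (let I = (\<integral>\<^sup>+ x. ennreal (norm (f x) powr p) \<partial>lborel)
      in if I = \<infinity> then \<infinity> else ennreal (enn2real I powr (1 / p)))"

definition Lp_bounded ::
    "((real ^ 'n \<Rightarrow> complex) \<Rightarrow> (real ^ 'n \<Rightarrow> complex) \<Rightarrow> real ^ 'n \<Rightarrow> complex) \<Rightarrow>
     real \<Rightarrow> real \<Rightarrow> real \<Rightarrow> bool" where
  "Lp_bounded T p1 p2 p \<longleftrightarrow>
     (\<exists>C\<ge>0. \<forall>f g. schwartz f \<longrightarrow> schwartz g \<longrightarrow>
        Lp_norm p (T f g) \<le> ennreal C * Lp_norm p1 f * Lp_norm p2 g)"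

definition a_exp :: "nat \<Rightarrow> real" where
  "a_exp n = (real n + 1) / (2 * real n)"

definition b_exp :: "nat \<Rightarrow> real" where
  "b_exp n = (real n + 1) / (2 * real n) + (real n - 1) / ((real n)\<^sup>2 + real n)"

text \<open>For \<open>n \<ge> 2\<close> and \<open>1 \<le> p1, p2 < 2n/(n+1)\<close> exactly one of the four cases applies;
  the value elsewhere is irrelevant.\<close>

definition alpha :: "nat \<Rightarrow> real \<Rightarrow> real \<Rightarrow> real" where
  "alpha n p1 p2 =
     (let lo = {a_exp n <..< b_exp n}; hi = {b_exp n .. 1} in
      if 1 / p1 \<in> lo \<and> 1 / p2 \<in> lo then 4 / (real n + 1)
      else if 1 / p1 \<in> lo \<and> 1 / p2 \<in> hi
        then 2 / (real n + 1) - (real n - 1) / (2 * real n) + 1 / p2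
      else if 1 / p1 \<in> hi \<and> 1 / p2 \<in> lo
        then 2 / (real n + 1) - (real n - 1) / (2 * real n) + 1 / p1
      else if 1 / p1 \<in> hi \<and> 1 / p2 \<in> hi
        then 1 / p1 + 1 / p2 - (real n - 1) / real n
      else undefined)"

end

theory Submission
  imports Defs "HOL-Probability.Probability"
begin

text \<open>
  In each of the four cases the hypothesis implies \<open>\<delta> > n (1/p - 1) > 1\<close>, and with
  \<open>1 \<le> p1, p2 \<le> 2\<close> only this is used. Laplace inversion writes \<open>(1 - |\<xi>|\<^sup>2 - |\<eta>|\<^sup>2)\<close> to the power \<open>\<delta>\<close>, cut off at
  0, as an integral of \<open>e\<^sup>z exp (- z |\<xi>|\<^sup>2) exp (- z |\<eta>|\<^sup>2)\<close> over \<open>z = 1 - it\<close> with a weight of size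
  \<open>|z|\<close> to the power \<open>- \<delta> - 1\<close>. Hence \<open>S(f, g)\<close> is a superposition of products \<open>V f \<cdot> V g\<close>, where
  \<open>V\<close> is the Gaussian multiplier with parameter \<open>z\<close>; its kernel is an explicit complex Gaussian
  living at scale \<open>R = |z|\<close>.

  An exact computation of \<open>V*wV\<close> for a Gaussian weight \<open>w\<close> at scale \<open>R\<close> shows that its kernel decays
  at scale 1, uniformly in \<open>z\<close>; this is the only place where the oscillation of the kernel is used.
  It gives an estimate of \<open>V f\<close> in \<open>L\<^sup>2\<close> on balls of radius \<open>R\<close> by the \<open>L\<^sup>q\<close> norm of \<open>f\<close> near that
  ball. For \<open>t\<close> in a dyadic block \<open>|z| \<sim> R\<close>, Jensen's inequality on balls of radius \<open>R\<close> passes from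
  \<open>L\<^sup>p\<close> to \<open>L\<^sup>1\<close> at the cost of \<open>R\<close> to the power \<open>n (1/p - 1)\<close>, the Cauchy-Schwarz and Hoelder
  inequalities finish the block, and the weight contributes \<open>R\<close> to the power \<open>- \<delta>\<close>, so that the
  blocks sum geometrically.
\<close>

section \<open>Complex Gaussian integrals\<close>

text \<open>The obstacle is the target space: here \<open>p < 1\<close>, so L^p has neither a
  triangle inequality nor duality, and a superposition over \<open>t\<close> cannot be estimated by
  integrating its quasi-norm. On a ball of radius R the L^1 norm controls the quasi-norm, and the
  integral over \<open>t\<close> may then be taken outside; the volume factor paid for this is what
  fixes the threshold. The radius |z| is forced: it is the width of the kernel of V, so a ball of
  that radius sees f only near itself. The local L^2 estimate is needed for all q between 1 and 2.
  The size of the kernel alone yields q = 1 without loss, but not q = 2, where cancellation is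
  required. The correlation kernel of \<open>V*wV\<close> serves both ends at once: uniformly in z
  it is bounded (for q = 1) and integrable (for q = 2). The weight is a Gaussian rather than a
  cutoff because the correlation is then again a Gaussian integral, with a closed form that needs no
  stationary phase.\<close>

lemma norm_exp_ii_diff_le:
  "norm (exp (\<i> * of_real s) - exp (\<i> * of_real t)) \<le> \<bar>s - t\<bar>"
proof -
  have "norm (exp (\<i> * of_real s) - exp (\<i> * of_real t))
      = norm (exp (\<i> * of_real t) * (exp (\<i> * of_real (s - t)) - 1))"
    by (simp add: algebra_simps flip: exp_add)
  also have "\<dots> = norm (exp (\<i> * of_real (s - t)) - 1)"
    by (simp add: norm_mult del: of_real_diff)
  also have "\<dots> \<le> \<bar>s - t\<bar>"
    using iexp_approx1[of "s - t" 0] by simp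
  finally show ?thesis .
qed

text \<open>Differentiation under the integral sign by dominated convergence: the first-order
  remainder divided by \<open>\<bar>s - t\<bar>\<close> is at most 2|q||h|. It serves twice, each
  time to derive a linear differential equation that takes the place of a contour shift.\<close>

lemma has_vector_derivative_integral_exp_ii:
  fixes h :: "'a \<Rightarrow> complex" and q :: "'a \<Rightarrow> real"
  assumes q [measurable]: "q \<in> borel_measurable M" and h: "integrable M h"
    and qh: "integrable M (\<lambda>x. of_real (q x) * h x)"
  shows "((\<lambda>t. \<integral>x. exp (\<i> * of_real (t * q x)) * h x \<partial>M) has_vector_derivative
          (\<integral>x. \<i> * of_real (q x) * (exp (\<i> * of_real (t * q x)) * h x) \<partial>M)) (at t)"
proof -
  have [measurable]: "h \<in> borel_measurable M" using h by auto
  define e where "e t x = exp (\<i> * of_real (t * q x))" for t x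
  have e [measurable]: "e t \<in> borel_measurable M" for t unfolding e_def by measurable
  have int: "integrable M (\<lambda>x. e t x * h x)" for t
    by (rule Bochner_Integration.integrable_bound[OF h]) (auto simp: norm_mult e_def simp del: of_real_mult)
  have int': "integrable M (\<lambda>x. \<i> * of_real (q x) * (e t x * h x))" for t
    by (rule Bochner_Integration.integrable_bound[OF qh])
       (auto simp: norm_mult e_def simp del: of_real_mult)
  \<comment> \<open>The normalised first-order remainder of the integrand; differentiability says
    that its integral tends to 0.\<close>
  define g where "g s x = (e s x * h x - e t x * h x
      - (s - t) *\<^sub>R (\<i> * of_real (q x) * (e t x * h x))) /\<^sub>R \<bar>s - t\<bar>" for s x
  have g_alt: "g s x = (((e s x - e t x) - (s - t) *\<^sub>R (\<i> * of_real (q x) * e t x)) /\<^sub>R \<bar>s - t\<bar>) * h x" for s x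
    unfolding g_def by (simp add: algebra_simps)
  have eq: "((\<integral>x. e s x * h x \<partial>M) - (\<integral>x. e t x * h x \<partial>M)
         - (s - t) *\<^sub>R (\<integral>x. \<i> * of_real (q x) * (e t x * h x) \<partial>M)) /\<^sub>R \<bar>s - t\<bar> = (\<integral>x. g s x \<partial>M)" for s
    unfolding g_def integral_scaleR_right
    by (subst Bochner_Integration.integral_diff
         | intro Bochner_Integration.integrable_diff integrable_scaleR_right int int' refl
         | simp only: integral_scaleR_right)+
  have lim: "((\<lambda>s. \<integral>x. g s x \<partial>M) \<longlongrightarrow> (\<integral>x. 0 \<partial>M)) (at t)"
    unfolding tendsto_at_iff_sequentially comp_def
  proof (intro allI impI)
    fix X :: "nat \<Rightarrow> real" assume X: "\<forall>i. X i \<in> UNIV - {t}" and Xt: "X \<longlonglongrightarrow> t"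
    show "(\<lambda>n. \<integral>x. g (X n) x \<partial>M) \<longlonglongrightarrow> (\<integral>x. 0 \<partial>M)"
    proof (rule integral_dominated_convergence)
      show "integrable M (\<lambda>x. 2 * norm (of_real (q x) * h x))" using qh by auto
      show "g (X n) \<in> borel_measurable M" for n unfolding g_def by measurable
      show "AE x in M. norm (g (X n) x) \<le> 2 * norm (of_real (q x) * h x)" for n
      proof (rule AE_I2)
        fix x
        have ne: "\<bar>X n - t\<bar> > 0" using X by auto
        have "norm ((e (X n) x - e t x) - (X n - t) *\<^sub>R (\<i> * of_real (q x) * e t x))
            \<le> norm (e (X n) x - e t x) + norm ((X n - t) *\<^sub>R (\<i> * of_real (q x) * e t x))"
          by (rule norm_triangle_ineq4)
        also have "\<dots> \<le> \<bar>X n * q x - t * q x\<bar> + \<bar>X n - t\<bar> * \<bar>q x\<bar>"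
          unfolding e_def
          by (intro add_mono norm_exp_ii_diff_le) (simp add: norm_mult del: of_real_mult of_real_diff)
        also have "\<dots> = \<bar>X n - t\<bar> * (2 * \<bar>q x\<bar>)" by (simp add: abs_mult flip: left_diff_distrib)
        finally have "norm (((e (X n) x - e t x) - (X n - t) *\<^sub>R (\<i> * of_real (q x) * e t x)) /\<^sub>R \<bar>X n - t\<bar>)
           \<le> 2 * \<bar>q x\<bar>"
          using ne by (simp only: norm_scaleR abs_inverse abs_abs)
            (simp add: inverse_eq_divide pos_divide_le_eq mult.commute)
        then show "norm (g (X n) x) \<le> 2 * norm (of_real (q x) * h x)"
          unfolding g_alt norm_mult by (simp add: mult_right_mono mult.assoc[symmetric])
      qed
      show "AE x in M. (\<lambda>n. g (X n) x) \<longlonglongrightarrow> 0"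
      proof (rule AE_I2)
        fix x
        have "((\<lambda>s. e s x) has_vector_derivative (\<i> * of_real (q x) * e t x)) (at t)"
          unfolding e_def
          by (rule has_vector_derivative_eq_rhs, rule field_vector_diff_chain_at[unfolded o_def, OF _ DERIV_exp])
             (auto intro!: derivative_eq_intros simp: has_vector_derivative_complex_iff)
        then have "((\<lambda>s. ((e s x - e t x) - (s - t) *\<^sub>R (\<i> * of_real (q x) * e t x)) /\<^sub>R \<bar>s - t\<bar>) \<longlongrightarrow> 0) (at t)"
          unfolding has_vector_derivative_def has_derivative_at_within by simp
        then have "((\<lambda>s. g s x) \<longlongrightarrow> 0 * h x) (at t)"
          unfolding g_alt by (rule tendsto_mult_right)
        then show "(\<lambda>n. g (X n) x) \<longlonglongrightarrow> 0"
          using X Xt unfolding tendsto_at_iff_sequentially comp_def by auto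
      qed
    qed auto
  qed
  show ?thesis
    unfolding has_vector_derivative_def has_derivative_at_within
    using lim eq by (auto simp: bounded_linear_scaleR_left e_def)
qed

text \<open>Integration by parts on the line: with \<open>F\<close> a polynomial times a Gaussian,
  the vanishing boundary values turn into a linear relation between Gaussian moments.\<close>

lemma lborel_integral_derivative_eq_0:
  fixes F f :: "real \<Rightarrow> complex"
  assumes "\<And>x. (F has_vector_derivative f x) (at x)" "\<And>x. isCont f x" "integrable lborel f"
    and "(F \<longlongrightarrow> 0) at_top" "(F \<longlongrightarrow> 0) at_bot"
  shows "(\<integral>x. f x \<partial>lborel) = 0"
proof -
  have "(LBINT x=-\<infinity>..\<infinity>. f x) = 0 - 0"
    using assms by (intro interval_integral_FTC_integrable)
      (auto simp: ereal_tendsto_simps set_integrable_def simp del: o_apply)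
  then show ?thesis
    by (simp add: interval_integral_to_infinity_eq interval_lebesgue_integral_def set_lebesgue_integral_def)
qed

section \<open>Gaussian integrals on the line\<close>

lemma exp_quadratic_eq_normal_density:
  fixes r c y :: real
  assumes "r > 0"
  shows "exp (- r * y\<^sup>2 + c * y)
    = sqrt (pi / r) * exp (c\<^sup>2 / (4 * r)) * normal_density (c / (2 * r)) (1 / sqrt (2 * r)) y"
proof -
  have "- r * y\<^sup>2 + c * y = c\<^sup>2 / (4 * r) + - ((y - c / (2 * r))\<^sup>2 / (2 * (1 / sqrt (2 * r))\<^sup>2))"
    using assms by (simp add: power_divide field_simps power2_eq_square)
  moreover have "sqrt (pi / r) * (1 / sqrt (2 * pi * (1 / sqrt (2 * r))\<^sup>2)) = 1"
    using assms by (simp add: power_divide real_sqrt_divide)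
  moreover from calculation(1) have "exp (- r * y\<^sup>2 + c * y)
      = exp (c\<^sup>2 / (4 * r)) * exp (- ((y - c / (2 * r))\<^sup>2 / (2 * (1 / sqrt (2 * r))\<^sup>2)))"
    by (metis exp_add)
  ultimately show ?thesis
    unfolding normal_density_def by (simp add: field_simps)
qed

lemma integrable_power_exp_quadratic:
  fixes r c :: real
  assumes "r > 0"
  shows "integrable lborel (\<lambda>y. y ^ k * exp (- r * y\<^sup>2 + c * y))"
proof -
  define \<mu> \<sigma> where "\<mu> = c / (2 * r)" and "\<sigma> = 1 / sqrt (2 * r)"
  have "\<sigma> > 0" using assms by (simp add: \<sigma>_def)
  \<comment> \<open>The moments of the normal distribution are known about its mean, so
    \<open>y ^ k\<close> is expanded binomially around \<open>\<mu>\<close>.\<close>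
  have "integrable lborel (\<lambda>y. y ^ k * normal_density \<mu> \<sigma> y)"
  proof (rule Bochner_Integration.integrable_cong[THEN iffD1, OF refl])
    show "integrable lborel (\<lambda>y. \<Sum>i\<le>k. of_nat (k choose i) * \<mu> ^ (k - i)
        * (normal_density \<mu> \<sigma> y * (y - \<mu>) ^ i))"
      using integrable_normal_moment[OF \<open>\<sigma> > 0\<close>] by (intro Bochner_Integration.integrable_sum integrable_mult_right) 
    show "(\<Sum>i\<le>k. of_nat (k choose i) * \<mu> ^ (k - i) * (normal_density \<mu> \<sigma> y * (y - \<mu>) ^ i))
       = y ^ k * normal_density \<mu> \<sigma> y" for y
      using binomial_ring[of "y - \<mu>" \<mu> k] by (simp add: sum_distrib_left mult_ac)
  qed
  then have "integrable lborel (\<lambda>y. sqrt (pi / r) * exp (c\<^sup>2 / (4 * r)) * (y ^ k * normal_density \<mu> \<sigma> y))"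
    by (rule integrable_mult_right)
  then show ?thesis
    unfolding exp_quadratic_eq_normal_density[OF assms, of _ c] \<mu>_def \<sigma>_def by (simp add: mult_ac)
qed

lemma integral_exp_quadratic_real:
  fixes r c :: real
  assumes "r > 0"
  shows "(\<integral>y. exp (- r * y\<^sup>2 + c * y) \<partial>lborel) = sqrt (pi / r) * exp (c\<^sup>2 / (4 * r))"
  unfolding exp_quadratic_eq_normal_density[OF assms] using assms by simp

context
  fixes z w :: complex
  assumes z: "Re z > 0"
begin

lemma norm_exp_quadratic: "norm (exp (- z * of_real (y\<^sup>2) + w * of_real y)) = exp (- Re z * y\<^sup>2 + Re w * y)"
  by (simp add: norm_exp_eq_Re)

lemma integrable_power_exp_quadratic_complex:
  "integrable lborel (\<lambda>y. of_real (y ^ k) * exp (- z * of_real (y\<^sup>2) + w * of_real y))"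
  by (rule Bochner_Integration.integrable_bound[OF integrable_power_exp_quadratic[OF z, of k "Re w"]])
     (auto simp: norm_mult norm_power norm_exp_quadratic abs_mult power_abs simp del: of_real_power)

lemma tendsto_power_exp_quadratic:
  "((\<lambda>y. of_real (y ^ k) * exp (- z * of_real (y\<^sup>2) + w * of_real y)) \<longlongrightarrow> 0) at_top"
  "((\<lambda>y. of_real (y ^ k) * exp (- z * of_real (y\<^sup>2) + w * of_real y)) \<longlongrightarrow> 0) at_bot"
proof -
  define r c where "r = Re z" and "c = Re w"
  have r: "r > 0" using z by (simp add: r_def)
  have norm_eq: "norm (of_real (y ^ k) * exp (- z * of_real (y\<^sup>2) + w * of_real y)) = norm (y ^ k * exp (- r * y\<^sup>2 + c * y))" for y
    unfolding norm_mult norm_exp_quadratic r_def c_def by (simp add: norm_power power_abs)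
  show "((\<lambda>y. of_real (y ^ k) * exp (- z * of_real (y\<^sup>2) + w * of_real y)) \<longlongrightarrow> 0) at_top"
    by (subst tendsto_norm_zero_iff[symmetric], subst norm_eq, rule tendsto_norm_zero) (use r in real_asymp)
  show "((\<lambda>y. of_real (y ^ k) * exp (- z * of_real (y\<^sup>2) + w * of_real y)) \<longlongrightarrow> 0) at_bot"
    by (subst tendsto_norm_zero_iff[symmetric], subst norm_eq, rule tendsto_norm_zero) (use r in real_asymp)
qed

lemma has_vector_derivative_exp_quadratic:
  "((\<lambda>y. exp (- z * of_real (y\<^sup>2) + w * of_real y)) has_vector_derivative
    (w - 2 * z * of_real y) * exp (- z * of_real (y\<^sup>2) + w * of_real y)) (at y)"
proof -
  have "((\<lambda>y. exp (- z * y\<^sup>2 + w * y)) has_field_derivative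
     (w - 2 * z * of_real y) * exp (- z * (of_real y)\<^sup>2 + w * of_real y)) (at (of_real y))"
    by (auto intro!: derivative_eq_intros simp: algebra_simps)
  from has_vector_derivative_real_field[OF this] show ?thesis by simp
qed

text \<open>The derivatives of E and of y E integrate to 0. The first relation expresses the first
  moment through J, the second one then gives the second moment.\<close>

lemma integral_exp_quadratic_moments:
  defines "E \<equiv> (\<lambda>y::real. exp (- z * of_real (y\<^sup>2) + w * of_real y))"
  defines "J \<equiv> (\<integral>y. E y \<partial>lborel)"
  shows "(\<integral>y. of_real y * E y \<partial>lborel) = w / (2 * z) * J"
    and "(\<integral>y. of_real (y\<^sup>2) * E y \<partial>lborel) = (1 / (2 * z) + w\<^sup>2 / (4 * z\<^sup>2)) * J"
proof -
  have z0: "z \<noteq> 0" using z by auto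
  have int: "integrable lborel E" "integrable lborel (\<lambda>y. of_real y * E y)" "integrable lborel (\<lambda>y. of_real (y\<^sup>2) * E y)"
    using integrable_power_exp_quadratic_complex[of 0] integrable_power_exp_quadratic_complex[of 1]
     integrable_power_exp_quadratic_complex[of 2] unfolding E_def by simp_all
  have lim: "(E \<longlongrightarrow> 0) at_top" "(E \<longlongrightarrow> 0) at_bot" 
     "((\<lambda>y. of_real y * E y) \<longlongrightarrow> 0) at_top" "((\<lambda>y. of_real y * E y) \<longlongrightarrow> 0) at_bot" 
    using tendsto_power_exp_quadratic[of 0] tendsto_power_exp_quadratic[of 1] unfolding E_def by simp_all
  have cont: "isCont E y" for y unfolding E_def by (intro continuous_intros)
  have d: "(E has_vector_derivative (w - 2 * z * of_real y) * E y) (at y)" for y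
    unfolding E_def by (rule has_vector_derivative_exp_quadratic)
  have "(\<integral>y. w * E y - 2 * z * (of_real y * E y) \<partial>lborel) = 0"
  proof (rule lborel_integral_derivative_eq_0[of E])
    show "(E has_vector_derivative w * E y - 2 * z * (of_real y * E y)) (at y)" for y
      using d[of y] by (simp add: algebra_simps)
    show "integrable lborel (\<lambda>y. w * E y - 2 * z * (of_real y * E y))"
      by (intro Bochner_Integration.integrable_diff integrable_mult_right int)
  qed (intro lim continuous_intros cont)+
  then have 1: "w * J - 2 * z * (\<integral>y. of_real y * E y \<partial>lborel) = 0"
    using int unfolding J_def by (subst (asm) Bochner_Integration.integral_diff) auto
  then show 1: "(\<integral>y. of_real y * E y \<partial>lborel) = w / (2 * z) * J"
    using z0 by (simp add: field_simps)
  have d2: "((\<lambda>y. of_real y * E y) has_vector_derivative (of_real y * ((w - 2 * z * of_real y) * E y) + 1 * E y)) (at y)" for y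
    by (rule has_vector_derivative_mult[OF _ d]) (auto simp: has_vector_derivative_complex_iff)
  have "(\<integral>y. E y + (w * (of_real y * E y) - 2 * z * (of_real (y\<^sup>2) * E y)) \<partial>lborel) = 0"
  proof (rule lborel_integral_derivative_eq_0[of "\<lambda>y. of_real y * E y"])
    show "((\<lambda>y. of_real y * E y) has_vector_derivative
        E y + (w * (of_real y * E y) - 2 * z * (of_real (y\<^sup>2) * E y))) (at y)" for y
      using d2[of y] by (simp add: algebra_simps power2_eq_square)
    show "integrable lborel (\<lambda>y. E y + (w * (of_real y * E y) - 2 * z * (of_real (y\<^sup>2) * E y)))"
      by (intro Bochner_Integration.integrable_add Bochner_Integration.integrable_diff integrable_mult_right int)
  qed (intro lim continuous_intros cont)+
  then have "J + (w * (\<integral>y. of_real y * E y \<partial>lborel) - 2 * z * (\<integral>y. of_real (y\<^sup>2) * E y \<partial>lborel)) = 0"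
    using int unfolding J_def 
    by (subst (asm) Bochner_Integration.integral_add, (auto)[2], subst (asm) Bochner_Integration.integral_diff) auto
  then show "(\<integral>y. of_real (y\<^sup>2) * E y \<partial>lborel) = (1 / (2 * z) + w\<^sup>2 / (4 * z\<^sup>2)) * J"
    using z0 unfolding 1 by (simp add: field_simps power2_eq_square)
qed

end

text \<open>Instead of shifting a contour, the imaginary parts of z and w are switched on along a
  segment, from the real Gaussian at t = 0 to the wanted one at t = 1. The moments turn the
  t-derivative of the integral into a multiple of the integral itself. Along the segment the real
  part stays positive, so \<open>csqrt\<close> never meets its branch cut.\<close>

lemma integral_exp_quadratic:
  fixes z w :: complex
  assumes z: "Re z > 0"
  shows "(\<integral>y. exp (- z * of_real (y\<^sup>2) + w * of_real y) \<partial>lborel)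
       = of_real (sqrt pi) / csqrt z * exp (w\<^sup>2 / (4 * z))"
proof -
  have alg1: "((- (of_nat 2 * (\<i> * w2 * b ^ (2 - Suc 0)))) * (4 * a) - (- b\<^sup>2) * (4 * (\<i> * s))) / (4 * a * (4 * a))
      = - (2 * b * (\<i> * w2)) / (4 * a) + b\<^sup>2 * (\<i> * s) / (4 * a\<^sup>2)" if "a \<noteq> 0" for a b s w2 :: complex
    using that by (simp add: field_simps power2_eq_square)
  have alg2: "s * \<i> / (2 * a) * C * X + X * (- (2 * b * (\<i> * w2)) / (4 * a) + b\<^sup>2 * (\<i> * s) / (4 * a\<^sup>2)) * C
      = - \<i> * (- s * (1 / (2 * a) + b\<^sup>2 / (4 * a\<^sup>2)) + w2 * (b / (2 * a))) * (C * X)" for a b C X s w2 :: complex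
  proof -
    have "s * \<i> / (2 * a) + (- (2 * b * (\<i> * w2)) / (4 * a) + b\<^sup>2 * (\<i> * s) / (4 * a\<^sup>2))
      = - \<i> * (- s * (1 / (2 * a) + b\<^sup>2 / (4 * a\<^sup>2)) + w2 * (b / (2 * a)))"
      by (simp add: algebra_simps add_divide_distrib diff_divide_distrib)
    then show ?thesis by algebra
  qed
  define r s w1 w2 where "r = Re z" and "s = Im z" and "w1 = Re w" and "w2 = Im w"
  define Z W where "Z t = of_real r + \<i> * of_real (t * s)" and "W t = of_real w1 + \<i> * of_real (t * w2)" for t
  have zw: "Z 1 = z" "W 1 = w" by (auto simp: Z_def W_def r_def s_def w1_def w2_def complex_eq_iff)
  have r: "r > 0" using z by (simp add: r_def)
  have Z: "Re (Z t) > 0" for t using r by (simp add: Z_def)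
  have Z': "Z t \<noteq> 0" "Z t \<notin> \<real>\<^sub>\<le>\<^sub>0" for t
    using Z[of t] by (auto simp: complex_nonpos_Reals_iff)
  define h where "h y = exp (- of_real r * of_real (y\<^sup>2) + of_real w1 * of_real y :: complex)" for y
  define q where "q y = - s * y\<^sup>2 + w2 * y" for y
  define E where "E t y = exp (- Z t * of_real (y\<^sup>2) + W t * of_real y)" for t y
  define J where "J t = (\<integral>y. E t y \<partial>lborel)" for t
  have E_eq: "E t y = exp (\<i> * of_real (t * q y)) * h y" for t y
    unfolding E_def h_def q_def Z_def W_def by (simp add: algebra_simps flip: exp_add)
  have hpow: "integrable lborel (\<lambda>y. of_real (y ^ k) * h y)" for k
    unfolding h_def using r by (intro integrable_power_exp_quadratic_complex) auto
  have h: "integrable lborel h" using hpow[of 0] by simp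
  have "integrable lborel (\<lambda>y. - of_real s * (of_real (y ^ 2) * h y) + of_real w2 * (of_real (y ^ 1) * h y))"
    by (intro Bochner_Integration.integrable_add integrable_mult_right hpow)
  then have qh: "integrable lborel (\<lambda>y. of_real (q y) * h y)"
    unfolding q_def by (simp add: algebra_simps)
  have J': "(J has_vector_derivative
     \<i> * (- of_real s * (1 / (2 * Z t) + (W t)\<^sup>2 / (4 * (Z t)\<^sup>2)) + of_real w2 * (W t / (2 * Z t))) * J t) (at t)" for t
  proof -
    have int: "integrable lborel (\<lambda>y. of_real (y ^ k) * E t y)" for k
      unfolding E_def by (intro integrable_power_exp_quadratic_complex Z)
    have "(J has_vector_derivative (\<integral>y. \<i> * of_real (q y) * (exp (\<i> * of_real (t * q y)) * h y) \<partial>lborel)) (at t)"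
      unfolding J_def[abs_def] E_eq by (rule has_vector_derivative_integral_exp_ii[OF _ h qh]) (simp add: q_def)
    also have "(\<integral>y. \<i> * of_real (q y) * (exp (\<i> * of_real (t * q y)) * h y) \<partial>lborel)
      = (\<integral>y. \<i> * (- of_real s * (of_real (y ^ 2) * E t y) + of_real w2 * (of_real (y ^ 1) * E t y)) \<partial>lborel)"
      unfolding E_eq[symmetric] unfolding q_def by (simp add: algebra_simps)
    also have "\<dots> = \<i> * (- of_real s * (\<integral>y. of_real (y ^ 2) * E t y \<partial>lborel) + of_real w2 * (\<integral>y. of_real (y ^ 1) * E t y \<partial>lborel))"
      unfolding integral_mult_right_zero
      by (subst Bochner_Integration.integral_add) (intro integrable_mult_right int, intro integrable_mult_right int, simp only: integral_mult_right_zero)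
    also have "(\<integral>y. of_real (y ^ 2) * E t y \<partial>lborel) = (1 / (2 * Z t) + (W t)\<^sup>2 / (4 * (Z t)\<^sup>2)) * J t"
      unfolding J_def E_def by (rule integral_exp_quadratic_moments[OF Z])
    also have "(\<integral>y. of_real (y ^ 1) * E t y \<partial>lborel) = W t / (2 * Z t) * J t"
      unfolding J_def E_def power_one_right by (rule integral_exp_quadratic_moments[OF Z])
    finally show ?thesis by (simp add: algebra_simps)
  qed
  \<comment> \<open>\<open>M t\<close> is sqrt(pi) divided by the expected value of
    \<open>J t\<close>, so the claim becomes that \<open>M t * J t\<close> is constant and has the
    right value at t = 0.\<close>
  define M where "M t = csqrt (Z t) * exp (- (W t)\<^sup>2 / (4 * Z t))" for t
  have M': "(M has_vector_derivative
     - \<i> * (- of_real s * (1 / (2 * Z t) + (W t)\<^sup>2 / (4 * (Z t)\<^sup>2)) + of_real w2 * (W t / (2 * Z t))) * M t) (at t)" for t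
  proof -
    \<comment> \<open>The parameter is made complex so that the rules for holomorphic functions
      apply; the result is restricted to real t afterwards.\<close>
    define ZZ where "ZZ u = of_real r + \<i> * (u * of_real s)" for u
    define WW where "WW u = of_real w1 + \<i> * (u * of_real w2)" for u
    have e: "ZZ (of_real t) = Z t" "WW (of_real t) = W t" for t by (auto simp: ZZ_def WW_def Z_def W_def)
    have cs: "of_real s * \<i> / (2 * csqrt (Z t)) = of_real s * \<i> / (2 * Z t) * csqrt (Z t)"
      using Z'[of t] by (simp add: divide_simps) (metis power2_csqrt power2_eq_square)
    have dZ: "(ZZ has_field_derivative \<i> * of_real s) (at u)" and dW: "(WW has_field_derivative \<i> * of_real w2) (at u)" for u
      unfolding ZZ_def WW_def by (auto intro!: derivative_eq_intros)
    have d1: "((\<lambda>u. csqrt (ZZ u)) has_field_derivative of_real s * \<i> / (2 * Z t) * csqrt (Z t)) (at (of_real t))"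
    proof (rule DERIV_cong[OF has_field_derivative_csqrt'[OF dZ]])
      show "ZZ (of_real t) \<notin> \<real>\<^sub>\<le>\<^sub>0" unfolding e by (rule Z')
      show "\<i> * of_real s / (2 * csqrt (ZZ (of_real t))) = of_real s * \<i> / (2 * Z t) * csqrt (Z t)"
        unfolding e cs[symmetric] by (simp only: mult.commute)
    qed
    have d20: "((\<lambda>u. - (WW u)\<^sup>2 / (4 * ZZ u)) has_field_derivative
       ((- (of_nat 2 * (\<i> * of_real w2 * WW (of_real t) ^ (2 - Suc 0)))) * (4 * ZZ (of_real t))
         - (- (WW (of_real t))\<^sup>2) * (4 * (\<i> * of_real s))) / (4 * ZZ (of_real t) * (4 * ZZ (of_real t)))) (at (of_real t))"
      by (intro DERIV_divide DERIV_minus DERIV_power DERIV_cmult dZ dW) (simp add: e Z')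
    have e20: "((- (of_nat 2 * (\<i> * of_real w2 * WW (of_real t) ^ (2 - Suc 0)))) * (4 * ZZ (of_real t))
         - (- (WW (of_real t))\<^sup>2) * (4 * (\<i> * of_real s))) / (4 * ZZ (of_real t) * (4 * ZZ (of_real t)))
      = - (2 * W t * (\<i> * of_real w2)) / (4 * Z t) + (W t)\<^sup>2 * (\<i> * of_real s) / (4 * (Z t)\<^sup>2)"
      unfolding e by (rule alg1) (rule Z')
    have d2: "((\<lambda>u. exp (- (WW u)\<^sup>2 / (4 * ZZ u))) has_field_derivative
        exp (- (WW (of_real t))\<^sup>2 / (4 * ZZ (of_real t)))
         * (- (2 * W t * (\<i> * of_real w2)) / (4 * Z t) + (W t)\<^sup>2 * (\<i> * of_real s) / (4 * (Z t)\<^sup>2))) (at (of_real t))"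
      by (rule DERIV_fun_exp[OF DERIV_cong[OF d20 e20]])
    have "((\<lambda>u. csqrt (ZZ u) * exp (- (WW u)\<^sup>2 / (4 * ZZ u))) has_field_derivative
      - \<i> * (- of_real s * (1 / (2 * Z t) + (W t)\<^sup>2 / (4 * (Z t)\<^sup>2)) + of_real w2 * (W t / (2 * Z t))) * M t) (at (of_real t))"
      by (rule DERIV_cong[OF DERIV_mult[OF d1 d2]]) (unfold e M_def, rule alg2)
    from has_vector_derivative_real_field[OF this] show ?thesis by (simp add: e M_def[abs_def])
  qed
  have "((\<lambda>t. M t * J t) has_vector_derivative 0) (at t)" for t
  proof (rule has_vector_derivative_eq_rhs[OF has_vector_derivative_mult[OF M' J']])
    have "m * (\<i> * k * j) + (- \<i> * k * m) * j = 0" for m k j :: complex by simp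
    then show "M t * (\<i> * (- of_real s * (1 / (2 * Z t) + (W t)\<^sup>2 / (4 * (Z t)\<^sup>2)) + of_real w2 * (W t / (2 * Z t))) * J t)
      + (- \<i> * (- of_real s * (1 / (2 * Z t) + (W t)\<^sup>2 / (4 * (Z t)\<^sup>2)) + of_real w2 * (W t / (2 * Z t))) * M t) * J t = 0" .
  qed
  then obtain c where c: "\<And>t. t \<in> UNIV \<Longrightarrow> M t * J t = c"
    by (rule has_vector_derivative_zero_constant[OF convex_UNIV has_vector_derivative_at_within]) blast+
  have "M 1 * J 1 = M 0 * J 0" using c[of 0] c[of 1] by simp
  also have "J 0 = of_real (sqrt (pi / r) * exp (w1\<^sup>2 / (4 * r)))"
  proof -
    have "J 0 = (\<integral>y. of_real (exp (- r * y\<^sup>2 + w1 * y)) \<partial>lborel)"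
      unfolding J_def E_def Z_def W_def by (simp flip: exp_of_real)
    then show ?thesis using integral_exp_quadratic_real[OF r] by simp
  qed
  also have "M 0 = of_real (sqrt r * exp (- (w1\<^sup>2 / (4 * r))))"
    unfolding M_def Z_def W_def using r by (simp add: csqrt_of_real_nonneg flip: exp_of_real)
  also have "of_real (sqrt r * exp (- (w1\<^sup>2 / (4 * r)))) * of_real (sqrt (pi / r) * exp (w1\<^sup>2 / (4 * r)))
      = (of_real (sqrt pi) :: complex)"
    using r by (simp add: exp_minus real_sqrt_divide field_simps flip: of_real_mult)
  finally have "M 1 * J 1 = of_real (sqrt pi)" .
  then have "J 1 = of_real (sqrt pi) / csqrt z * exp (w\<^sup>2 / (4 * z))"
    using Z'[of 1] unfolding M_def zw by (simp add: exp_minus field_simps)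
  then show ?thesis unfolding J_def E_def zw .
qed

section \<open>Gaussian integrals on Euclidean space\<close>

lemma
  fixes f :: "'a::euclidean_space \<Rightarrow> real \<Rightarrow> 'b::{real_normed_field,banach,second_countable_topology}"
  assumes f: "\<And>b. b \<in> Basis \<Longrightarrow> integrable lborel (f b)"
  shows integrable_lborel_prod: "integrable lborel (\<lambda>x::'a. \<Prod>b\<in>Basis. f b (x \<bullet> b))"
    and integral_lborel_prod: "(\<integral>x. (\<Prod>b\<in>Basis. f b (x \<bullet> b)) \<partial>lborel) = (\<Prod>b\<in>Basis. \<integral>y. f b y \<partial>lborel)"
proof -
  interpret product_sigma_finite "\<lambda>b::'a. lborel :: real measure"
    by standard
  have [measurable]: "f b \<in> borel_measurable borel" if "b \<in> Basis" for b
    using f[OF that] by auto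
  have meas: "(\<lambda>x. \<Prod>b\<in>Basis. f b (x \<bullet> b)) \<in> borel_measurable (borel :: 'a measure)"
    by measurable
  have eq: "(\<Prod>b\<in>Basis. f b ((\<Sum>c\<in>Basis. g c *\<^sub>R c) \<bullet> b)) = (\<Prod>b\<in>Basis. f b (g b))" for g :: "'a \<Rightarrow> real"
    by (intro prod.cong) auto
  have m: "(\<lambda>g. \<Sum>c\<in>Basis. g c *\<^sub>R c) \<in> (\<Pi>\<^sub>M b\<in>Basis. lborel) \<rightarrow>\<^sub>M (borel :: 'a measure)"
    by measurable
  show "integrable lborel (\<lambda>x::'a. \<Prod>b\<in>Basis. f b (x \<bullet> b))"
    by (subst lborel_eq, subst integrable_distr_eq[OF m meas]) (simp add: eq product_integrable_prod f)
  show "(\<integral>x. (\<Prod>b\<in>Basis. f b (x \<bullet> b)) \<partial>lborel) = (\<Prod>b\<in>Basis. \<integral>y. f b y \<partial>lborel)"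
    by (subst lborel_eq, subst integral_distr[OF m meas]) (simp add: eq product_integral_prod f)
qed

context
  fixes z :: complex and c d :: "'a::euclidean_space"
  assumes z: "Re z > 0"
begin

text \<open>\<open>Complex (c \<bullet> y) (d \<bullet> y)\<close> stands for the linear form with
  complex coefficient vector c + i d. Accordingly the exponent in the value of the integral contains
  the bilinear, not the Hermitian, square of that vector, which is |c|^2 - |d|^2 + 2i (c .
  d).\<close>

lemma exp_quadratic_eq_prod:
  "exp (- z * of_real ((norm y)\<^sup>2) + Complex (c \<bullet> y) (d \<bullet> y))
     = (\<Prod>b\<in>Basis. exp (- z * of_real ((y \<bullet> b)\<^sup>2) + Complex (c \<bullet> b) (d \<bullet> b) * of_real (y \<bullet> b)))"
proof -
  have "(norm y)\<^sup>2 = (\<Sum>b\<in>Basis. (y \<bullet> b)\<^sup>2)"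
    unfolding power2_norm_eq_inner by (subst euclidean_inner) (simp add: power2_eq_square)
  moreover have "Complex (c \<bullet> y) (d \<bullet> y) = (\<Sum>b\<in>Basis. Complex (c \<bullet> b) (d \<bullet> b) * of_real (y \<bullet> b))"
    by (subst (1 2) euclidean_inner) (simp add: complex_eq_iff)
  ultimately show ?thesis
    by (simp add: exp_sum[symmetric] sum_subtractf sum_distrib_left sum_negf del: of_real_power)
qed

lemma integrable_exp_quadratic_euclidean:
  "integrable lborel (\<lambda>y::'a. exp (- z * of_real ((norm y)\<^sup>2) + Complex (c \<bullet> y) (d \<bullet> y)))"
  unfolding exp_quadratic_eq_prod
  using integrable_power_exp_quadratic_complex[OF z, of 0]
  by (intro integrable_lborel_prod[of "\<lambda>b y. exp (- z * of_real (y\<^sup>2) + Complex (c \<bullet> b) (d \<bullet> b) * of_real y)"]) simp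

lemma integral_exp_quadratic_euclidean:
  "(\<integral>y. exp (- z * of_real ((norm y)\<^sup>2) + Complex (c \<bullet> y) (d \<bullet> y)) \<partial>lborel)
    = (of_real (sqrt pi) / csqrt z) ^ DIM('a) * exp (Complex ((norm c)\<^sup>2 - (norm d)\<^sup>2) (2 * (c \<bullet> d)) / (4 * z))"
proof -
  have "(\<integral>y. exp (- z * of_real ((norm y)\<^sup>2) + Complex (c \<bullet> y) (d \<bullet> y)) \<partial>lborel)
     = (\<Prod>b\<in>(Basis::'a set). \<integral>y. exp (- z * of_real (y\<^sup>2) + Complex (c \<bullet> b) (d \<bullet> b) * of_real y) \<partial>lborel)"
    unfolding exp_quadratic_eq_prod
    using integrable_power_exp_quadratic_complex[OF z, of 0]
    by (intro integral_lborel_prod[of "\<lambda>b y. exp (- z * of_real (y\<^sup>2) + Complex (c \<bullet> b) (d \<bullet> b) * of_real y)"]) simp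
  also have "\<dots> = (of_real (sqrt pi) / csqrt z) ^ DIM('a) * exp (\<Sum>b\<in>(Basis::'a set). (Complex (c \<bullet> b) (d \<bullet> b))\<^sup>2 / (4 * z))"
    unfolding integral_exp_quadratic[OF z] by (simp add: prod.distrib exp_sum power_divide prod_dividef)
  also have "(\<Sum>b\<in>(Basis::'a set). (Complex (c \<bullet> b) (d \<bullet> b))\<^sup>2 / (4 * z))
    = Complex ((norm c)\<^sup>2 - (norm d)\<^sup>2) (2 * (c \<bullet> d)) / (4 * z)"
  proof -
    have "Complex ((norm c)\<^sup>2 - (norm d)\<^sup>2) (2 * (c \<bullet> d)) = (\<Sum>b\<in>(Basis::'a set). (Complex (c \<bullet> b) (d \<bullet> b))\<^sup>2)"
      unfolding power2_norm_eq_inner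
      by (subst (1 2 3) euclidean_inner) (simp add: complex_eq_iff power2_eq_square sum_subtractf sum_distrib_left mult_ac)
    then show ?thesis by (simp add: sum_divide_distrib)
  qed
  finally show ?thesis .
qed

end

section \<open>Fourier inversion and the Laplace representation of a power\<close>

lemma integrable_lborel_pair_mult:
  fixes f :: "'a::euclidean_space \<Rightarrow> 'c::{real_normed_field,banach,second_countable_topology}"
    and g :: "'b::euclidean_space \<Rightarrow> 'c"
  assumes f: "integrable lborel f" and g: "integrable lborel g"
  shows "integrable (lborel \<Otimes>\<^sub>M lborel) (\<lambda>(x, y). f x * g y)"
proof (rule lborel_pair.Fubini_integrable)
  have [measurable]: "f \<in> borel_measurable borel" "g \<in> borel_measurable borel"
    using f g by auto
  show "(\<lambda>(x, y). f x * g y) \<in> borel_measurable (lborel \<Otimes>\<^sub>M lborel)" by measurable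
  show "integrable lborel (\<lambda>x. \<integral>y. norm (case (x, y) of (x, y) \<Rightarrow> f x * g y) \<partial>lborel)"
    using f g by (simp add: norm_mult)
  show "AE x in lborel. integrable lborel (\<lambda>y. case (x, y) of (x, y) \<Rightarrow> f x * g y)"
    using g by simp
qed

text \<open>A factor exp(- \<epsilon> t^2) makes the double integral absolutely convergent. After
  Fubini the inner integral is a Gaussian, so the regularised integral is an average of \<rho>
  around w at scale sqrt(\<epsilon>), and continuity at w gives the limit. The bound on \<rho>
  provides the dominating function on that side, the integrability of the transform on the
  other.\<close>

lemma fourier_inversion_real:
  fixes \<rho> :: "real \<Rightarrow> real"
  assumes \<rho>: "integrable lborel \<rho>" and cont: "isCont \<rho> w" and bdd: "\<And>v. \<bar>\<rho> v\<bar> \<le> B"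
    and \<phi>: "integrable lborel (\<lambda>t. \<integral>v. of_real (\<rho> v) * exp (\<i> * of_real (t * v)) \<partial>lborel)" (is "integrable _ ?\<phi>")
  shows "(\<integral>t. ?\<phi> t * exp (- \<i> * of_real (t * w)) \<partial>lborel) = of_real (2 * pi * \<rho> w)"
proof (rule LIMSEQ_unique)
  have [measurable]: "\<rho> \<in> borel_measurable borel" using \<rho> by auto
  have [measurable]: "?\<phi> \<in> borel_measurable borel" using \<phi> by auto
  \<comment> \<open>Any positive null sequence serves here; a sequence is used because dominated
    convergence is sequential.\<close>
  define \<epsilon> where "\<epsilon> n = 1 / (4 * (1 + real n)\<^sup>2)" for n
  define A where "A n = (\<integral>t. ?\<phi> t * exp (- \<i> * of_real (t * w)) * of_real (exp (- \<epsilon> n * t\<^sup>2)) \<partial>lborel)" for n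
  have \<epsilon>: "\<epsilon> n > 0" for n by (simp add: \<epsilon>_def)
  have \<epsilon>0: "\<epsilon> \<longlonglongrightarrow> 0" unfolding \<epsilon>_def by real_asymp
  show "A \<longlonglongrightarrow> (\<integral>t. ?\<phi> t * exp (- \<i> * of_real (t * w)) \<partial>lborel)"
    unfolding A_def
  proof (rule integral_dominated_convergence[where w = "\<lambda>t. norm (?\<phi> t)"])
    show "AE t in lborel. (\<lambda>n. ?\<phi> t * exp (- \<i> * of_real (t * w)) * of_real (exp (- \<epsilon> n * t\<^sup>2)))
        \<longlonglongrightarrow> ?\<phi> t * exp (- \<i> * of_real (t * w))"
    proof (rule AE_I2)
      fix t :: real
      have "(\<lambda>n. ?\<phi> t * exp (- \<i> * of_real (t * w)) * of_real (exp (- \<epsilon> n * t\<^sup>2)))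
        \<longlonglongrightarrow> ?\<phi> t * exp (- \<i> * of_real (t * w)) * of_real (exp (- 0 * t\<^sup>2))"
        by (intro tendsto_intros \<epsilon>0)
      then show "(\<lambda>n. ?\<phi> t * exp (- \<i> * of_real (t * w)) * of_real (exp (- \<epsilon> n * t\<^sup>2)))
        \<longlonglongrightarrow> ?\<phi> t * exp (- \<i> * of_real (t * w))" by simp
    qed
    show "AE t in lborel. norm (?\<phi> t * exp (- \<i> * of_real (t * w)) * of_real (exp (- \<epsilon> n * t\<^sup>2))) \<le> norm (?\<phi> t)" for n
      using \<epsilon>[of n] by (auto simp: norm_mult norm_exp_eq_Re intro!: mult_left_le)
  qed (use \<phi> in \<open>auto intro!: integrable_norm\<close>)
  have A_eq: "A n = (\<integral>s. of_real (2 * sqrt pi * (\<rho> (w + 2 * sqrt (\<epsilon> n) * s) * exp (- s\<^sup>2))) \<partial>lborel)" for n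
  proof -
    have gi: "integrable lborel (\<lambda>t. exp (- \<epsilon> n * t\<^sup>2))"
      using integrable_power_exp_quadratic[OF \<epsilon>[of n], of 0 0] by simp
    have int: "integrable (lborel \<Otimes>\<^sub>M lborel) (\<lambda>(t, v). of_real (\<rho> v * exp (- \<epsilon> n * t\<^sup>2)) * exp (\<i> * of_real (t * (v - w))))"
      (is "integrable _ (\<lambda>(t, v). ?k t v)")
    proof (rule Bochner_Integration.integrable_bound)
      show "integrable (lborel \<Otimes>\<^sub>M lborel) (\<lambda>(t, v). exp (- \<epsilon> n * t\<^sup>2) * \<rho> v)"
        by (intro integrable_lborel_pair_mult gi \<rho>)
      have "norm (?k t v) = \<bar>exp (- \<epsilon> n * t\<^sup>2) * \<rho> v\<bar>" for t v
        by (simp only: norm_mult norm_of_real norm_exp_i_times) (simp add: abs_mult)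
      then show "AE x in lborel \<Otimes>\<^sub>M lborel. norm (case x of (t, v) \<Rightarrow> ?k t v)
          \<le> norm (case x of (t, v) \<Rightarrow> exp (- \<epsilon> n * t\<^sup>2) * \<rho> v)"
        by (auto simp del: of_real_mult of_real_diff)
    qed measurable
    have "A n = (\<integral>t. (\<integral>v. ?k t v \<partial>lborel) \<partial>lborel)"
      unfolding A_def
    proof (rule Bochner_Integration.integral_cong[OF refl])
      fix t
      have "?\<phi> t * exp (- \<i> * of_real (t * w)) * of_real (exp (- \<epsilon> n * t\<^sup>2))
        = (\<integral>v. of_real (\<rho> v) * exp (\<i> * of_real (t * v)) * (exp (- \<i> * of_real (t * w)) * of_real (exp (- \<epsilon> n * t\<^sup>2))) \<partial>lborel)"
        by (simp only: mult.assoc integral_mult_left_zero[symmetric])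
      also have "\<dots> = (\<integral>v. ?k t v \<partial>lborel)"
      proof (intro Bochner_Integration.integral_cong refl)
        fix v
        have "exp (\<i> * of_real (t * (v - w))) = exp (\<i> * of_real (t * v)) * exp (- \<i> * of_real (t * w))"
          by (simp add: algebra_simps flip: exp_add)
        then show "of_real (\<rho> v) * exp (\<i> * of_real (t * v)) * (exp (- \<i> * of_real (t * w)) * of_real (exp (- \<epsilon> n * t\<^sup>2))) = ?k t v"
          by (simp only: of_real_mult mult_ac)
      qed
      finally show "?\<phi> t * exp (- \<i> * of_real (t * w)) * of_real (exp (- \<epsilon> n * t\<^sup>2)) = (\<integral>v. ?k t v \<partial>lborel)" .
    qed
    also have "\<dots> = (\<integral>v. (\<integral>t. ?k t v \<partial>lborel) \<partial>lborel)"
      using lborel_pair.Fubini_integral[OF int] by simp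
    also have "\<dots> = (\<integral>v. of_real (\<rho> v * (sqrt (pi / \<epsilon> n) * exp (- (v - w)\<^sup>2 / (4 * \<epsilon> n)))) \<partial>lborel)"
    proof (rule Bochner_Integration.integral_cong[OF refl])
      fix v
      have "exp (- of_real (\<epsilon> n) * of_real (t\<^sup>2) + (\<i> * of_real (v - w)) * of_real t)
          = of_real (exp (- \<epsilon> n * t\<^sup>2)) * exp (\<i> * of_real (t * (v - w)))" for t
        unfolding exp_of_real[symmetric] exp_add by (simp add: mult_ac)
      then have "(\<integral>t. ?k t v \<partial>lborel) = (\<integral>t. of_real (\<rho> v) * exp (- of_real (\<epsilon> n) * of_real (t\<^sup>2) + (\<i> * of_real (v - w)) * of_real t) \<partial>lborel)"
        by (simp only: of_real_mult mult.assoc)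
      also have "\<dots> = of_real (\<rho> v) * (of_real (sqrt pi) / csqrt (of_real (\<epsilon> n)) * exp ((\<i> * of_real (v - w))\<^sup>2 / (4 * of_real (\<epsilon> n))))"
        unfolding integral_mult_right_zero by (subst integral_exp_quadratic) (use \<epsilon>[of n] in simp_all)
      also have "csqrt (of_real (\<epsilon> n)) = of_real (sqrt (\<epsilon> n))"
        using \<epsilon>[of n] by (simp add: csqrt_of_real_nonneg)
      also have "(\<i> * of_real (v - w))\<^sup>2 / (4 * of_real (\<epsilon> n)) = (of_real (- (v - w)\<^sup>2 / (4 * \<epsilon> n)) :: complex)"
        by (simp add: power_mult_distrib)
      also have "of_real (\<rho> v) * (of_real (sqrt pi) / of_real (sqrt (\<epsilon> n)) * exp (of_real (- (v - w)\<^sup>2 / (4 * \<epsilon> n)) :: complex))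
         = of_real (\<rho> v * (sqrt (pi / \<epsilon> n) * exp (- (v - w)\<^sup>2 / (4 * \<epsilon> n))))"
        unfolding exp_of_real by (simp only: real_sqrt_divide of_real_mult of_real_divide)
      finally show "(\<integral>t. ?k t v \<partial>lborel) = of_real (\<rho> v * (sqrt (pi / \<epsilon> n) * exp (- (v - w)\<^sup>2 / (4 * \<epsilon> n))))" .
    qed
    \<comment> \<open>The substitution v = w + 2 sqrt(\<epsilon>) s moves the parameter from the
      Gaussian into the argument of \<rho>, so that one Gaussian dominates for all n.\<close>
    also have "\<dots> = \<bar>2 * sqrt (\<epsilon> n)\<bar> *\<^sub>R (\<integral>s. of_real (\<rho> (w + 2 * sqrt (\<epsilon> n) * s) * (sqrt (pi / \<epsilon> n)
          * exp (- (w + 2 * sqrt (\<epsilon> n) * s - w)\<^sup>2 / (4 * \<epsilon> n)))) \<partial>lborel)"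
      by (rule lborel_integral_real_affine[where f = "\<lambda>v. complex_of_real (\<rho> v * (sqrt (pi / \<epsilon> n) * exp (- (v - w)\<^sup>2 / (4 * \<epsilon> n))))"])
        (use \<epsilon>[of n] in simp)
    also have "\<dots> = (\<integral>s. \<bar>2 * sqrt (\<epsilon> n)\<bar> *\<^sub>R of_real (\<rho> (w + 2 * sqrt (\<epsilon> n) * s) * (sqrt (pi / \<epsilon> n)
          * exp (- (w + 2 * sqrt (\<epsilon> n) * s - w)\<^sup>2 / (4 * \<epsilon> n)))) \<partial>lborel)"
      by (simp only: integral_scaleR_right)
    also have "\<dots> = (\<integral>s. of_real (2 * sqrt pi * (\<rho> (w + 2 * sqrt (\<epsilon> n) * s) * exp (- s\<^sup>2))) \<partial>lborel)"
    proof (intro Bochner_Integration.integral_cong refl)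
      fix s :: real
      have 1: "\<bar>2 * sqrt (\<epsilon> n)\<bar> * sqrt (pi / \<epsilon> n) = 2 * sqrt pi"
        using \<epsilon>[of n] by (simp add: real_sqrt_divide)
      have 2: "- (w + 2 * sqrt (\<epsilon> n) * s - w)\<^sup>2 / (4 * \<epsilon> n) = - s\<^sup>2"
        using \<epsilon>[of n] by (simp add: power_mult_distrib)
      have 3: "a * (x * (b * e)) = (a * b) * (x * e)" for a b x e :: real by simp
      have "\<bar>2 * sqrt (\<epsilon> n)\<bar> * (\<rho> (w + 2 * sqrt (\<epsilon> n) * s) * (sqrt (pi / \<epsilon> n)
          * exp (- (w + 2 * sqrt (\<epsilon> n) * s - w)\<^sup>2 / (4 * \<epsilon> n))))
        = 2 * sqrt pi * (\<rho> (w + 2 * sqrt (\<epsilon> n) * s) * exp (- s\<^sup>2))"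
        unfolding 2 3 1 ..
      then show "\<bar>2 * sqrt (\<epsilon> n)\<bar> *\<^sub>R of_real (\<rho> (w + 2 * sqrt (\<epsilon> n) * s) * (sqrt (pi / \<epsilon> n)
          * exp (- (w + 2 * sqrt (\<epsilon> n) * s - w)\<^sup>2 / (4 * \<epsilon> n))))
        = complex_of_real (2 * sqrt pi * (\<rho> (w + 2 * sqrt (\<epsilon> n) * s) * exp (- s\<^sup>2)))"
        by (simp only: scaleR_conv_of_real of_real_mult[symmetric])
    qed
    finally show ?thesis .
  qed
  have gs: "integrable lborel (\<lambda>s::real. exp (- s\<^sup>2))" 
    using integrable_power_exp_quadratic[of 1 0 0] by simp
  have "A \<longlonglongrightarrow> (\<integral>s. complex_of_real (2 * sqrt pi * (\<rho> w * exp (- s\<^sup>2))) \<partial>lborel)"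
    unfolding A_eq
  proof (rule integral_dominated_convergence[where w = "\<lambda>s. 2 * sqrt pi * (B * exp (- s\<^sup>2))"])
    show "AE s in lborel. (\<lambda>n. complex_of_real (2 * sqrt pi * (\<rho> (w + 2 * sqrt (\<epsilon> n) * s) * exp (- s\<^sup>2))))
       \<longlonglongrightarrow> complex_of_real (2 * sqrt pi * (\<rho> w * exp (- s\<^sup>2)))"
    proof (rule AE_I2)
      fix s :: real
      have "(\<lambda>n. w + 2 * sqrt (\<epsilon> n) * s) \<longlonglongrightarrow> w + 2 * sqrt 0 * s"
        by (intro tendsto_intros \<epsilon>0)
      then have "(\<lambda>n. \<rho> (w + 2 * sqrt (\<epsilon> n) * s)) \<longlonglongrightarrow> \<rho> w"
        by (intro isCont_tendsto_compose[OF cont]) simp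
      then show "(\<lambda>n. complex_of_real (2 * sqrt pi * (\<rho> (w + 2 * sqrt (\<epsilon> n) * s) * exp (- s\<^sup>2))))
       \<longlonglongrightarrow> complex_of_real (2 * sqrt pi * (\<rho> w * exp (- s\<^sup>2)))"
        by (intro tendsto_intros)
    qed
    show "AE s in lborel. norm (complex_of_real (2 * sqrt pi * (\<rho> (w + 2 * sqrt (\<epsilon> n) * s) * exp (- s\<^sup>2))))
        \<le> 2 * sqrt pi * (B * exp (- s\<^sup>2))" for n
      unfolding norm_of_real by (auto simp: abs_mult intro!: mult_right_mono bdd)
  qed (use gs in auto)
  also have "(\<integral>s. complex_of_real (2 * sqrt pi * (\<rho> w * exp (- s\<^sup>2))) \<partial>lborel) = of_real (2 * pi * \<rho> w)"
  proof -
    have "complex_of_real (sqrt pi) * complex_of_real (sqrt pi) = of_real pi"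
      by (simp flip: of_real_mult)
    then show ?thesis
      using integral_exp_quadratic_real[of 1 0] by (simp add: mult_ac)
  qed
  finally show "A \<longlonglongrightarrow> of_real (2 * pi * \<rho> w)" .
qed

section \<open>The Gamma density and Laplace inversion\<close>

lemma has_bochner_integral_Gamma:
  fixes a :: real
  assumes "a > -1"
  shows "has_bochner_integral lborel (\<lambda>v. indicator {0<..} v * (v powr a * exp (- v))) (Gamma (a + 1))"
proof (rule has_bochner_integral_nn_integral)
  have "(\<integral>\<^sup>+v. ennreal (indicator {0<..} v * (v powr a * exp (- v))) \<partial>lborel)
      = (\<integral>\<^sup>+v. ennreal (indicator {0..} v * v powr (a + 1 - 1) / exp v) \<partial>lborel)"
    by (intro nn_integral_cong) (auto simp: exp_minus divide_inverse split: split_indicator)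
  also have "\<dots> = ennreal (Gamma (a + 1))"
    using assms by (intro Gamma_conv_nn_integral_real[symmetric]) simp
  finally show "(\<integral>\<^sup>+v. ennreal (indicator {0<..} v * (v powr a * exp (- v))) \<partial>lborel) = ennreal (Gamma (a + 1))" .
qed (use assms in \<open>auto intro!: less_imp_le Gamma_real_pos\<close>)

text \<open>With z = 1 - it, let \<phi> be the transform and \<psi> that of v h. Then \<phi>' = i
  \<psi>, and integration by parts gives z \<psi> = (a + 1) \<phi>. Together they form a first-order
  equation whose solution is a multiple of z to the power - (a + 1); at t = 0 the factor is the
  Gamma value.\<close>

lemma fourier_Gamma_density:
  fixes a t :: real
  assumes a: "a > 0"
  defines "h \<equiv> (\<lambda>v. complex_of_real (indicator {0<..} v * (v powr a * exp (- v))))"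
  shows "(\<integral>v. exp (\<i> * of_real (t * v)) * h v \<partial>lborel)
    = of_real (Gamma (a + 1)) * (1 - \<i> * of_real t) powr of_real (- (a + 1))"
proof -
  have h: "integrable lborel h" 
    unfolding h_def using has_bochner_integral_Gamma[of a] a by (intro integrable_of_real) (auto simp: has_bochner_integral_iff)
  have "integrable lborel (\<lambda>v. complex_of_real (indicator {0<..} v * (v powr (a + 1) * exp (- v))))"
    using has_bochner_integral_Gamma[of "a + 1"] a by (intro integrable_of_real) (auto simp: has_bochner_integral_iff)
  moreover have "complex_of_real (indicator {0<..} v * (v powr (a + 1) * exp (- v))) = of_real v * h v" for v
    unfolding h_def by (auto simp: powr_add split: split_indicator)
  ultimately have vh: "integrable lborel (\<lambda>v. of_real v * h v)" by simp
  define \<phi> where "\<phi> t = (\<integral>v. exp (\<i> * of_real (t * v)) * h v \<partial>lborel)" for t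
  define \<psi> where "\<psi> t = (\<integral>v. of_real v * (exp (\<i> * of_real (t * v)) * h v) \<partial>lborel)" for t
  define z where "z t = 1 - \<i> * of_real t" for t
  have z: "z t \<noteq> 0" "z t \<notin> \<real>\<^sub>\<le>\<^sub>0" for t
    by (auto simp: z_def complex_nonpos_Reals_iff complex_eq_iff)
  have \<phi>': "(\<phi> has_vector_derivative \<i> * \<psi> t) (at t)" for t
  proof -
    have "(\<phi> has_vector_derivative (\<integral>v. \<i> * of_real v * (exp (\<i> * of_real (t * v)) * h v) \<partial>lborel)) (at t)"
      unfolding \<phi>_def[abs_def] by (rule has_vector_derivative_integral_exp_ii[OF _ h vh]) simp
    then show ?thesis unfolding \<psi>_def by (simp only: mult.assoc integral_mult_right_zero)
  qed
  have parts: "z t * \<psi> t = of_real (a + 1) * \<phi> t" for t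
  proof -
    \<comment> \<open>\<open>F\<close> vanishes at 0 because the exponent a + 1 is positive, and at
      infinity by the exponential; integrating its derivative \<open>f\<close> yields the relation
      between \<psi> and \<phi>.\<close>
    define F where "F v = complex_of_real (v powr (a + 1)) * exp (- z t * of_real v)" for v
    define f where "f v = complex_of_real ((a + 1) * v powr a) * exp (- z t * of_real v)
        - z t * (complex_of_real (v powr (a + 1)) * exp (- z t * of_real v))" for v
    have e: "exp (- z t * of_real v) = exp (\<i> * of_real (t * v)) * of_real (exp (- v))" for v
      unfolding z_def exp_of_real[symmetric] by (simp add: algebra_simps flip: exp_add)
    have ie: "integrable lborel (\<lambda>v. of_real (a + 1) * (exp (\<i> * of_real (t * v)) * h v))"
      by (intro integrable_mult_right, rule Bochner_Integration.integrable_bound[OF h])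
         (use h in \<open>auto simp: norm_mult simp del: of_real_mult\<close>)
    have ie': "integrable lborel (\<lambda>v. z t * (of_real v * (exp (\<i> * of_real (t * v)) * h v)))"
      by (intro integrable_mult_right, rule Bochner_Integration.integrable_bound[OF vh])
         (use h in \<open>auto simp: norm_mult simp del: of_real_mult\<close>)
    have fi: "indicator {0<..} v *\<^sub>R f v = of_real (a + 1) * (exp (\<i> * of_real (t * v)) * h v)
         - z t * (of_real v * (exp (\<i> * of_real (t * v)) * h v))" for v
      unfolding f_def e h_def by (auto simp: powr_add split: split_indicator)
    have ei: "einterval 0 \<infinity> = {0<..}" by (auto simp: einterval_iff)
    have "(LBINT v=0..\<infinity>. f v) = 0 - 0"
    proof (rule interval_integral_FTC_integrable[of _ _ F])
      fix v :: real assume "0 < ereal v"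
      then have v: "v > 0" by simp
      have "((\<lambda>v. complex_of_real (v powr (a + 1))) has_vector_derivative complex_of_real ((a + 1) * v powr a)) (at v)"
        using v by (intro has_vector_derivative_of_real)
          (auto intro!: derivative_eq_intros simp: has_real_derivative_iff_has_vector_derivative[symmetric] powr_diff)
      moreover have "((\<lambda>v. exp (- z t * of_real v)) has_vector_derivative (- z t * exp (- z t * of_real v))) (at v)"
        by (rule has_vector_derivative_real_field) (auto intro!: derivative_eq_intros)
      ultimately show "(F has_vector_derivative f v) (at v)"
        unfolding F_def f_def by (rule has_vector_derivative_eq_rhs[OF has_vector_derivative_mult]) (simp add: algebra_simps)
      show "isCont f v" unfolding f_def using v by (intro continuous_intros) auto
    next
      show "set_integrable lborel (einterval 0 \<infinity>) f"
        unfolding set_integrable_def ei fi by (rule Bochner_Integration.integrable_diff[OF ie ie'])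
      have nF: "norm (F v) = \<bar>v powr (a + 1) * exp (- v)\<bar>" for v
        unfolding F_def by (simp add: norm_mult z_def)
      show "((F \<circ> real_of_ereal) \<longlongrightarrow> 0) (at_right 0)"
        unfolding zero_ereal_def ereal_tendsto_simps
        by (subst tendsto_norm_zero_iff[symmetric], subst nF, rule tendsto_rabs_zero) (use a in real_asymp)
      show "((F \<circ> real_of_ereal) \<longlongrightarrow> 0) (at_left \<infinity>)"
        unfolding ereal_tendsto_simps
        by (subst tendsto_norm_zero_iff[symmetric], subst nF, rule tendsto_rabs_zero) (use a in real_asymp)
    qed simp
    moreover have "(LBINT v=0..\<infinity>. f v) = (\<integral>v. indicator {0<..} v *\<^sub>R f v \<partial>lborel)"
      unfolding zero_ereal_def by (simp add: interval_integral_to_infinity_eq set_lebesgue_integral_def)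
    ultimately have "(\<integral>v. of_real (a + 1) * (exp (\<i> * of_real (t * v)) * h v) - z t * (of_real v * (exp (\<i> * of_real (t * v)) * h v)) \<partial>lborel) = 0"
      unfolding fi by simp
    then show ?thesis
      unfolding Bochner_Integration.integral_diff[OF ie ie'] integral_mult_right_zero \<phi>_def \<psi>_def by simp
  qed
  \<comment> \<open>The integrating factor. It is smooth since 1 - it stays off the cut of the
    complex power.\<close>
  define M where "M t = z t powr of_real (a + 1)" for t
  have M': "(M has_vector_derivative - \<i> * (of_real (a + 1) / z t * M t)) (at t)" for t
  proof -
    have "((\<lambda>u. (1 - \<i> * u) powr of_real (a + 1)) has_field_derivative
        (of_real (a + 1) * (1 - \<i> * of_real t) powr (of_real (a + 1) - 1) * (0 - \<i> * 1))) (at (of_real t))"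
      using z[of t] unfolding z_def by (intro has_field_derivative_powr_right DERIV_chain2[OF has_field_derivative_powr] derivative_intros) auto
    moreover have "z t powr (of_real (a + 1) - 1) = M t / z t"
      unfolding M_def powr_diff using z[of t] by (simp only: powr_to_1 if_False)
    ultimately have "((\<lambda>u. (1 - \<i> * u) powr of_real (a + 1)) has_field_derivative
        - \<i> * (of_real (a + 1) / z t * M t)) (at (of_real t))"
      unfolding z_def[symmetric] by (auto elim!: DERIV_cong)
    then show ?thesis
      unfolding M_def[abs_def] z_def by (rule has_vector_derivative_real_field)
  qed
  have "((\<lambda>t. M t * \<phi> t) has_vector_derivative 0) (at t)" for t
  proof (rule has_vector_derivative_eq_rhs[OF has_vector_derivative_mult[OF M' \<phi>']])
    have "m * (\<i> * p) + - \<i> * (k / x * m) * f = 0" if "x * p = k * f" "x \<noteq> 0" for m p k x f :: complex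
    proof -
      have "p = k * f / x" using that by (simp add: field_simps)
      then show ?thesis by simp
    qed
    from this[OF parts z(1)] show "M t * (\<i> * \<psi> t) + - \<i> * (of_real (a + 1) / z t * M t) * \<phi> t = 0" .
  qed
  then obtain c where c: "\<And>t. t \<in> UNIV \<Longrightarrow> M t * \<phi> t = c"
    by (rule has_vector_derivative_zero_constant[OF convex_UNIV has_vector_derivative_at_within]) blast+
  have "M t * \<phi> t = M 0 * \<phi> 0" using c[of 0] c[of t] by simp
  also have "M 0 = 1" by (simp add: M_def z_def)
  also have "\<phi> 0 = of_real (Gamma (a + 1))"
    unfolding \<phi>_def h_def using has_bochner_integral_Gamma[of a] a
    by (simp add: has_bochner_integral_iff del: of_real_mult)
  finally have "M t * \<phi> t = of_real (Gamma (a + 1))" by simp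
  then show ?thesis
    using z[of t] unfolding \<phi>_def M_def z_def of_real_minus powr_minus by (simp add: field_simps)
qed

lemma norm_one_minus_ii_powr:
  fixes s t :: real
  shows "norm ((1 - \<i> * of_real t) powr of_real s) = (1 + t\<^sup>2) powr (s / 2)"
proof -
  have "norm (1 - \<i> * of_real t) = sqrt (1 + t\<^sup>2)"
    by (simp add: cmod_def)
  moreover have "1 - \<i> * of_real t \<noteq> 0" by (simp add: complex_eq_iff)
  ultimately show ?thesis
    by (simp add: norm_powr_real_powr' powr_half_sqrt[symmetric] powr_powr add_nonneg_nonneg)
qed

lemma integrable_inverse_one_plus_square: "integrable lborel (\<lambda>t::real. inverse (1 + t\<^sup>2))"
  using integrable_inverse_1_plus_square by (simp add: set_integrable_def)

text \<open>The order \<open>a \<ge> 1\<close> makes the weight at most 1 / (1 + t^2). The integral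
  over t then converges absolutely, which the inversion formula and every later interchange rely
  on.\<close>

lemma integrable_one_minus_ii_powr:
  fixes a :: real
  assumes "a \<ge> 1"
  shows "integrable lborel (\<lambda>t. (1 - \<i> * of_real t) powr of_real (- (a + 1)))"
proof (rule Bochner_Integration.integrable_bound[OF integrable_inverse_one_plus_square])
  show "(\<lambda>t. (1 - \<i> * complex_of_real t) powr of_real (- (a + 1))) \<in> borel_measurable lborel"
    by (simp, intro borel_measurable_continuous_onI continuous_intros) (auto simp: complex_nonpos_Reals_iff)
  have "(1 + t\<^sup>2) powr (- (a + 1) / 2) \<le> inverse (1 + t\<^sup>2)" for t :: real
  proof -
    have "(1 + t\<^sup>2) powr (- (a + 1) / 2) \<le> (1 + t\<^sup>2) powr (- 1)"
      using assms by (intro powr_mono) auto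
    then show ?thesis by (simp add: powr_minus add_nonneg_nonneg)
  qed
  then show "AE t in lborel. norm ((1 - \<i> * of_real t) powr of_real (- (a + 1))) \<le> norm (inverse (1 + t\<^sup>2))"
    unfolding norm_one_minus_ii_powr by simp
qed

text \<open>Fourier inversion for the Gamma density, multiplied by exp(w) to undo its exponential
  factor. Since \<open>0 powr a = 0\<close>, the \<open>max\<close> encodes the cutoff to w > 0, and
  the density extends continuously to the whole line.\<close>

lemma powr_eq_Laplace_integral:
  fixes a w :: real
  assumes a: "a \<ge> 1"
  shows "complex_of_real (max 0 w powr a) = of_real (Gamma (a + 1) / (2 * pi)) *
    (\<integral>t. (1 - \<i> * of_real t) powr of_real (- (a + 1)) * exp ((1 - \<i> * of_real t) * of_real w) \<partial>lborel)"
proof -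
  define \<rho> where "\<rho> v = max 0 v powr a * exp (- v)" for v :: real
  have \<rho>_eq: "\<rho> = (\<lambda>v. indicator {0<..} v * (v powr a * exp (- v)))"
    unfolding \<rho>_def by (auto simp: fun_eq_iff max_def split: split_indicator)
  define g where "g t = (1 - \<i> * of_real t) powr of_real (- (a + 1))" for t
  have \<phi>: "(\<integral>v. of_real (\<rho> v) * exp (\<i> * of_real (t * v)) \<partial>lborel) = of_real (Gamma (a + 1)) * g t" for t
    using fourier_Gamma_density[of a t] a unfolding \<rho>_eq g_def by (simp add: mult.commute)
  have "(\<integral>t. (of_real (Gamma (a + 1)) * g t) * exp (- \<i> * of_real (t * w)) \<partial>lborel) = of_real (2 * pi * \<rho> w)"
    unfolding \<phi>[symmetric]
  proof (rule fourier_inversion_real)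
    show "integrable lborel \<rho>"
      unfolding \<rho>_eq using has_bochner_integral_Gamma[of a] a by (simp add: has_bochner_integral_iff)
    have "continuous_on UNIV \<rho>"
      unfolding \<rho>_def[abs_def] using a by (intro continuous_intros continuous_on_powr') auto
    then show "isCont \<rho> w" by (simp add: continuous_on_eq_continuous_at)
    show "integrable lborel (\<lambda>t. \<integral>v. of_real (\<rho> v) * exp (\<i> * of_real (t * v)) \<partial>lborel)"
      unfolding \<phi> g_def by (intro integrable_mult_right integrable_one_minus_ii_powr a)
    \<comment> \<open>From v / a \<le> exp (v / a), raised to the power a.\<close>
    show "\<bar>\<rho> v\<bar> \<le> a powr a" for v
    proof (cases "v > 0")
      case True
      have "v / a \<le> exp (v / a)" using exp_ge_add_one_self[of "v / a"] by linarith
      then have "(v / a) powr a \<le> exp (v / a) powr a" using True a by (intro powr_mono2) auto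
      then have "v powr a \<le> a powr a * exp v" using True a by (simp add: powr_divide exp_powr_real field_simps)
      then show ?thesis unfolding \<rho>_def using True by (simp add: exp_minus field_simps)
    next
      case False
      then show ?thesis unfolding \<rho>_def by (simp add: max_def)
    qed
  qed
  then have "of_real (Gamma (a + 1)) * (\<integral>t. g t * exp (- \<i> * of_real (t * w)) \<partial>lborel) = of_real (2 * pi * \<rho> w)"
    by (simp only: mult.assoc integral_mult_right_zero)
  then have "of_real (exp w) * (of_real (Gamma (a + 1)) * (\<integral>t. g t * exp (- \<i> * of_real (t * w)) \<partial>lborel))
     = of_real (2 * pi * max 0 w powr a)"
    by (simp add: \<rho>_def exp_minus field_simps)
  moreover have "of_real (exp w) * (\<integral>t. g t * exp (- \<i> * of_real (t * w)) \<partial>lborel)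
     = (\<integral>t. g t * exp ((1 - \<i> * of_real t) * of_real w) \<partial>lborel)"
  proof -
    have "of_real (exp w) * (g t * exp (- \<i> * of_real (t * w))) = g t * exp ((1 - \<i> * of_real t) * of_real w)" for t
      by (simp add: algebra_simps exp_diff exp_minus exp_of_real field_simps)
    then show ?thesis by (simp only: integral_mult_right_zero[symmetric])
  qed
  ultimately have "of_real (Gamma (a + 1)) * (\<integral>t. g t * exp ((1 - \<i> * of_real t) * of_real w) \<partial>lborel)
     = complex_of_real (2 * pi * max 0 w powr a)"
    by (metis mult.left_commute)
  then show ?thesis unfolding g_def by (simp add: field_simps)
qed

section \<open>Gaussian multipliers\<close>

lemma integral_lborel_pair_mult:
  fixes f :: "'a::euclidean_space \<Rightarrow> complex" and g :: "'b::euclidean_space \<Rightarrow> complex"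
  assumes f: "integrable lborel f" and g: "integrable lborel g"
  shows "(\<integral>p. f (fst p) * g (snd p) \<partial>lborel) = (\<integral>x. f x \<partial>lborel) * (\<integral>y. g y \<partial>lborel)"
proof -
  have "(\<integral>p. f (fst p) * g (snd p) \<partial>lborel) = (\<integral>x. (\<integral>y. f x * g y \<partial>lborel) \<partial>lborel)"
    using lborel_pair.integral_fst'[OF integrable_lborel_pair_mult[OF f g]]
    by (simp add: lborel_prod case_prod_unfold)
  also have "\<dots> = (\<integral>x. f x \<partial>lborel) * (\<integral>y. g y \<partial>lborel)"
    by (simp only: integral_mult_right_zero integral_mult_left_zero)
  finally show ?thesis .
qed

text \<open>Up to normalisation, the heat semigroup at complex time. For z = 1 - it it combines a
  unit of heat flow with a Schroedinger evolution, the latter being the source of the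
  oscillation.\<close>

definition gauss_mult :: "complex \<Rightarrow> (real ^ 'n \<Rightarrow> complex) \<Rightarrow> real ^ 'n \<Rightarrow> complex" where
  "gauss_mult z f x = (\<integral>\<xi>. exp (- z * of_real ((norm \<xi>)\<^sup>2)) * fourier f \<xi>
     * exp (2 * of_real pi * \<i> * of_real (x \<bullet> \<xi>)) \<partial>lborel)"

text \<open>The inverse Fourier transform of the multiplier. For Re z = 1 the real part of 1/z is
  1/|z|^2, so the modulus is a Gaussian of width about |z| and of height |z| to the power -n/2, up
  to a constant.\<close>

definition gauss_kernel :: "complex \<Rightarrow> real ^ 'n \<Rightarrow> complex" where
  "gauss_kernel z v = (of_real (sqrt pi) / csqrt z) ^ CARD('n) * exp (- of_real (pi\<^sup>2) / z * of_real ((norm v)\<^sup>2))"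

lemma norm_gauss_kernel_le:
  fixes v :: "real ^ 'n"
  assumes "Re z > 0"
  shows "norm (gauss_kernel z v) \<le> (sqrt pi / sqrt (norm z)) ^ CARD('n)"
proof -
  have "Re (of_real (pi\<^sup>2) / z) \<ge> 0"
    using assms by (auto simp: Re_divide intro!: divide_nonneg_nonneg)
  moreover have "Re (- w * of_real r) = - (Re w * r)" for w r
    by simp
  ultimately have "Re (- of_real (pi\<^sup>2) / z * of_real ((norm v)\<^sup>2)) \<le> 0"
    by (simp only: minus_divide_left[symmetric] neg_le_0_iff_le) (intro mult_nonneg_nonneg zero_le_power2)
  then have "norm (exp (- of_real (pi\<^sup>2) / z * of_real ((norm v)\<^sup>2))) \<le> 1"
    by (simp only: norm_exp_eq_Re exp_le_one_iff)
  then show ?thesis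
    unfolding gauss_kernel_def norm_mult norm_power norm_divide
    by (simp add: norm_csqrt mult_left_le)
qed

lemma gauss_kernel_measurable [measurable]: "gauss_kernel z \<in> borel_measurable borel"
  unfolding gauss_kernel_def[abs_def] by measurable

lemma integrable_exp_minus_norm_sq:
  fixes z :: complex
  assumes "Re z > 0"
  shows "integrable lborel (\<lambda>\<xi>::'a::euclidean_space. exp (- z * of_real ((norm \<xi>)\<^sup>2)))"
  using integrable_exp_quadratic_euclidean[OF assms, of "0::'a" 0] by (simp add: zero_complex.code[symmetric])

lemma fourier_measurable:
  fixes f :: "real ^ 'n \<Rightarrow> complex"
  assumes [measurable]: "f \<in> borel_measurable borel"
  shows "fourier f \<in> borel_measurable borel"
  unfolding fourier_def[abs_def] by measurable

lemma norm_fourier_le: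
  fixes f :: "real ^ 'n \<Rightarrow> complex"
  shows "norm (fourier f \<xi>) \<le> (\<integral>x. norm (f x) \<partial>lborel)"
proof -
  have "norm (fourier f \<xi>) \<le> (\<integral>x. norm (exp (- 2 * of_real pi * \<i> * of_real (x \<bullet> \<xi>)) * f x) \<partial>lborel)"
    unfolding fourier_def by (rule integral_norm_bound)
  also have "\<dots> = (\<integral>x. norm (f x) \<partial>lborel)"
    by (simp add: norm_mult norm_exp_eq_Re)
  finally show ?thesis .
qed

lemma gauss_mult_eq_convolution:
  fixes f :: "real ^ 'n \<Rightarrow> complex"
  assumes z: "Re z > 0" and f: "integrable lborel f"
  shows "gauss_mult z f x = (\<integral>u. f u * gauss_kernel z (x - u) \<partial>lborel)"
proof -
  have [measurable]: "f \<in> borel_measurable borel" using f by auto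
  define k where "k \<xi> u = exp (- z * of_real ((norm \<xi>)\<^sup>2)) * f u * exp (2 * of_real pi * \<i> * of_real ((x - u) \<bullet> \<xi>))" for \<xi> u
  have int: "integrable (lborel \<Otimes>\<^sub>M lborel) (\<lambda>(\<xi>, u). k \<xi> u)"
  proof (rule Bochner_Integration.integrable_bound)
    show "integrable (lborel \<Otimes>\<^sub>M lborel) (\<lambda>(\<xi>::real^'n, u). exp (- z * of_real ((norm \<xi>)\<^sup>2)) * f u)"
      by (rule integrable_lborel_pair_mult[OF integrable_exp_minus_norm_sq[OF z] f])
    show "(\<lambda>(\<xi>, u). k \<xi> u) \<in> borel_measurable (lborel \<Otimes>\<^sub>M lborel)"
      unfolding k_def by measurable
    have "norm (k \<xi> u) = norm (exp (- z * of_real ((norm \<xi>)\<^sup>2)) * f u)" for \<xi> u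
      unfolding k_def norm_mult by (simp add: norm_exp_eq_Re)
    then show "AE p in lborel \<Otimes>\<^sub>M lborel. norm (case p of (\<xi>, u) \<Rightarrow> k \<xi> u)
        \<le> norm (case p of (\<xi>, u) \<Rightarrow> exp (- z * of_real ((norm \<xi>)\<^sup>2)) * f u)"
      by (intro AE_I2) (simp add: split_beta)
  qed
  have "gauss_mult z f x = (\<integral>\<xi>. (\<integral>u. k \<xi> u \<partial>lborel) \<partial>lborel)"
    unfolding gauss_mult_def
  proof (rule Bochner_Integration.integral_cong[OF refl])
    fix \<xi>
    have "exp (2 * of_real pi * \<i> * of_real ((x - u) \<bullet> \<xi>)) =
       exp (- 2 * of_real pi * \<i> * of_real (u \<bullet> \<xi>)) * exp (2 * of_real pi * \<i> * of_real (x \<bullet> \<xi>))" for u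
      by (simp add: inner_diff_left right_diff_distrib flip: exp_add)
    then have "k \<xi> u = exp (- z * of_real ((norm \<xi>)\<^sup>2)) * (exp (- 2 * of_real pi * \<i> * of_real (u \<bullet> \<xi>)) * f u)
        * exp (2 * of_real pi * \<i> * of_real (x \<bullet> \<xi>))" for u
      unfolding k_def by (simp only: mult_ac)
    then show "exp (- z * of_real ((norm \<xi>)\<^sup>2)) * fourier f \<xi> * exp (2 * of_real pi * \<i> * of_real (x \<bullet> \<xi>))
       = (\<integral>u. k \<xi> u \<partial>lborel)"
      unfolding fourier_def by (simp only: integral_mult_left_zero integral_mult_right_zero)
  qed
  also have "\<dots> = (\<integral>u. (\<integral>\<xi>. k \<xi> u \<partial>lborel) \<partial>lborel)"
    using lborel_pair.Fubini_integral[OF int] by simp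
  also have "\<dots> = (\<integral>u. f u * gauss_kernel z (x - u) \<partial>lborel)"
  proof (rule Bochner_Integration.integral_cong[OF refl])
    fix u
    have "k \<xi> u = f u * exp (- z * of_real ((norm \<xi>)\<^sup>2) + Complex (0 \<bullet> \<xi>) (((2 * pi) *\<^sub>R (x - u)) \<bullet> \<xi>))" for \<xi>
    proof -
      have "Complex (0 \<bullet> \<xi>) (((2 * pi) *\<^sub>R (x - u)) \<bullet> \<xi>) = 2 * of_real pi * \<i> * of_real ((x - u) \<bullet> \<xi>)"
        by (simp add: complex_eq_iff)
      then show ?thesis unfolding k_def exp_add by (simp only: mult_ac)
    qed
    then have "(\<integral>\<xi>. k \<xi> u \<partial>lborel) = f u * ((of_real (sqrt pi) / csqrt z) ^ DIM(real^'n)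
        * exp (Complex ((norm (0::real^'n))\<^sup>2 - (norm ((2 * pi) *\<^sub>R (x - u)))\<^sup>2) (2 * (0 \<bullet> ((2 * pi) *\<^sub>R (x - u)))) / (4 * z)))"
      by (simp only: integral_mult_right_zero integral_exp_quadratic_euclidean[OF z])
    also have "Complex ((norm (0::real^'n))\<^sup>2 - (norm ((2 * pi) *\<^sub>R (x - u)))\<^sup>2) (2 * (0 \<bullet> ((2 * pi) *\<^sub>R (x - u)))) / (4 * z)
        = - of_real (pi\<^sup>2) / z * of_real ((norm (x - u))\<^sup>2)"
    proof -
      have "Complex ((norm (0::real^'n))\<^sup>2 - (norm ((2 * pi) *\<^sub>R (x - u)))\<^sup>2) (2 * (0 \<bullet> ((2 * pi) *\<^sub>R (x - u))))
        = - (4 * of_real (pi\<^sup>2) * of_real ((norm (x - u))\<^sup>2))"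
        by (simp add: complex_eq_iff power_mult_distrib)
      then show ?thesis by (simp add: field_simps)
    qed
    finally show "(\<integral>\<xi>. k \<xi> u \<partial>lborel) = f u * gauss_kernel z (x - u)"
      by (simp add: gauss_kernel_def)
  qed
  finally show ?thesis .
qed

text \<open>This is the kernel of \<open>V*wV\<close>. Write pi^2/z = \<alpha> + i \<beta>. The
  quadratic phases of the two kernels cancel, leaving the linear phase 2 \<beta> (u - u') . y, and
  integration against a Gaussian of exponent 4 \<alpha> turns it into decay in u - u' at rate
  \<beta>^2 / (4 \<alpha>). As Re z = 1, one has \<alpha>^2 + \<beta>^2 = pi^2 \<alpha>, so this
  rate is (pi^2 - \<alpha>) / 4. The deficit \<alpha>/4 is supplied by the real parts, and the final
  rate no longer depends on z.\<close>

lemma norm_gauss_kernel_correlation: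
  fixes x u u' :: "real ^ 'n" and z :: complex
  assumes z: "Re z = 1"
  defines "\<alpha> \<equiv> pi\<^sup>2 / (norm z)\<^sup>2"
  shows "norm (\<integral>y. of_real (exp (- 2 * \<alpha> * (norm (x - y))\<^sup>2)) * (gauss_kernel z (y - u) * cnj (gauss_kernel z (y - u'))) \<partial>lborel)
    = (sqrt pi / 2) ^ CARD('n) * (exp (- (\<alpha> / 2) * (norm (x - u))\<^sup>2) * exp (- (\<alpha> / 2) * (norm (x - u'))\<^sup>2)
       * exp (- (pi\<^sup>2 / 4) * (norm (u - u'))\<^sup>2))"
proof -
  have z0: "z \<noteq> 0" "norm z > 0" using z by auto
  define \<beta> where "\<beta> = Im (of_real (pi\<^sup>2) / z)"
  have a: "of_real (pi\<^sup>2) / z = Complex \<alpha> \<beta>"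
    using z by (simp add: complex_eq_iff \<alpha>_def \<beta>_def Re_divide cmod_power2)
  have \<alpha>: "\<alpha> > 0" using z0 by (simp add: \<alpha>_def)
  have "(norm (of_real (pi\<^sup>2) / z))\<^sup>2 = pi\<^sup>2 * \<alpha>"
    by (simp add: norm_divide norm_power power_divide \<alpha>_def flip: power_mult power_add)
  then have \<beta>: "\<beta>\<^sup>2 = pi\<^sup>2 * \<alpha> - \<alpha>\<^sup>2"
    unfolding a by (simp add: cmod_power2)
  define \<kappa> where "\<kappa> = (of_real (sqrt pi) / csqrt z) ^ CARD('n)"
  have K: "gauss_kernel z v = \<kappa> * exp (- Complex \<alpha> \<beta> * of_real ((norm v)\<^sup>2))" for v :: "real ^ 'n"
    unfolding gauss_kernel_def \<kappa>_def a[symmetric] by simp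
  \<comment> \<open>As a function of y the total exponent is -4 \<alpha> |y|^2 + (c + i d) . y - (R
    + i I): one \<alpha> comes from each kernel and 2 \<alpha> from the weight.\<close>
  define c where "c = (4 * \<alpha>) *\<^sub>R x + (2 * \<alpha>) *\<^sub>R (u + u')"
  define d where "d = (2 * \<beta>) *\<^sub>R (u - u')"
  define R where "R = 2 * \<alpha> * (norm x)\<^sup>2 + \<alpha> * (norm u)\<^sup>2 + \<alpha> * (norm u')\<^sup>2"
  define I where "I = \<beta> * (norm u)\<^sup>2 - \<beta> * (norm u')\<^sup>2"
  have "of_real (exp (- 2 * \<alpha> * (norm (x - y))\<^sup>2)) * (gauss_kernel z (y - u) * cnj (gauss_kernel z (y - u')))
     = (\<kappa> * cnj \<kappa> * exp (- Complex R I)) * exp (- of_real (4 * \<alpha>) * of_real ((norm y)\<^sup>2) + Complex (c \<bullet> y) (d \<bullet> y))" for y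
  proof -
    have "of_real (- 2 * \<alpha> * (norm (x - y))\<^sup>2) + (- Complex \<alpha> \<beta> * of_real ((norm (y - u))\<^sup>2)
        + - cnj (Complex \<alpha> \<beta>) * of_real ((norm (y - u'))\<^sup>2))
      = - Complex R I + (- of_real (4 * \<alpha>) * of_real ((norm y)\<^sup>2) + Complex (c \<bullet> y) (d \<bullet> y))"
      unfolding complex_eq_iff R_def I_def c_def d_def power2_norm_eq_inner
      by (simp add: inner_diff_left inner_diff_right inner_add_left inner_commute algebra_simps)
    then have "exp (of_real (- 2 * \<alpha> * (norm (x - y))\<^sup>2)) * (exp (- Complex \<alpha> \<beta> * of_real ((norm (y - u))\<^sup>2))
        * exp (- cnj (Complex \<alpha> \<beta>) * of_real ((norm (y - u'))\<^sup>2)))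
      = exp (- Complex R I) * exp (- of_real (4 * \<alpha>) * of_real ((norm y)\<^sup>2) + Complex (c \<bullet> y) (d \<bullet> y))"
      unfolding exp_add[symmetric] by simp
    moreover have "cnj (exp (- Complex \<alpha> \<beta> * of_real ((norm (y - u'))\<^sup>2))) = exp (- cnj (Complex \<alpha> \<beta>) * of_real ((norm (y - u'))\<^sup>2))"
      unfolding exp_cnj by simp
    moreover have "A * (k * B * (k' * C)) = (k * k' * X) * Y" if "A * (B * C) = X * Y" for A B C X Y k k' :: complex
      using that by algebra
    ultimately show ?thesis
      unfolding K complex_cnj_mult exp_of_real by simp
  qed
  then have "(\<integral>y. of_real (exp (- 2 * \<alpha> * (norm (x - y))\<^sup>2)) * (gauss_kernel z (y - u) * cnj (gauss_kernel z (y - u'))) \<partial>lborel)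
    = (\<kappa> * cnj \<kappa> * exp (- Complex R I)) * ((of_real (sqrt pi) / csqrt (of_real (4 * \<alpha>))) ^ DIM(real ^ 'n)
       * exp (Complex ((norm c)\<^sup>2 - (norm d)\<^sup>2) (2 * (c \<bullet> d)) / (4 * of_real (4 * \<alpha>))))"
    using \<alpha> by (simp only: integral_mult_right_zero) (subst integral_exp_quadratic_euclidean, auto)
  also have "norm \<dots> = ((sqrt pi / sqrt (norm z)) ^ CARD('n))\<^sup>2 * (sqrt pi / sqrt (4 * \<alpha>)) ^ CARD('n)
      * (exp (- R) * exp (((norm c)\<^sup>2 - (norm d)\<^sup>2) / (16 * \<alpha>)))"
  proof -
    have "norm \<kappa> = (sqrt pi / sqrt (norm z)) ^ CARD('n)"
      unfolding \<kappa>_def by (simp add: norm_power norm_divide norm_csqrt)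
    moreover have "csqrt (of_real (4 * \<alpha>)) = of_real (sqrt (4 * \<alpha>))"
      using \<alpha> by (subst csqrt_of_real_nonneg) auto
    moreover have "Complex ((norm c)\<^sup>2 - (norm d)\<^sup>2) (2 * (c \<bullet> d)) / (4 * of_real (4 * \<alpha>))
       = Complex (((norm c)\<^sup>2 - (norm d)\<^sup>2) / (16 * \<alpha>)) (2 * (c \<bullet> d) / (16 * \<alpha>))"
      using \<alpha> by (auto simp: complex_eq_iff Re_divide Im_divide power2_eq_square field_simps)
    ultimately show ?thesis
      using \<alpha> by (simp only: norm_mult norm_power norm_divide norm_exp_eq_Re norm_of_real complex_mod_cnj) 
         (simp add: power2_eq_square)
  qed
  \<comment> \<open>The powers of |z| cancel: the squared height of the kernel is of order |z| to
    the power -n, the Gaussian volume of order |z| to the power n. This makes the estimate uniform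
    in z.\<close>
  also have "((sqrt pi / sqrt (norm z)) ^ CARD('n))\<^sup>2 * (sqrt pi / sqrt (4 * \<alpha>)) ^ CARD('n) = (sqrt pi / 2) ^ CARD('n)"
  proof -
    have "sqrt (4 * \<alpha>) = 2 * pi / norm z"
      using z0 by (simp add: \<alpha>_def real_sqrt_mult real_sqrt_divide)
    then have "(sqrt pi / sqrt (norm z))\<^sup>2 * (sqrt pi / sqrt (4 * \<alpha>)) = sqrt pi / 2"
      using z0 by (simp add: power_divide)
    then show ?thesis
      by (simp only: power_mult_distrib[symmetric] power_mult[symmetric] mult.commute[of "CARD('n)" 2]) (simp only: power_mult power_mult_distrib[symmetric])
  qed
  also have "exp (- R) * exp (((norm c)\<^sup>2 - (norm d)\<^sup>2) / (16 * \<alpha>))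
    = exp (- (\<alpha> / 2) * (norm (x - u))\<^sup>2) * exp (- (\<alpha> / 2) * (norm (x - u'))\<^sup>2) * exp (- (pi\<^sup>2 / 4) * (norm (u - u'))\<^sup>2)"
  proof -
    have 1: "(norm d)\<^sup>2 / (16 * \<alpha>) = (pi\<^sup>2 - \<alpha>) / 4 * (norm (u - u'))\<^sup>2"
    proof -
      have "(norm d)\<^sup>2 = 4 * \<beta>\<^sup>2 * (norm (u - u'))\<^sup>2"
        unfolding d_def by (simp add: power_mult_distrib)
      then show ?thesis using \<alpha> unfolding \<beta> by (simp add: field_simps power2_eq_square)
    qed
    have 2: "(norm c)\<^sup>2 / (16 * \<alpha>) = \<alpha> / 4 * (norm (2 *\<^sub>R x + u + u'))\<^sup>2"
    proof -
      have "c = (2 * \<alpha>) *\<^sub>R (2 *\<^sub>R x + u + u')" unfolding c_def by (simp add: algebra_simps)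
      then have "(norm c)\<^sup>2 = 4 * \<alpha>\<^sup>2 * (norm (2 *\<^sub>R x + u + u'))\<^sup>2"
        by (simp only: norm_scaleR power_mult_distrib power2_abs) simp
      then show ?thesis using \<alpha> by (simp add: power2_eq_square)
    qed
    \<comment> \<open>The deficit \<alpha>/4 |u - u'|^2 joins |2x + u + u'|^2; by the parallelogram
      law the terms regroup into the squared distances of u and u' from x.\<close>
    have "- R + \<alpha> / 4 * (norm (2 *\<^sub>R x + u + u'))\<^sup>2 + \<alpha> / 4 * (norm (u - u'))\<^sup>2
        = - (\<alpha> / 2) * (norm (x - u))\<^sup>2 - (\<alpha> / 2) * (norm (x - u'))\<^sup>2"
      unfolding R_def power2_norm_eq_inner
      by (simp add: inner_diff_left inner_diff_right inner_add_left inner_add_right inner_commute algebra_simps)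
    then have "- R + (\<alpha> / 4 * (norm (2 *\<^sub>R x + u + u'))\<^sup>2 - (pi\<^sup>2 - \<alpha>) / 4 * (norm (u - u'))\<^sup>2)
       = - (\<alpha> / 2) * (norm (x - u))\<^sup>2 + - (\<alpha> / 2) * (norm (x - u'))\<^sup>2 + - (pi\<^sup>2 / 4) * (norm (u - u'))\<^sup>2"
      by (simp add: field_simps)
    then show ?thesis unfolding diff_divide_distrib 1 2 exp_add[symmetric] by simp
  qed
  finally show ?thesis by simp
qed

text \<open>The square of |V f| is a double integral over pairs (u, u'). Integrating in y first
  leaves the correlation just computed; absolute values are taken only afterwards, so the
  cancellation is kept. The two remaining Gaussian factors confine u and u' to the vicinity of
  x.\<close>

lemma gauss_mult_local_L2:
  fixes f :: "real ^ 'n \<Rightarrow> complex" and x :: "real ^ 'n" and z :: complex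
  assumes z: "Re z = 1" and f: "integrable lborel f"
  defines "\<alpha> \<equiv> pi\<^sup>2 / (norm z)\<^sup>2"
  shows "(\<integral>\<^sup>+y. ennreal (exp (- 2 * \<alpha> * (norm (x - y))\<^sup>2) * (norm (gauss_mult z f y))\<^sup>2) \<partial>lborel)
    \<le> ennreal ((sqrt pi / 2) ^ CARD('n)) * (\<integral>\<^sup>+p. ennreal ((norm (f (fst p)) * exp (- (\<alpha> / 2) * (norm (x - fst p))\<^sup>2))
        * (norm (f (snd p)) * exp (- (\<alpha> / 2) * (norm (x - snd p))\<^sup>2)) * exp (- (pi\<^sup>2 / 4) * (norm (fst p - snd p))\<^sup>2)) \<partial>lborel)"
proof -
  have [measurable]: "f \<in> borel_measurable borel" using f by auto
  have [measurable]: "cnj \<in> borel_measurable borel"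
    by (intro borel_measurable_continuous_onI continuous_intros)
  have z': "Re z > 0" "norm z > 0" using z by auto
  have \<alpha>: "\<alpha> > 0" using z' by (simp add: \<alpha>_def)
  \<comment> \<open>This crude bound on the kernel depends on z; it serves only to justify the use
    of Fubini.\<close>
  define M where "M = (sqrt pi / sqrt (norm z)) ^ CARD('n)"
  have M: "norm (gauss_kernel z v) \<le> M" for v :: "real ^ 'n"
    unfolding M_def by (rule norm_gauss_kernel_le[OF z'(1)])
  define P where "P p = f (fst p) * cnj (f (snd p))" for p
  define E where "E y = exp (- 2 * \<alpha> * (norm (x - y))\<^sup>2)" for y
  define Q where "Q p y = gauss_kernel z (y - fst p) * cnj (gauss_kernel z (y - snd p))" for p :: "(real^'n) \<times> (real^'n)" and y
  define N where "N p = (\<integral>y. of_real (E y) * Q p y \<partial>lborel)" for p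
  have [measurable]: "E \<in> borel_measurable borel" unfolding E_def by measurable
  have E: "integrable lborel (\<lambda>y. complex_of_real (E y))"
  proof -
    have "integrable lborel (\<lambda>y::real^'n. exp (- of_real (2 * \<alpha>) * of_real ((norm y)\<^sup>2) + Complex (((4 * \<alpha>) *\<^sub>R x) \<bullet> y) (0 \<bullet> y)) * of_real (exp (- 2 * \<alpha> * (norm x)\<^sup>2)))"
      using \<alpha> by (intro integrable_mult_left integrable_exp_quadratic_euclidean) auto
    also have "(\<lambda>y::real^'n. exp (- of_real (2 * \<alpha>) * of_real ((norm y)\<^sup>2) + Complex (((4 * \<alpha>) *\<^sub>R x) \<bullet> y) (0 \<bullet> y)) * of_real (exp (- 2 * \<alpha> * (norm x)\<^sup>2)))
       = (\<lambda>y. complex_of_real (E y))"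
    proof
      fix y :: "real ^ 'n"
      have "- of_real (2 * \<alpha>) * of_real ((norm y)\<^sup>2) + Complex (((4 * \<alpha>) *\<^sub>R x) \<bullet> y) (0 \<bullet> y) + of_real (- 2 * \<alpha> * (norm x)\<^sup>2)
         = complex_of_real (- 2 * \<alpha> * (norm (x - y))\<^sup>2)"
        unfolding complex_eq_iff power2_norm_eq_inner
        by (simp add: inner_diff_left inner_diff_right inner_commute algebra_simps)
      then show "exp (- of_real (2 * \<alpha>) * of_real ((norm y)\<^sup>2) + Complex (((4 * \<alpha>) *\<^sub>R x) \<bullet> y) (0 \<bullet> y)) * of_real (exp (- 2 * \<alpha> * (norm x)\<^sup>2))
        = complex_of_real (E y)"
        unfolding E_def exp_of_real[symmetric] exp_add[symmetric] by simp
    qed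
    finally show ?thesis .
  qed
  have P: "integrable lborel P"
    using integrable_lborel_pair_mult[OF f integrable_cnj[OF f]]
    unfolding P_def by (simp add: lborel_prod case_prod_unfold)
  have fK: "integrable lborel (\<lambda>u. f u * gauss_kernel z (y - u))" for y
  proof (rule Bochner_Integration.integrable_bound[OF integrable_mult_right[OF f, of "of_real M"]])
    show "AE u in lborel. norm (f u * gauss_kernel z (y - u)) \<le> norm (of_real M * f u)"
      unfolding norm_mult norm_of_real mult.commute[of "\<bar>M\<bar>"]
      by (intro AE_I2 mult_left_mono order_trans[OF M abs_ge_self] norm_ge_zero)
  qed measurable
  have int: "integrable (lborel \<Otimes>\<^sub>M lborel) (\<lambda>(p, y). P p * (of_real (E y) * Q p y))"
  proof (rule Bochner_Integration.integrable_bound)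
    show "integrable (lborel \<Otimes>\<^sub>M lborel) (\<lambda>(p, y). P p * (of_real (M * M) * of_real (E y)))"
      by (intro integrable_lborel_pair_mult P integrable_mult_right E)
    show "(\<lambda>(p, y). P p * (of_real (E y) * Q p y)) \<in> borel_measurable (lborel \<Otimes>\<^sub>M lborel)"
    proof -
      have "sets (lborel \<Otimes>\<^sub>M lborel :: (((real ^ 'n) \<times> (real ^ 'n)) \<times> (real ^ 'n)) measure) = sets ((borel \<Otimes>\<^sub>M borel) \<Otimes>\<^sub>M borel)"
        by (intro sets_pair_measure_cong) (simp_all only: sets_lborel borel_prod)
      then show ?thesis
        unfolding P_def Q_def by (subst measurable_cong_sets[OF _ refl]) measurable
    qed
    have Q: "norm (Q p y) \<le> norm (complex_of_real (M * M))" for p y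
      unfolding Q_def norm_mult complex_mod_cnj norm_of_real
      by (rule order_trans[OF _ abs_ge_self]) (intro mult_mono M norm_ge_zero order_trans[OF norm_ge_zero M])
    have "norm (P p * (of_real (E y) * Q p y)) \<le> norm (P p * (of_real (M * M) * of_real (E y)))" for p y
      unfolding norm_mult[of "P p"] norm_mult[of "of_real (E y)"] norm_mult[of "of_real (M * M)"]
        mult.commute[of "norm (of_real (E y))"]
      by (intro mult_left_mono mult_right_mono Q norm_ge_zero)
    then show "AE q in lborel \<Otimes>\<^sub>M lborel. norm (case q of (p, y) \<Rightarrow> P p * (of_real (E y) * Q p y))
        \<le> norm (case q of (p, y) \<Rightarrow> P p * (of_real (M * M) * of_real (E y)))"
      by (intro AE_I2) (simp only: case_prod_unfold)
  qed
  have sq: "of_real (E y * (norm (gauss_mult z f y))\<^sup>2) = (\<integral>p. P p * (of_real (E y) * Q p y) \<partial>lborel)" for y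
  proof -
    have "of_real ((norm (gauss_mult z f y))\<^sup>2) = (\<integral>u. f u * gauss_kernel z (y - u) \<partial>lborel) * (\<integral>u. cnj (f u * gauss_kernel z (y - u)) \<partial>lborel)"
      unfolding complex_norm_square gauss_mult_eq_convolution[OF z'(1) f] Bochner_Integration.integral_cnj ..
    also have "\<dots> = (\<integral>p. f (fst p) * gauss_kernel z (y - fst p) * cnj (f (snd p) * gauss_kernel z (y - snd p)) \<partial>lborel)"
      by (rule integral_lborel_pair_mult[symmetric, OF fK integrable_cnj[OF fK]])
    also have "\<dots> = (\<integral>p. P p * Q p y \<partial>lborel)"
      unfolding P_def Q_def by (simp only: complex_cnj_mult mult_ac)
    finally have "of_real (E y * (norm (gauss_mult z f y))\<^sup>2) = of_real (E y) * (\<integral>p. P p * Q p y \<partial>lborel)"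
      by simp
    also have "\<dots> = (\<integral>p. P p * (of_real (E y) * Q p y) \<partial>lborel)"
      unfolding integral_mult_right_zero[symmetric] by (simp only: mult_ac)
    finally show ?thesis .
  qed
  have int_E: "integrable lborel (\<lambda>y. complex_of_real (E y * (norm (gauss_mult z f y))\<^sup>2))"
    unfolding sq by (rule lborel_pair.integrable_snd[OF int])
  have int_N: "integrable lborel (\<lambda>p. P p * N p)"
    using lborel_pair.integrable_fst[OF int] unfolding N_def by (simp only: integral_mult_right_zero)
  have "(\<integral>\<^sup>+y. ennreal (E y * (norm (gauss_mult z f y))\<^sup>2) \<partial>lborel) = ennreal (\<integral>y. E y * (norm (gauss_mult z f y))\<^sup>2 \<partial>lborel)"
    using int_E by (intro nn_integral_eq_integral) (auto simp: complex_of_real_integrable_eq E_def simp del: of_real_mult of_real_power)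
  also have "\<dots> \<le> ennreal (norm (\<integral>y. complex_of_real (E y * (norm (gauss_mult z f y))\<^sup>2) \<partial>lborel))"
    by (intro ennreal_leI) (simp only: integral_complex_of_real norm_of_real abs_ge_self)
  also have "(\<integral>y. complex_of_real (E y * (norm (gauss_mult z f y))\<^sup>2) \<partial>lborel) = (\<integral>p. P p * N p \<partial>lborel)"
    unfolding sq lborel_pair.Fubini_integral[OF int] N_def by (simp only: integral_mult_right_zero)
  also have "ennreal (norm (\<integral>p. P p * N p \<partial>lborel)) \<le> (\<integral>\<^sup>+p. norm (P p * N p) \<partial>lborel)"
    by (rule integral_norm_bound_ennreal[OF int_N])
  also have "\<dots> = (\<integral>\<^sup>+p. ennreal ((sqrt pi / 2) ^ CARD('n)) * ennreal ((norm (f (fst p)) * exp (- (\<alpha> / 2) * (norm (x - fst p))\<^sup>2))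
        * (norm (f (snd p)) * exp (- (\<alpha> / 2) * (norm (x - snd p))\<^sup>2)) * exp (- (pi\<^sup>2 / 4) * (norm (fst p - snd p))\<^sup>2)) \<partial>lborel)"
  proof (rule nn_integral_cong)
    fix p
    have "norm (N p) = (sqrt pi / 2) ^ CARD('n) * (exp (- (\<alpha> / 2) * (norm (x - fst p))\<^sup>2) * exp (- (\<alpha> / 2) * (norm (x - snd p))\<^sup>2)
       * exp (- (pi\<^sup>2 / 4) * (norm (fst p - snd p))\<^sup>2))"
      unfolding N_def E_def Q_def \<alpha>_def by (rule norm_gauss_kernel_correlation[OF z])
    then show "ennreal (norm (P p * N p)) = ennreal ((sqrt pi / 2) ^ CARD('n)) * ennreal ((norm (f (fst p)) * exp (- (\<alpha> / 2) * (norm (x - fst p))\<^sup>2))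
        * (norm (f (snd p)) * exp (- (\<alpha> / 2) * (norm (x - snd p))\<^sup>2)) * exp (- (pi\<^sup>2 / 4) * (norm (fst p - snd p))\<^sup>2))"
      by (subst ennreal_mult[symmetric]) (simp_all only: norm_mult P_def complex_mod_cnj mult_ac, auto)
  qed
  also have "\<dots> = ennreal ((sqrt pi / 2) ^ CARD('n)) * (\<integral>\<^sup>+p. ennreal ((norm (f (fst p)) * exp (- (\<alpha> / 2) * (norm (x - fst p))\<^sup>2))
        * (norm (f (snd p)) * exp (- (\<alpha> / 2) * (norm (x - snd p))\<^sup>2)) * exp (- (pi\<^sup>2 / 4) * (norm (fst p - snd p))\<^sup>2)) \<partial>lborel)"
  proof (rule nn_integral_cmult)
    show "(\<lambda>p. ennreal ((norm (f (fst p)) * exp (- (\<alpha> / 2) * (norm (x - fst p))\<^sup>2))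
        * (norm (f (snd p)) * exp (- (\<alpha> / 2) * (norm (x - snd p))\<^sup>2)) * exp (- (pi\<^sup>2 / 4) * (norm (fst p - snd p))\<^sup>2)))
      \<in> borel_measurable lborel"
      unfolding lborel_prod[symmetric] by measurable
  qed
  finally show ?thesis unfolding E_def .
qed

section \<open>Integral inequalities\<close>

lemma nn_integral_lborel_affine:
  fixes f :: "'a::euclidean_space \<Rightarrow> ennreal"
  assumes [measurable]: "f \<in> borel_measurable borel" and c: "\<bar>c\<bar> = 1"
  shows "(\<integral>\<^sup>+x. f (t + c *\<^sub>R x) \<partial>lborel) = (\<integral>\<^sup>+x. f x \<partial>lborel)"
proof -
  have "c \<noteq> 0" using c by auto
  then show ?thesis
    by (subst (2) lborel_affine[of c t]) (simp_all add: nn_integral_density nn_integral_distr c)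
qed

lemma nn_integral_lborel_reflect:
  fixes f :: "'a::euclidean_space \<Rightarrow> ennreal"
  assumes "f \<in> borel_measurable borel"
  shows "(\<integral>\<^sup>+x. f (t - x) \<partial>lborel) = (\<integral>\<^sup>+x. f x \<partial>lborel)"
  using nn_integral_lborel_affine[OF assms, of "-1" t] by simp

lemma nn_integral_lborel_translate:
  fixes f :: "'a::euclidean_space \<Rightarrow> ennreal"
  assumes "f \<in> borel_measurable borel"
  shows "(\<integral>\<^sup>+x. f (x - t) \<partial>lborel) = (\<integral>\<^sup>+x. f x \<partial>lborel)"
  using nn_integral_lborel_affine[OF assms, of 1 "-t"] by simp

lemma nn_integral_lborel_pair:
  fixes f :: "'a::euclidean_space \<times> 'b::euclidean_space \<Rightarrow> ennreal"
  assumes "f \<in> borel_measurable (lborel \<Otimes>\<^sub>M lborel)"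
  shows "(\<integral>\<^sup>+p. f p \<partial>lborel) = (\<integral>\<^sup>+x. \<integral>\<^sup>+y. f (x, y) \<partial>lborel \<partial>lborel)"
  using lborel.nn_integral_fst[of f "lborel :: 'a measure"] assms by (simp add: lborel_prod)

text \<open>The case of Young's inequality for a kernel both bounded and integrable, for all q in
  [1, 2]. Interpolation is replaced by a pointwise inequality for \<open>h\<close> normalised in
  L^q: its first term is the case q = 1, where only G \<le> 1 counts, and the other two terms, each
  contributing I, carry the case q = 2.\<close>

lemma bilinear_convolution_le:
  fixes h G :: "'a::euclidean_space \<Rightarrow> real"
  assumes [measurable]: "h \<in> borel_measurable borel" "G \<in> borel_measurable borel"
    and h: "\<And>x. h x \<ge> 0" and G: "\<And>x. 0 \<le> G x" "\<And>x. G x \<le> 1"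
    and I: "(\<integral>\<^sup>+x. ennreal (G x) \<partial>lborel) = ennreal I" "I \<ge> 0"
    and q: "1 \<le> q" "q \<le> 2"
    and A: "(\<integral>\<^sup>+x. ennreal (h x powr q) \<partial>lborel) = ennreal A" "A \<ge> 0"
  shows "(\<integral>\<^sup>+p. ennreal (h (fst p) * h (snd p) * G (fst p - snd p)) \<partial>lborel) \<le> ennreal ((1 + 2 * I) * A powr (2 / q))"
proof (cases "A = 0")
  case True
  then have "AE x in lborel. ennreal (h x powr q) = 0"
    using A nn_integral_0_iff_AE[of "\<lambda>x. ennreal (h x powr q)" lborel] by simp
  then have h0: "AE x in lborel. h x = 0" by eventually_elim simp
  have "(\<integral>\<^sup>+p. ennreal (h (fst p) * h (snd p) * G (fst p - snd p)) \<partial>lborel)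
     = (\<integral>\<^sup>+x. \<integral>\<^sup>+y. ennreal (h x * h y * G (x - y)) \<partial>lborel \<partial>lborel)"
    by (subst nn_integral_lborel_pair) auto
  also have "\<dots> = (\<integral>\<^sup>+(x::'a). 0 \<partial>lborel)"
  proof (rule nn_integral_cong_AE)
    show "AE x in lborel. (\<integral>\<^sup>+y. ennreal (h x * h y * G (x - y)) \<partial>lborel) = 0"
      using h0 by eventually_elim simp
  qed
  finally show ?thesis by simp
next
  case False
  then have A0: "A > 0" using A by simp
  \<comment> \<open>The L^q norm of \<open>h\<close>. The pointwise inequality below is not
    homogeneous and is applied to h / s.\<close>
  define s where "s = A powr (1 / q)"
  have s: "s > 0" using A0 by (simp add: s_def)
  have sq: "s powr q = A" using A0 q by (simp add: s_def powr_powr)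
  have s2: "s\<^sup>2 = A powr (2 / q)" using A0 by (simp add: s_def powr_powr power2_eq_square flip: powr_add)
  \<comment> \<open>If one of a, b is at least 1, it is below its q-th power, and the other one
    times g is at most its q-th power plus g. If both are below 1, use ab \<le> a^2 + b^2 and q
    \<le> 2.\<close>
  have key: "a * b * g \<le> a powr q * b powr q + a powr q * g + b powr q * g"
    if "0 \<le> a" "0 \<le> b" "0 \<le> g" "g \<le> 1" for a b g :: real
  proof -
    have large: "a * b * g \<le> a powr q * b powr q + a powr q * g" if "a \<ge> 1" "b \<ge> 0" for a b
    proof -
      have "a powr 1 \<le> a powr q" using that q by (intro powr_mono) auto
      then have a: "a \<le> a powr q" using that by simp
      have "b * g \<le> b powr q + g"
      proof (cases "b \<le> 1")
        case True
        then have "b * g \<le> g" using \<open>0 \<le> g\<close> by (intro mult_left_le_one_le) (use that in auto)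
        then show ?thesis by (simp add: add_increasing)
      next
        case False
        then have "b powr 1 \<le> b powr q" using q by (intro powr_mono) auto
        then have "b \<le> b powr q" using False by simp
        moreover have "b * g \<le> b" using False \<open>g \<le> 1\<close> by (intro mult_left_le) auto
        ultimately show ?thesis using \<open>0 \<le> g\<close> by linarith
      qed
      then have "a * (b * g) \<le> a powr q * (b powr q + g)"
        using a that \<open>0 \<le> g\<close> by (intro mult_mono) auto
      then show ?thesis by (simp add: algebra_simps)
    qed
    consider "a \<ge> 1" | "b \<ge> 1" | "a < 1" "b < 1" by linarith
    then show ?thesis
    proof cases
      case 1
      have "0 \<le> b powr q * g" using that by simp
      with large[OF 1 \<open>0 \<le> b\<close>] show ?thesis by linarith
    next
      case 2
      have "0 \<le> a powr q * g" using that by simp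
      with large[OF 2 \<open>0 \<le> a\<close>] show ?thesis by (simp add: mult_ac)
    next
      case 3
      have sq_le: "c * c \<le> c powr q" if "0 \<le> c" "c < 1" for c
      proof (cases "c = 0")
        case False
        then have "c powr 2 \<le> c powr q" using that q by (intro powr_mono') auto
        then show ?thesis using that False by (simp add: powr_numeral power2_eq_square)
      qed simp
      have "a * b \<le> a * a + b * b"
        using sum_squares_bound[of a b] mult_nonneg_nonneg[OF \<open>0 \<le> a\<close> \<open>0 \<le> b\<close>]
        unfolding power2_eq_square by linarith
      also have "\<dots> \<le> a powr q + b powr q" using 3 that by (intro add_mono sq_le)
      finally have "a * b * g \<le> (a powr q + b powr q) * g" using that by (intro mult_right_mono)
      moreover have "0 \<le> a powr q * b powr q" by simp
      ultimately show ?thesis unfolding distrib_right by linarith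
    qed
  qed
  have pw: "h x * h y * G (x - y) \<le> s\<^sup>2 / A\<^sup>2 * (h x powr q * h y powr q)
      + s\<^sup>2 / A * (h x powr q * G (x - y)) + s\<^sup>2 / A * (h y powr q * G (x - y))" for x y
  proof -
    have "(h x / s) * (h y / s) * G (x - y) \<le> (h x / s) powr q * (h y / s) powr q
       + (h x / s) powr q * G (x - y) + (h y / s) powr q * G (x - y)"
      using h s G by (intro key) auto
    then have "s\<^sup>2 * ((h x / s) * (h y / s) * G (x - y)) \<le> s\<^sup>2 * ((h x powr q / A) * (h y powr q / A)
       + (h x powr q / A) * G (x - y) + (h y powr q / A) * G (x - y))"
      using h s by (intro mult_left_mono) (auto simp: powr_divide sq)
    moreover have "s\<^sup>2 * ((h x / s) * (h y / s) * G (x - y)) = h x * h y * G (x - y)"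
      using s by (simp add: power2_eq_square)
    ultimately show ?thesis by (simp add: algebra_simps power2_eq_square)
  qed
  have t1: "(\<integral>\<^sup>+x. \<integral>\<^sup>+y. ennreal (s\<^sup>2 / A\<^sup>2 * (h x powr q * h y powr q)) \<partial>lborel \<partial>lborel) = ennreal (s\<^sup>2)"
  proof -
    have "(\<integral>\<^sup>+y. ennreal (s\<^sup>2 / A\<^sup>2 * (h x powr q * h y powr q)) \<partial>lborel) = ennreal (s\<^sup>2 / A\<^sup>2 * A) * ennreal (h x powr q)" for x
    proof -
      have "(\<integral>\<^sup>+y. ennreal (s\<^sup>2 / A\<^sup>2 * (h x powr q * h y powr q)) \<partial>lborel) = (\<integral>\<^sup>+y. ennreal (s\<^sup>2 / A\<^sup>2 * h x powr q) * ennreal (h y powr q) \<partial>lborel)"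
        using A0 by (intro nn_integral_cong) (simp add: ennreal_mult[symmetric] mult_ac)
      also have "\<dots> = ennreal (s\<^sup>2 / A\<^sup>2 * h x powr q) * ennreal A"
        by (subst nn_integral_cmult) (auto simp: A)
      finally show ?thesis using A0 by (simp add: ennreal_mult[symmetric] mult_ac)
    qed
    then have "(\<integral>\<^sup>+x. \<integral>\<^sup>+y. ennreal (s\<^sup>2 / A\<^sup>2 * (h x powr q * h y powr q)) \<partial>lborel \<partial>lborel) = ennreal (s\<^sup>2 / A\<^sup>2 * A) * ennreal A"
      by (simp add: nn_integral_cmult A)
    then show ?thesis using A0 by (simp add: ennreal_mult[symmetric] power2_eq_square)
  qed
  have t2: "(\<integral>\<^sup>+x. \<integral>\<^sup>+y. ennreal (s\<^sup>2 / A * (h x powr q * G (x - y))) \<partial>lborel \<partial>lborel) = ennreal (s\<^sup>2 * I)"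
  proof -
    have "(\<integral>\<^sup>+y. ennreal (s\<^sup>2 / A * (h x powr q * G (x - y))) \<partial>lborel) = ennreal (s\<^sup>2 / A * I) * ennreal (h x powr q)" for x
    proof -
      have "(\<integral>\<^sup>+y. ennreal (s\<^sup>2 / A * (h x powr q * G (x - y))) \<partial>lborel) = (\<integral>\<^sup>+y. ennreal (s\<^sup>2 / A * h x powr q) * ennreal (G (x - y)) \<partial>lborel)"
        using A0 G by (intro nn_integral_cong) (simp add: ennreal_mult[symmetric] mult_ac)
      also have "\<dots> = ennreal (s\<^sup>2 / A * h x powr q) * ennreal I"
        by (subst nn_integral_cmult) (auto simp: I nn_integral_lborel_reflect[where f = "\<lambda>y. ennreal (G y)"])
      finally show ?thesis using A0 I by (simp add: ennreal_mult[symmetric] mult_ac)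
    qed
    then have "(\<integral>\<^sup>+x. \<integral>\<^sup>+y. ennreal (s\<^sup>2 / A * (h x powr q * G (x - y))) \<partial>lborel \<partial>lborel) = ennreal (s\<^sup>2 / A * I) * ennreal A"
      by (simp add: nn_integral_cmult A)
    then show ?thesis using A0 I by (simp add: ennreal_mult[symmetric])
  qed
  have t3: "(\<integral>\<^sup>+x. \<integral>\<^sup>+y. ennreal (s\<^sup>2 / A * (h y powr q * G (x - y))) \<partial>lborel \<partial>lborel) = ennreal (s\<^sup>2 * I)"
  proof -
    have "(\<integral>\<^sup>+x. ennreal (s\<^sup>2 / A * (h y powr q * G (x - y))) \<partial>lborel) = ennreal (s\<^sup>2 / A * I) * ennreal (h y powr q)" for y
    proof -
      have "(\<integral>\<^sup>+x. ennreal (s\<^sup>2 / A * (h y powr q * G (x - y))) \<partial>lborel) = (\<integral>\<^sup>+x. ennreal (s\<^sup>2 / A * h y powr q) * ennreal (G (x - y)) \<partial>lborel)"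
        using A0 G by (intro nn_integral_cong) (simp add: ennreal_mult[symmetric] mult_ac)
      also have "\<dots> = ennreal (s\<^sup>2 / A * h y powr q) * ennreal I"
        by (subst nn_integral_cmult) (auto simp: I nn_integral_lborel_translate[where f = "\<lambda>y. ennreal (G y)"])
      finally show ?thesis using A0 I by (simp add: ennreal_mult[symmetric] mult_ac)
    qed
    then have "(\<integral>\<^sup>+y. \<integral>\<^sup>+x. ennreal (s\<^sup>2 / A * (h y powr q * G (x - y))) \<partial>lborel \<partial>lborel) = ennreal (s\<^sup>2 / A * I) * ennreal A"
      by (simp add: nn_integral_cmult A)
    then show ?thesis using A0 I by (subst lborel_pair.Fubini') (auto simp: ennreal_mult[symmetric])
  qed
  have "(\<integral>\<^sup>+p. ennreal (h (fst p) * h (snd p) * G (fst p - snd p)) \<partial>lborel)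
     = (\<integral>\<^sup>+x. \<integral>\<^sup>+y. ennreal (h x * h y * G (x - y)) \<partial>lborel \<partial>lborel)"
    by (subst nn_integral_lborel_pair) auto
  also have "\<dots> \<le> (\<integral>\<^sup>+x. \<integral>\<^sup>+y. ennreal (s\<^sup>2 / A\<^sup>2 * (h x powr q * h y powr q))
      + ennreal (s\<^sup>2 / A * (h x powr q * G (x - y))) + ennreal (s\<^sup>2 / A * (h y powr q * G (x - y))) \<partial>lborel \<partial>lborel)"
    using pw A0 G by (intro nn_integral_mono) (simp add: ennreal_plus[symmetric] ennreal_leI del: ennreal_plus)
  also have "\<dots> = (\<integral>\<^sup>+x. \<integral>\<^sup>+y. ennreal (s\<^sup>2 / A\<^sup>2 * (h x powr q * h y powr q)) \<partial>lborel \<partial>lborel)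
      + (\<integral>\<^sup>+x. \<integral>\<^sup>+y. ennreal (s\<^sup>2 / A * (h x powr q * G (x - y))) \<partial>lborel \<partial>lborel)
      + (\<integral>\<^sup>+x. \<integral>\<^sup>+y. ennreal (s\<^sup>2 / A * (h y powr q * G (x - y))) \<partial>lborel \<partial>lborel)"
    by (simp add: nn_integral_add)
  also have "\<dots> = ennreal (s\<^sup>2) + ennreal (s\<^sup>2 * I) + ennreal (s\<^sup>2 * I)"
    unfolding t1 t2 t3 ..
  also have "\<dots> = ennreal ((1 + 2 * I) * A powr (2 / q))"
    using I unfolding s2[symmetric] by (simp add: ennreal_plus[symmetric] algebra_simps del: ennreal_plus)
  finally show ?thesis .
qed

text \<open>Concavity, used through the tangent line at B. Since its slope is nonnegative, an upper
  bound B for the mean is enough and the mean itself need not be known.\<close>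

lemma Jensen_powr_nn_integral:
  fixes \<omega> H :: "'a \<Rightarrow> real"
  assumes [measurable]: "\<omega> \<in> borel_measurable M" "H \<in> borel_measurable M"
    and \<omega>: "\<And>x. \<omega> x \<ge> 0" "(\<integral>\<^sup>+x. ennreal (\<omega> x) \<partial>M) = 1" and H: "\<And>x. H x \<ge> 0"
    and p: "0 < p" "p \<le> 1"
    and B: "(\<integral>\<^sup>+x. ennreal (\<omega> x * H x) \<partial>M) \<le> ennreal B" "B \<ge> 0"
  shows "(\<integral>\<^sup>+x. ennreal (\<omega> x * H x powr p) \<partial>M) \<le> ennreal (B powr p)"
proof (cases "B = 0")
  case True
  then have "(\<integral>\<^sup>+x. ennreal (\<omega> x * H x) \<partial>M) = 0" using B by simp
  then have "AE x in M. ennreal (\<omega> x * H x) = 0"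
    by (subst (asm) nn_integral_0_iff_AE) auto
  then have "AE x in M. ennreal (\<omega> x * H x powr p) = 0"
  proof eventually_elim
    case (elim x)
    then have "\<omega> x * H x \<le> 0" by (simp add: ennreal_eq_0_iff)
    then have "\<omega> x * H x = 0" using \<omega>(1)[of x] H[of x] by (intro antisym) auto
    then show ?case by auto
  qed
  then have "(\<integral>\<^sup>+x. ennreal (\<omega> x * H x powr p) \<partial>M) = (\<integral>\<^sup>+x. 0 \<partial>M)"
    by (intro nn_integral_cong_AE)
  then show ?thesis by simp
next
  case False
  then have B0: "B > 0" using B by simp
  \<comment> \<open>The tangent of u^p at u = B, obtained from weighted AM-GM after multiplication
    by B to the power 1 - p.\<close>
  have key: "u powr p \<le> p * B powr (p - 1) * u + (1 - p) * B powr p" if "u \<ge> 0" for u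
  proof (cases "u = 0")
    case False
    have "u powr p * B powr (1 - p) \<le> p * u + (1 - p) * B"
      using Youngs_inequality_0[of p "1 - p" u B] that False B0 p by simp
    then have "u powr p * B powr (1 - p) * B powr (p - 1) \<le> (p * u + (1 - p) * B) * B powr (p - 1)"
      by (intro mult_right_mono) auto
    moreover have "B powr (1 - p) * B powr (p - 1) = 1" "B * B powr (p - 1) = B powr p"
      using B0 by (auto simp: powr_add[symmetric] powr_mult_base)
    moreover have "(p * u + (1 - p) * B) * B powr (p - 1) = p * B powr (p - 1) * u + (1 - p) * (B * B powr (p - 1))"
      by (simp add: algebra_simps)
    ultimately show ?thesis by (simp add: mult.assoc)
  qed (use p in auto)
  have "(\<integral>\<^sup>+x. ennreal (\<omega> x * H x powr p) \<partial>M)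
    \<le> (\<integral>\<^sup>+x. ennreal (p * B powr (p - 1)) * ennreal (\<omega> x * H x) + ennreal ((1 - p) * B powr p) * ennreal (\<omega> x) \<partial>M)"
  proof (rule nn_integral_mono)
    fix x
    have "\<omega> x * H x powr p \<le> \<omega> x * (p * B powr (p - 1) * H x + (1 - p) * B powr p)"
      using key[OF H] \<omega> by (intro mult_left_mono) auto
    then show "ennreal (\<omega> x * H x powr p) \<le> ennreal (p * B powr (p - 1)) * ennreal (\<omega> x * H x) + ennreal ((1 - p) * B powr p) * ennreal (\<omega> x)"
    proof -
      assume "\<omega> x * H x powr p \<le> \<omega> x * (p * B powr (p - 1) * H x + (1 - p) * B powr p)"
      then have "ennreal (\<omega> x * H x powr p) \<le> ennreal ((p * B powr (p - 1)) * (\<omega> x * H x) + ((1 - p) * B powr p) * \<omega> x)"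
        by (intro ennreal_leI) (simp add: algebra_simps)
      also have "\<dots> = ennreal (p * B powr (p - 1)) * ennreal (\<omega> x * H x) + ennreal ((1 - p) * B powr p) * ennreal (\<omega> x)"
        using \<omega>(1)[of x] H[of x] p by (subst ennreal_plus) (simp_all add: ennreal_mult)
      finally show ?thesis .
    qed
  qed
  also have "\<dots> = ennreal (p * B powr (p - 1)) * (\<integral>\<^sup>+x. ennreal (\<omega> x * H x) \<partial>M) + ennreal ((1 - p) * B powr p)"
    by (simp add: nn_integral_add nn_integral_cmult \<omega>(2))
  also have "\<dots> \<le> ennreal (p * B powr (p - 1)) * ennreal B + ennreal ((1 - p) * B powr p)"
    by (intro add_mono mult_left_mono B) auto
  also have "\<dots> = ennreal (B powr p)"
  proof -
    have "p * B powr (p - 1) * B = p * B powr p"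
      using B0 powr_mult_base[of B "p - 1"] by (simp add: mult.commute mult.left_commute)
    then have "p * B powr (p - 1) * B + (1 - p) * B powr p = B powr p"
      by (simp only:) (simp add: algebra_simps)
    then show ?thesis
      using B0 p by (simp only: ennreal_mult[symmetric] ennreal_plus[symmetric] mult_nonneg_nonneg powr_ge_zero
          less_imp_le diff_ge_0_iff_ge)
  qed
  finally show ?thesis .
qed

lemma Hoelder_nn_integral_powr:
  fixes U V :: "'a \<Rightarrow> real"
  assumes [measurable]: "U \<in> borel_measurable M" "V \<in> borel_measurable M"
    and nn: "\<And>x. U x \<ge> 0" "\<And>x. V x \<ge> 0"
    and u: "(\<integral>\<^sup>+x. ennreal (U x) \<partial>M) = ennreal u" "u \<ge> 0"
    and v: "(\<integral>\<^sup>+x. ennreal (V x) \<partial>M) = ennreal v" "v \<ge> 0"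
    and \<theta>: "0 < \<theta>" "0 < \<eta>" "\<theta> + \<eta> = 1"
  shows "(\<integral>\<^sup>+x. ennreal (U x powr \<theta> * V x powr \<eta>) \<partial>M) \<le> ennreal (u powr \<theta> * v powr \<eta>)"
proof (cases "u = 0 \<or> v = 0")
  case True
  then have "AE x in M. U x = 0 \<or> V x = 0"
  proof
    assume "u = 0"
    then have "AE x in M. ennreal (U x) = 0" using u nn_integral_0_iff_AE[of "\<lambda>x. ennreal (U x)" M] by simp
    then show ?thesis by eventually_elim (use nn in \<open>simp add: ennreal_eq_0_iff antisym\<close>)
  next
    assume "v = 0"
    then have "AE x in M. ennreal (V x) = 0" using v nn_integral_0_iff_AE[of "\<lambda>x. ennreal (V x)" M] by simp
    then show ?thesis by eventually_elim (use nn in \<open>simp add: ennreal_eq_0_iff antisym\<close>)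
  qed
  then have "AE x in M. ennreal (U x powr \<theta> * V x powr \<eta>) = 0" by eventually_elim auto
  then have "(\<integral>\<^sup>+x. ennreal (U x powr \<theta> * V x powr \<eta>) \<partial>M) = (\<integral>\<^sup>+x. 0 \<partial>M)"
    by (intro nn_integral_cong_AE)
  then show ?thesis by simp
next
  case False
  then have uv: "u > 0" "v > 0" using u v by auto
  define K where "K = u powr \<theta> * v powr \<eta>"
  have K: "K \<ge> 0" by (simp add: K_def)
  \<comment> \<open>Weighted AM-GM for a/u and b/v, multiplied by K; after integration the two
    coefficients add up to K.\<close>
  have key: "a powr \<theta> * b powr \<eta> \<le> K * \<theta> / u * a + K * \<eta> / v * b" if "a \<ge> 0" "b \<ge> 0" for a b
  proof (cases "a = 0 \<or> b = 0")
    case True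
    then show ?thesis using that K uv \<theta> by auto
  next
    case False
    have "(a / u) powr \<theta> * (b / v) powr \<eta> \<le> \<theta> * (a / u) + \<eta> * (b / v)"
      using False that uv \<theta> by (intro Youngs_inequality_0) auto
    then have "K * ((a / u) powr \<theta> * (b / v) powr \<eta>) \<le> K * (\<theta> * (a / u) + \<eta> * (b / v))"
      using K by (intro mult_left_mono)
    moreover have "K * ((a / u) powr \<theta> * (b / v) powr \<eta>) = a powr \<theta> * b powr \<eta>"
      using uv that by (simp add: K_def powr_divide)
    ultimately show ?thesis by (simp add: algebra_simps)
  qed
  have "(\<integral>\<^sup>+x. ennreal (U x powr \<theta> * V x powr \<eta>) \<partial>M)
    \<le> (\<integral>\<^sup>+x. ennreal (K * \<theta> / u) * ennreal (U x) + ennreal (K * \<eta> / v) * ennreal (V x) \<partial>M)"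
    using key nn K uv \<theta>
    by (intro nn_integral_mono) (simp add: ennreal_mult[symmetric] ennreal_plus[symmetric] ennreal_leI del: ennreal_plus)
  also have "\<dots> = ennreal (K * \<theta> / u) * ennreal u + ennreal (K * \<eta> / v) * ennreal v"
    by (simp add: nn_integral_add nn_integral_cmult u v)
  also have "\<dots> = ennreal K"
  proof -
    have "K * \<theta> + K * \<eta> = K" using \<theta>(3) by (simp add: distrib_left[symmetric])
    then have "K * \<theta> / u * u + K * \<eta> / v * v = K" using uv by simp
    then show ?thesis
      using uv K \<theta> by (simp only: ennreal_mult[symmetric] ennreal_plus[symmetric] mult_nonneg_nonneg
          divide_nonneg_nonneg less_imp_le)
  qed
  finally show ?thesis unfolding K_def .
qed

section \<open>Superposition of Gaussian multipliers\<close>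

text \<open>The bounds A and B on pi^2/|z|^2 detach both weights from z: a single pair serves a
  whole dyadic block of t, so the weights can be pulled out of the t-integral. The constant depends
  on the dimension only.\<close>

lemma gauss_mult_local_bound:
  "\<exists>C\<ge>0. \<forall>(f :: real ^ 'n \<Rightarrow> complex) q z x A B. integrable lborel f \<longrightarrow> 1 \<le> q \<longrightarrow> q \<le> 2 \<longrightarrow>
     integrable lborel (\<lambda>u. norm (f u) powr q) \<longrightarrow> Re z = 1 \<longrightarrow> 0 \<le> B \<longrightarrow> B \<le> pi\<^sup>2 / (norm z)\<^sup>2 \<longrightarrow> pi\<^sup>2 / (norm z)\<^sup>2 \<le> A \<longrightarrow>
     (\<integral>\<^sup>+y. ennreal (exp (- 2 * A * (norm (x - y))\<^sup>2) * (norm (gauss_mult z f y))\<^sup>2) \<partial>lborel)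
      \<le> ennreal (C * (\<integral>u. norm (f u) powr q * exp (- (B / 2) * (norm (x - u))\<^sup>2) \<partial>lborel) powr (2 / q))"
proof -
  define G :: "real ^ 'n \<Rightarrow> real" where "G v = exp (- (pi\<^sup>2 / 4) * (norm v)\<^sup>2)" for v
  have [measurable]: "G \<in> borel_measurable borel" unfolding G_def by measurable
  define I where "I = (\<integral>v. G v \<partial>lborel)"
  have "integrable lborel (\<lambda>v::real^'n. exp (- complex_of_real (pi\<^sup>2 / 4) * of_real ((norm v)\<^sup>2)))"
    by (rule integrable_exp_minus_norm_sq) simp
  then have "integrable lborel (\<lambda>v. complex_of_real (G v))"
    unfolding G_def exp_of_real[symmetric] of_real_mult of_real_minus .
  then have G: "integrable lborel G" by (simp add: complex_of_real_integrable_eq)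
  have I: "(\<integral>\<^sup>+v. ennreal (G v) \<partial>lborel) = ennreal I" "I \<ge> 0"
    unfolding I_def by (rule nn_integral_eq_integral[OF G]) (auto simp: G_def intro!: integral_nonneg_AE)
  define C where "C = (sqrt pi / 2) ^ CARD('n) * (1 + 2 * I)"
  have C: "C \<ge> 0" using I by (simp add: C_def)
  have main: "(\<integral>\<^sup>+y. ennreal (exp (- 2 * A * (norm (x - y))\<^sup>2) * (norm (gauss_mult z f y))\<^sup>2) \<partial>lborel)
      \<le> ennreal (C * (\<integral>u. norm (f u) powr q * exp (- (B / 2) * (norm (x - u))\<^sup>2) \<partial>lborel) powr (2 / q))"
    if f: "integrable lborel f" and q: "1 \<le> q" "q \<le> 2" and fq: "integrable lborel (\<lambda>u. norm (f u) powr q)"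
      and z: "Re z = 1" and AB: "0 \<le> B" "B \<le> pi\<^sup>2 / (norm z)\<^sup>2" "pi\<^sup>2 / (norm z)\<^sup>2 \<le> A"
    for f :: "real ^ 'n \<Rightarrow> complex" and q z x A B
  proof -
    have [measurable]: "f \<in> borel_measurable borel" using f by auto
    define \<alpha> where "\<alpha> = pi\<^sup>2 / (norm z)\<^sup>2"
    define h where "h u = norm (f u) * exp (- (\<alpha> / 2) * (norm (x - u))\<^sup>2)" for u
    have [measurable]: "h \<in> borel_measurable borel" unfolding h_def by measurable
    \<comment> \<open>Raising to the power q \<ge> 1 only sharpens the Gaussian, and \<alpha> \<ge>
      B allows it to be replaced by the wider one.\<close>
    have hq_le: "h u powr q \<le> norm (f u) powr q * exp (- (B / 2) * (norm (x - u))\<^sup>2)" for u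
    proof -
      have "B * (norm (x - u))\<^sup>2 \<le> \<alpha> * (norm (x - u))\<^sup>2"
        using AB by (intro mult_right_mono) (auto simp: \<alpha>_def)
      also have "\<dots> \<le> q * (\<alpha> * (norm (x - u))\<^sup>2)"
        using mult_right_mono[OF q(1), of "\<alpha> * (norm (x - u))\<^sup>2"] AB by (simp add: \<alpha>_def)
      finally have "exp (- (\<alpha> / 2) * (norm (x - u))\<^sup>2 * q) \<le> exp (- (B / 2) * (norm (x - u))\<^sup>2)"
        by (simp add: mult_ac)
      then show ?thesis
        unfolding h_def by (simp add: powr_mult exp_powr_real mult_left_mono)
    qed
    define A1 where "A1 = (\<integral>u. h u powr q \<partial>lborel)"
    have bint: "integrable lborel (\<lambda>u. norm (f u) powr q * exp (- (B / 2) * (norm (x - u))\<^sup>2))"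
      by (rule Bochner_Integration.integrable_bound[OF fq]) (use AB in \<open>auto intro!: AE_I2 mult_left_le\<close>)
    have hint: "integrable lborel (\<lambda>u. h u powr q)"
      by (rule Bochner_Integration.integrable_bound[OF bint]) (use hq_le in \<open>auto intro!: AE_I2\<close>)
    have A1: "(\<integral>\<^sup>+u. ennreal (h u powr q) \<partial>lborel) = ennreal A1" "A1 \<ge> 0"
      unfolding A1_def by (rule nn_integral_eq_integral[OF hint]) (auto intro!: integral_nonneg_AE)
    have A1_le: "A1 \<le> (\<integral>u. norm (f u) powr q * exp (- (B / 2) * (norm (x - u))\<^sup>2) \<partial>lborel)"
      unfolding A1_def by (rule integral_mono[OF hint bint]) (rule hq_le)
    have "(\<integral>\<^sup>+y. ennreal (exp (- 2 * A * (norm (x - y))\<^sup>2) * (norm (gauss_mult z f y))\<^sup>2) \<partial>lborel)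
      \<le> (\<integral>\<^sup>+y. ennreal (exp (- 2 * \<alpha> * (norm (x - y))\<^sup>2) * (norm (gauss_mult z f y))\<^sup>2) \<partial>lborel)"
    proof (intro nn_integral_mono ennreal_leI mult_right_mono)
      fix y
      have "\<alpha> * (norm (x - y))\<^sup>2 \<le> A * (norm (x - y))\<^sup>2"
        using AB by (intro mult_right_mono) (auto simp: \<alpha>_def)
      then show "exp (- 2 * A * (norm (x - y))\<^sup>2) \<le> exp (- 2 * \<alpha> * (norm (x - y))\<^sup>2)"
        by (simp add: mult.assoc)
    qed auto
    also have "\<dots> \<le> ennreal ((sqrt pi / 2) ^ CARD('n)) * (\<integral>\<^sup>+p. ennreal (h (fst p) * h (snd p) * G (fst p - snd p)) \<partial>lborel)"
      using gauss_mult_local_L2[OF z f, of x] unfolding h_def G_def \<alpha>_def .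
    also have "\<dots> \<le> ennreal ((sqrt pi / 2) ^ CARD('n)) * ennreal ((1 + 2 * I) * A1 powr (2 / q))"
    proof (intro mult_left_mono bilinear_convolution_le)
      show "G v \<le> 1" for v unfolding G_def by simp
    qed (use I q A1 in \<open>auto simp: h_def G_def\<close>)
    also have "\<dots> = ennreal (C * A1 powr (2 / q))"
      using I by (simp add: C_def ennreal_mult[symmetric] mult.assoc)
    also have "\<dots> \<le> ennreal (C * (\<integral>u. norm (f u) powr q * exp (- (B / 2) * (norm (x - u))\<^sup>2) \<partial>lborel) powr (2 / q))"
      using C A1 A1_le q by (intro ennreal_leI mult_left_mono powr_mono2) auto
    finally show ?thesis .
  qed
  show ?thesis
    by (rule exI[of _ C]) (use C main in blast)
qed

text \<open>A bound uniform in t and x. Its only purpose is to make the t-integrals converge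
  absolutely; it does not enter the final constant.\<close>

lemma norm_gauss_mult_le:
  fixes f :: "real ^ 'n \<Rightarrow> complex"
  assumes "Re z = 1"
  shows "norm (gauss_mult z f x) \<le> (\<integral>\<xi>. exp (- (norm (\<xi> :: real ^ 'n))\<^sup>2) \<partial>lborel) * (\<integral>x. norm (f x) \<partial>lborel)"
proof -
  have "integrable lborel (\<lambda>v::real^'n. exp (- 1 * complex_of_real ((norm v)\<^sup>2)))"
    by (rule integrable_exp_minus_norm_sq) simp
  then have "integrable lborel (\<lambda>v::real^'n. norm (exp (- 1 * complex_of_real ((norm v)\<^sup>2))))" by (rule integrable_norm)
  then have int: "integrable lborel (\<lambda>v::real^'n. exp (- (norm v)\<^sup>2))"
    by (simp add: norm_exp_eq_Re)
  have "norm (gauss_mult z f x) \<le> (\<integral>\<xi>. norm (exp (- z * of_real ((norm \<xi>)\<^sup>2)) * fourier f \<xi>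
     * exp (2 * of_real pi * \<i> * of_real (x \<bullet> \<xi>))) \<partial>lborel)"
    unfolding gauss_mult_def by (rule integral_norm_bound)
  also have "\<dots> \<le> (\<integral>\<xi>. exp (- (norm (\<xi> :: real ^ 'n))\<^sup>2) * (\<integral>x. norm (f x) \<partial>lborel) \<partial>lborel)"
  proof (rule integral_mono')
    show "norm (exp (- z * of_real ((norm \<xi>)\<^sup>2)) * fourier f \<xi> * exp (2 * of_real pi * \<i> * of_real (x \<bullet> \<xi>)))
        \<le> exp (- (norm \<xi>)\<^sup>2) * (\<integral>x. norm (f x) \<partial>lborel)" for \<xi>
      using assms by (simp add: norm_mult norm_exp_eq_Re norm_fourier_le)
  qed (use int in auto)
  finally show ?thesis by simp
qed

lemma gauss_mult_measurable:
  fixes f :: "real ^ 'n \<Rightarrow> complex"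
  assumes "f \<in> borel_measurable borel"
  shows "(\<lambda>(x, t). gauss_mult (1 - \<i> * of_real t) f x) \<in> borel_measurable (borel \<Otimes>\<^sub>M borel)"
proof -
  have [measurable]: "fourier f \<in> borel_measurable borel" by (rule fourier_measurable[OF assms])
  show ?thesis unfolding gauss_mult_def by measurable
qed

text \<open>The power of 1 - |\<xi>|^2 - |\<eta>|^2 couples the two frequencies, whereas an
  exponential of it factorises. Laplace inversion followed by Fubini therefore yields products of
  linear operators.\<close>

lemma bochner_riesz_eq_gauss_mult_integral:
  fixes f g :: "real ^ 'n \<Rightarrow> complex"
  assumes f: "integrable lborel f" and g: "integrable lborel g" and \<delta>: "\<delta> \<ge> 1"
  shows "bochner_riesz \<delta> f g x = of_real (Gamma (\<delta> + 1) / (2 * pi)) *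
    (\<integral>t. (1 - \<i> * of_real t) powr of_real (- (\<delta> + 1)) * exp (1 - \<i> * of_real t)
       * (gauss_mult (1 - \<i> * of_real t) f x * gauss_mult (1 - \<i> * of_real t) g x) \<partial>lborel)"
proof -
  define c where "c = complex_of_real (Gamma (\<delta> + 1) / (2 * pi))"
  define \<gamma> where "\<gamma> t = (1 - \<i> * of_real t) powr of_real (- (\<delta> + 1))" for t
  define \<psi> where "\<psi> h \<xi> = fourier h \<xi> * exp (2 * of_real pi * \<i> * of_real (x \<bullet> \<xi>))" for h \<xi>
  define w where "w p = 1 - (norm (fst p))\<^sup>2 - (norm (snd p))\<^sup>2" for p :: "(real ^ 'n) \<times> (real ^ 'n)"
  define K where "K p t = \<gamma> t * exp ((1 - \<i> * of_real t) * of_real (w p)) * (\<psi> f (fst p) * \<psi> g (snd p))" for p t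
  have [measurable]: "f \<in> borel_measurable borel" "g \<in> borel_measurable borel" using f g by auto
  have [measurable]: "\<psi> f \<in> borel_measurable borel" "\<psi> g \<in> borel_measurable borel"
    unfolding \<psi>_def[abs_def] using fourier_measurable[of f] fourier_measurable[of g] by auto
  have \<gamma>: "integrable lborel \<gamma>" unfolding \<gamma>_def by (rule integrable_one_minus_ii_powr[OF \<delta>])
  then have [measurable]: "\<gamma> \<in> borel_measurable borel" by auto
  have \<psi>: "norm (\<psi> h \<xi>) \<le> (\<integral>x. norm (h x) \<partial>lborel)" for h \<xi>
    unfolding \<psi>_def by (simp add: norm_mult norm_exp_eq_Re norm_fourier_le)
  define Bf where "Bf = (\<integral>x. norm (f x) \<partial>lborel)"
  define Bg where "Bg = (\<integral>x. norm (g x) \<partial>lborel)"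
  have e_int: "integrable lborel (\<lambda>\<xi>::real^'n. exp (- z * complex_of_real ((norm \<xi>)\<^sup>2)))" if "Re z = 1" for z
    by (rule integrable_exp_minus_norm_sq) (use that in simp)
  have e2_int: "integrable lborel (\<lambda>p::(real^'n) \<times> (real^'n). exp (- 1 * complex_of_real ((norm (fst p))\<^sup>2)) * exp (- 1 * complex_of_real ((norm (snd p))\<^sup>2)))"
    using integrable_lborel_pair_mult[OF e_int[of 1] e_int[of 1]] by (simp add: lborel_prod case_prod_unfold)
  have sets_eq: "sets (lborel \<Otimes>\<^sub>M lborel :: (((real ^ 'n) \<times> (real ^ 'n)) \<times> real) measure) = sets ((borel \<Otimes>\<^sub>M borel) \<Otimes>\<^sub>M borel)"
    by (intro sets_pair_measure_cong) (simp_all only: sets_lborel borel_prod)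
  \<comment> \<open>The modulus of the exponential is e times a Gaussian in each frequency and does
    not involve t, so a product of integrable functions dominates.\<close>
  have K_int: "integrable (lborel \<Otimes>\<^sub>M lborel) (\<lambda>(p, t). K p t)"
  proof (rule Bochner_Integration.integrable_bound)
    show "integrable (lborel \<Otimes>\<^sub>M lborel) (\<lambda>(p::(real^'n) \<times> (real^'n), t).
        (exp (- 1 * complex_of_real ((norm (fst p))\<^sup>2)) * exp (- 1 * complex_of_real ((norm (snd p))\<^sup>2))) * (of_real (exp 1 * (Bf * Bg)) * \<gamma> t))"
      by (intro integrable_lborel_pair_mult e2_int integrable_mult_right \<gamma>)
    show "(\<lambda>(p, t). K p t) \<in> borel_measurable (lborel \<Otimes>\<^sub>M lborel)"
      unfolding K_def w_def by (subst measurable_cong_sets[OF sets_eq refl]) measurable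
    have "norm (K p t) \<le> norm ((exp (- 1 * complex_of_real ((norm (fst p))\<^sup>2)) * exp (- 1 * complex_of_real ((norm (snd p))\<^sup>2))) * (of_real (exp 1 * (Bf * Bg)) * \<gamma> t))" for p t
    proof -
      have "norm (\<psi> f (fst p)) * norm (\<psi> g (snd p)) \<le> Bf * Bg"
        unfolding Bf_def Bg_def by (intro mult_mono \<psi>) auto
      moreover have "norm (exp ((1 - \<i> * of_real t) * of_real (w p))) = exp 1 * (exp (- (norm (fst p))\<^sup>2) * exp (- (norm (snd p))\<^sup>2))"
        by (simp add: norm_exp_eq_Re w_def flip: exp_add)
      ultimately have "norm (K p t) \<le> norm (\<gamma> t) * (exp 1 * (exp (- (norm (fst p))\<^sup>2) * exp (- (norm (snd p))\<^sup>2))) * (Bf * Bg)"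
        unfolding K_def norm_mult by (simp add: mult_left_mono)
      also have "\<dots> = norm ((exp (- 1 * complex_of_real ((norm (fst p))\<^sup>2)) * exp (- 1 * complex_of_real ((norm (snd p))\<^sup>2))) * (of_real (exp 1 * (Bf * Bg)) * \<gamma> t))"
        unfolding norm_mult norm_exp_eq_Re norm_of_real by (simp add: Bf_def Bg_def abs_mult mult_ac)
      finally show ?thesis .
    qed
    then show "AE q in lborel \<Otimes>\<^sub>M lborel. norm (case q of (p, t) \<Rightarrow> K p t) \<le> norm (case q of (p, t) \<Rightarrow>
        (exp (- 1 * complex_of_real ((norm (fst p))\<^sup>2)) * exp (- 1 * complex_of_real ((norm (snd p))\<^sup>2))) * (of_real (exp 1 * (Bf * Bg)) * \<gamma> t))"
      by (intro AE_I2) (simp only: case_prod_unfold)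
  qed
  \<comment> \<open>The indicator of the ball is absorbed into \<open>max 0\<close>, since 0 to a
    positive power is 0.\<close>
  have "bochner_riesz \<delta> f g x = (\<integral>p. of_real (max 0 (w p) powr \<delta>) * (\<psi> f (fst p) * \<psi> g (snd p)) \<partial>lborel)"
    unfolding bochner_riesz_def set_lebesgue_integral_def
  proof (intro Bochner_Integration.integral_cong refl)
    fix p :: "(real ^ 'n) \<times> (real ^ 'n)"
    obtain \<xi> \<eta> where p: "p = (\<xi>, \<eta>)" by fastforce
    have e: "exp (2 * of_real pi * \<i> * of_real (x \<bullet> (\<xi> + \<eta>))) = exp (2 * of_real pi * \<i> * of_real (x \<bullet> \<xi>)) * exp (2 * of_real pi * \<i> * of_real (x \<bullet> \<eta>))"
      by (simp add: inner_add_right distrib_left flip: exp_add)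
    have assoc: "m * F * G * (X * Y) = m * ((F * X) * (G * Y))" for m F G X Y :: complex
      by (simp only: mult_ac)
    show "indicat_real {(\<xi>, \<eta>). (norm \<xi>)\<^sup>2 + (norm \<eta>)\<^sup>2 \<le> 1} p *\<^sub>R
        (case p of (\<xi>, \<eta>) \<Rightarrow> of_real ((1 - (norm \<xi>)\<^sup>2 - (norm \<eta>)\<^sup>2) powr \<delta>) * fourier f \<xi> * fourier g \<eta> *
          exp (2 * of_real pi * \<i> * of_real (x \<bullet> (\<xi> + \<eta>))))
      = of_real (max 0 (w p) powr \<delta>) * (\<psi> f (fst p) * \<psi> g (snd p))"
    proof (cases "(norm \<xi>)\<^sup>2 + (norm \<eta>)\<^sup>2 \<le> 1")
      case True
      then have "max 0 (w p) = 1 - (norm \<xi>)\<^sup>2 - (norm \<eta>)\<^sup>2" by (simp add: w_def p)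
      then show ?thesis
        using True unfolding p \<psi>_def prod.case fst_conv snd_conv e assoc by simp
    next
      case False
      then have "max 0 (w p) = 0" by (simp add: w_def p)
      then show ?thesis using False by (simp add: p)
    qed
  qed
  also have "\<dots> = (\<integral>p. c * (\<integral>t. K p t \<partial>lborel) \<partial>lborel)"
  proof (intro Bochner_Integration.integral_cong refl)
    fix p
    show "of_real (max 0 (w p) powr \<delta>) * (\<psi> f (fst p) * \<psi> g (snd p)) = c * (\<integral>t. K p t \<partial>lborel)"
      unfolding powr_eq_Laplace_integral[OF \<delta>] K_def \<gamma>_def c_def by (simp only: mult.assoc integral_mult_left_zero[symmetric])
  qed
  also have "\<dots> = c * (\<integral>t. (\<integral>p. K p t \<partial>lborel) \<partial>lborel)"
    unfolding lborel_pair.Fubini_integral[OF K_int] by (simp only: integral_mult_right_zero)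
  also have "(\<integral>t. (\<integral>p. K p t \<partial>lborel) \<partial>lborel) = (\<integral>t. \<gamma> t * exp (1 - \<i> * of_real t)
       * (gauss_mult (1 - \<i> * of_real t) f x * gauss_mult (1 - \<i> * of_real t) g x) \<partial>lborel)"
  proof (intro Bochner_Integration.integral_cong refl)
    fix t :: real
    define z where "z = 1 - \<i> * of_real t"
    have z: "Re z = 1" by (simp add: z_def)
    define E where "E h \<xi> = exp (- z * of_real ((norm \<xi>)\<^sup>2)) * fourier h \<xi> * exp (2 * of_real pi * \<i> * of_real (x \<bullet> \<xi>))" for h and \<xi> :: "real ^ 'n"
    have E: "integrable lborel (E h)" if [measurable]: "h \<in> borel_measurable borel" for h
    proof (rule Bochner_Integration.integrable_bound)
      show "integrable lborel (\<lambda>\<xi>::real^'n. exp (- z * complex_of_real ((norm \<xi>)\<^sup>2)) * of_real (\<integral>x. norm (h x) \<partial>lborel))"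
        by (intro integrable_mult_left e_int z)
      show "E h \<in> borel_measurable lborel"
        unfolding E_def using fourier_measurable[of h] by measurable
      show "AE \<xi> in lborel. norm (E h \<xi>) \<le> norm (exp (- z * complex_of_real ((norm \<xi>)\<^sup>2)) * of_real (\<integral>x. norm (h x) \<partial>lborel))"
        unfolding E_def norm_mult by (intro AE_I2) (auto simp: norm_exp_eq_Re norm_fourier_le intro!: mult_left_mono order_trans[OF norm_fourier_le abs_ge_self])
    qed
    have "K p t = \<gamma> t * exp z * (E f (fst p) * E g (snd p))" for p
    proof -
      have "exp (z * of_real (w p)) = exp z * (exp (- z * of_real ((norm (fst p))\<^sup>2)) * exp (- z * of_real ((norm (snd p))\<^sup>2)))"
        unfolding w_def by (simp add: algebra_simps flip: exp_add)
      moreover have "G * (e * (a * b)) * ((F * X) * (H * Y)) = G * e * ((a * F * X) * (b * H * Y))" for G e a b F X H Y :: complex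
        by (simp only: mult_ac)
      ultimately show ?thesis
        unfolding K_def E_def \<psi>_def z_def[symmetric] by (simp only:)
    qed
    then have "(\<integral>p. K p t \<partial>lborel) = \<gamma> t * exp z * (\<integral>p. E f (fst p) * E g (snd p) \<partial>lborel)"
      by (simp only: integral_mult_right_zero)
    also have "(\<integral>p. E f (fst p) * E g (snd p) \<partial>lborel) = gauss_mult z f x * gauss_mult z g x"
    proof -
      have "integrable lborel (E f)" "integrable lborel (E g)" by (rule E, measurable)+
      from integral_lborel_pair_mult[OF this] show ?thesis
        unfolding E_def gauss_mult_def .
    qed
    finally show "(\<integral>p. K p t \<partial>lborel) = \<gamma> t * exp (1 - \<i> * of_real t)
       * (gauss_mult (1 - \<i> * of_real t) f x * gauss_mult (1 - \<i> * of_real t) g x)"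
      unfolding z_def .
  qed
  finally show ?thesis unfolding c_def \<gamma>_def .
qed

section \<open>Auxiliary facts on nonnegative integrals and series\<close>

lemma ennreal_power2_le_imp_le:
  assumes "X\<^sup>2 \<le> ennreal (k\<^sup>2)" "k \<ge> 0"
  shows "X \<le> ennreal k"
proof (cases X)
  case (real x)
  then have "x\<^sup>2 \<le> k\<^sup>2" using assms by (simp add: ennreal_power)
  then have "x \<le> k" using assms(2) by (rule power2_le_imp_le)
  then show ?thesis using real by (simp add: ennreal_leI)
next
  case top
  then show ?thesis using assms by (simp add: top_unique power2_eq_square ennreal_mult_top)
qed

lemma ennreal_integral_le_nn_integral:
  fixes f :: "'a \<Rightarrow> real"
  assumes "\<And>x. f x \<ge> 0"
  shows "ennreal (\<integral>x. f x \<partial>M) \<le> (\<integral>\<^sup>+x. ennreal (f x) \<partial>M)"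
proof (cases "integrable M f")
  case True
  then show ?thesis using assms by (subst nn_integral_eq_integral) auto
next
  \<comment> \<open>The Bochner integral of a non-integrable function is 0 by convention, so the
    inequality is trivial. Integrability of the dyadic pieces in t thus need not be checked when
    they are bounded from above.\<close>
  case False
  then show ?thesis by (simp add: not_integrable_integral_eq)
qed

text \<open>The substitute for the triangle inequality when p \<le> 1. If T is the sum of the p-th
  powers, then each one is at most T, hence a_j is at most T to the power (1 - p)/p times its own
  p-th power, and summation gives T to the power 1/p. Bounding x by an extended sum also covers
  divergent series.\<close>

lemma powr_suminf_le_suminf_powr:
  fixes a :: "nat \<Rightarrow> real"
  assumes a: "\<And>j. a j \<ge> 0" and x: "x \<ge> 0" "ennreal x \<le> (\<Sum>j. ennreal (a j))" and p: "0 < p" "p \<le> 1"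
  shows "ennreal (x powr p) \<le> (\<Sum>j. ennreal (a j powr p))"
proof (cases "(\<Sum>j. ennreal (a j powr p))")
  case (real T)
  have le: "a j powr p \<le> T" for j
  proof -
    have "(\<Sum>i\<in>{j}. ennreal (a i powr p)) \<le> (\<Sum>j. ennreal (a j powr p))"
      by (intro sum_le_suminf) auto
    then show ?thesis using real by simp
  qed
  have "a j \<le> T powr ((1 - p) / p) * a j powr p" for j
  proof (cases "a j = 0")
    case False
    have "a j = (a j powr p) powr ((1 - p) / p) * a j powr p"
      using False a[of j] p by (simp add: powr_powr flip: powr_add)
    also have "\<dots> \<le> T powr ((1 - p) / p) * a j powr p"
      using le[of j] p by (intro mult_right_mono powr_mono2) auto
    finally show ?thesis .
  qed simp
  then have "(\<Sum>j. ennreal (a j)) \<le> (\<Sum>j. ennreal (T powr ((1 - p) / p)) * ennreal (a j powr p))"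
    by (intro suminf_le) (auto simp: ennreal_mult[symmetric] ennreal_leI)
  also have "\<dots> = ennreal (T powr ((1 - p) / p)) * ennreal T"
    using real by simp
  also have "\<dots> = ennreal (T powr (1 / p))"
  proof (cases "T = 0")
    case False
    then have "T powr ((1 - p) / p) * T powr 1 = T powr (1 / p)"
      using p unfolding powr_add[symmetric] by (simp add: field_simps)
    then show ?thesis using real False by (simp add: ennreal_mult[symmetric])
  qed (use p in auto)
  finally have "ennreal x \<le> ennreal (T powr (1 / p))" using x(2) by (rule order_trans[rotated])
  then have "x \<le> T powr (1 / p)" by simp
  then have "x powr p \<le> (T powr (1 / p)) powr p" using x p by (intro powr_mono2) auto
  also have "\<dots> = T" using real p by (simp add: powr_powr)
  finally show ?thesis using real by (simp add: ennreal_leI)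
qed simp

lemma nn_integral_gaussian:
  assumes s: "s > 0"
  shows "(\<integral>\<^sup>+v. ennreal (exp (- s * (norm (v :: 'a::euclidean_space))\<^sup>2)) \<partial>lborel) = ennreal (sqrt (pi / s) ^ DIM('a))"
proof -
  have eq: "exp (- complex_of_real s * of_real ((norm v)\<^sup>2) + Complex (0 \<bullet> v) (0 \<bullet> v)) = of_real (exp (- s * (norm v)\<^sup>2))" for v :: 'a
    by (simp add: zero_complex.code[symmetric] exp_of_real[symmetric])
  have "integrable lborel (\<lambda>v::'a. complex_of_real (exp (- s * (norm v)\<^sup>2)))"
    using integrable_exp_quadratic_euclidean[of "of_real s" "0::'a" 0] s unfolding eq by simp
  then have int: "integrable lborel (\<lambda>v::'a. exp (- s * (norm v)\<^sup>2))"
    by (simp only: complex_of_real_integrable_eq)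
  have "complex_of_real (\<integral>(v::'a). exp (- s * (norm v)\<^sup>2) \<partial>lborel) = (\<integral>(v::'a). of_real (exp (- s * (norm v)\<^sup>2)) \<partial>lborel)"
    by (simp only: integral_complex_of_real)
  also have "\<dots> = of_real (sqrt (pi / s) ^ DIM('a))"
    using integral_exp_quadratic_euclidean[of "of_real s" "0::'a" 0] s unfolding eq
    by (simp add: zero_complex.code[symmetric] csqrt_of_real_nonneg real_sqrt_divide)
  finally have "(\<integral>(v::'a). exp (- s * (norm v)\<^sup>2) \<partial>lborel) = sqrt (pi / s) ^ DIM('a)"
    by (simp only: of_real_eq_iff)
  then show ?thesis using nn_integral_eq_integral[OF int] by simp
qed

section \<open>Integrability of Schwartz functions\<close>

lemma integrable_lborel_rapid_decay:
  fixes f :: "'a::euclidean_space \<Rightarrow> complex"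
  assumes [measurable]: "f \<in> borel_measurable borel"
    and decay: "\<And>k. \<exists>B. \<forall>x. norm x ^ k * norm (f x) \<le> B"
  shows "integrable lborel f"
proof -
  define n where "n = DIM('a)"
  obtain B0 where B0: "\<And>x. norm x ^ 0 * norm (f x) \<le> B0" using decay[of 0] by blast
  obtain B1 where B1: "\<And>x. norm x ^ (2 * n) * norm (f x) \<le> B1" using decay[of "2 * n"] by blast
  \<comment> \<open>The comparison function is a product over coordinates. Its reciprocal is at most
    (1 + |x|^2)^n \<le> 2^n (1 + |x|^(2n)), hence the two decay orders and the factor 2^n.\<close>
  define B where "B = 2 ^ n * (B0 + B1)"
  have bound: "norm (f x) \<le> B * (\<Prod>b\<in>Basis. inverse (1 + (x \<bullet> b)\<^sup>2))" for x
  proof -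
    have "(\<Prod>b\<in>(Basis::'a set). 1 + (x \<bullet> b)\<^sup>2) \<le> (\<Prod>b\<in>(Basis::'a set). 1 + (norm x)\<^sup>2)"
    proof (intro prod_mono conjI add_left_mono)
      fix b :: 'a assume "b \<in> Basis"
      then show "(x \<bullet> b)\<^sup>2 \<le> (norm x)\<^sup>2"
        using Basis_le_norm[of b x] by (intro abs_le_square_iff[THEN iffD1]) simp
    qed (auto intro: add_nonneg_nonneg)
    also have "\<dots> = (1 + (norm x)\<^sup>2) ^ n" by (simp add: n_def)
    also have "\<dots> \<le> (2 * max 1 ((norm x)\<^sup>2)) ^ n" by (intro power_mono) auto
    also have "\<dots> = 2 ^ n * max 1 ((norm x)\<^sup>2) ^ n" by (rule power_mult_distrib)
    also have "max 1 ((norm x)\<^sup>2) ^ n \<le> 1 + norm x ^ (2 * n)"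
      by (auto simp: max_def power_mult)
    finally have "(\<Prod>b\<in>(Basis::'a set). 1 + (x \<bullet> b)\<^sup>2) * norm (f x) \<le> (2 ^ n * (1 + norm x ^ (2 * n))) * norm (f x)"
      by (intro mult_right_mono) auto
    also have "\<dots> = 2 ^ n * (norm x ^ 0 * norm (f x) + norm x ^ (2 * n) * norm (f x))"
      by (simp add: algebra_simps)
    also have "\<dots> \<le> B" unfolding B_def by (intro mult_left_mono add_mono B0 B1) auto
    finally have "(\<Prod>b\<in>(Basis::'a set). 1 + (x \<bullet> b)\<^sup>2) * norm (f x) \<le> B" .
    moreover have "(\<Prod>b\<in>(Basis::'a set). 1 + (x \<bullet> b)\<^sup>2) > 0"
      by (intro prod_pos) (auto intro: add_pos_nonneg)
    moreover have "(\<Prod>b\<in>(Basis::'a set). inverse (1 + (x \<bullet> b)\<^sup>2)) = inverse (\<Prod>b\<in>(Basis::'a set). 1 + (x \<bullet> b)\<^sup>2)"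
      using prod_inversef[of "\<lambda>b. 1 + (x \<bullet> b)\<^sup>2" "Basis::'a set"] by (simp add: o_def)
    ultimately show ?thesis
      by (simp only: divide_inverse[symmetric] pos_le_divide_eq mult.commute[of "norm (f x)"])
  qed
  show ?thesis
  proof (rule Bochner_Integration.integrable_bound)
    show "integrable lborel (\<lambda>x::'a. B * (\<Prod>b\<in>Basis. inverse (1 + (x \<bullet> b)\<^sup>2)))"
      by (intro integrable_mult_right integrable_lborel_prod integrable_inverse_one_plus_square)
    show "AE x in lborel. norm (f x) \<le> norm (B * (\<Prod>b\<in>Basis. inverse (1 + (x \<bullet> b)\<^sup>2)))"
      unfolding real_norm_def by (intro AE_I2 order_trans[OF bound abs_ge_self])
  qed simp
qed

lemma schwartz_integrable:
  fixes f :: "real ^ 'n \<Rightarrow> complex"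
  assumes "schwartz f"
  shows "integrable lborel f" and "q \<ge> 1 \<Longrightarrow> integrable lborel (\<lambda>x. norm (f x) powr q)"
proof -
  \<comment> \<open>Only the derivative of order zero is used: differentiability for measurability,
    and rapid decay of f itself.\<close>
  have "partials [] f = f" by (simp add: partials_def)
  then have "f differentiable_on UNIV" and decay: "\<And>k. \<exists>B. \<forall>x. norm x ^ k * norm (f x) \<le> B"
    using assms unfolding schwartz_def by metis+
  then have [measurable]: "f \<in> borel_measurable borel"
    by (intro borel_measurable_continuous_onI differentiable_imp_continuous_on)
  show int: "integrable lborel f" by (rule integrable_lborel_rapid_decay[OF _ decay]) simp
  obtain B where B: "\<And>x. norm x ^ 0 * norm (f x) \<le> B" using decay[of 0] by blast
  show "integrable lborel (\<lambda>x. norm (f x) powr q)" if q: "q \<ge> 1"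
  proof (rule Bochner_Integration.integrable_bound)
    show "integrable lborel (\<lambda>x. B powr (q - 1) * norm (f x))" using int by simp
    \<comment> \<open>Boundedness and integrability together give every L^q with q \<ge> 1.\<close>
    have "norm (f x) powr q \<le> B powr (q - 1) * norm (f x)" for x
    proof (cases "f x = 0")
      case False
      then have "norm (f x) powr q = norm (f x) powr (q - 1) * norm (f x)"
        using powr_add[of "norm (f x)" "q - 1" 1] by simp
      also have "\<dots> \<le> B powr (q - 1) * norm (f x)"
        using B[of x] q by (intro mult_right_mono powr_mono2) auto
      finally show ?thesis .
    qed (use q in simp)
    then show "AE x in lborel. norm (norm (f x) powr q) \<le> norm (B powr (q - 1) * norm (f x))"
      by (intro AE_I2) (simp add: abs_mult)
  qed simp
qed

text \<open>The four cases are one formula: \<alpha> is 1/p1 + 1/p2 - (n-1)/n with each of 1/p1 and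
  1/p2 replaced by b_n where it is smaller. So n \<alpha> - 1 is at least n (1/p - 1), with equality
  in the last case. The second claim holds because both reciprocals exceed a_n and 2 n a_n = n +
  1.\<close>

lemma alpha_lower_bound:
  fixes n :: nat and p1 p2 p :: real
  assumes n: "n \<ge> 2" and p1: "1 \<le> p1" "p1 < 2 * real n / (real n + 1)"
    and p2: "1 \<le> p2" "p2 < 2 * real n / (real n + 1)" and p: "1 / p = 1 / p1 + 1 / p2"
  shows "real n * (1 / p - 1) \<le> real n * alpha n p1 p2 - 1" and "1 < real n * (1 / p - 1)"
proof -
  define N where "N = real n"
  have N: "N \<ge> 2" using n by (simp add: N_def)
  have x: "a_exp n < 1 / p1" "1 / p1 \<le> 1" and y: "a_exp n < 1 / p2" "1 / p2 \<le> 1"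
    using p1 p2 N unfolding a_exp_def N_def[symmetric] by (auto simp: field_simps)
  have Na: "2 * N * a_exp n = N + 1" using N unfolding a_exp_def N_def[symmetric] by (simp add: field_simps)
  have "N * (2 * a_exp n) < N * (1 / p)" unfolding p using N x y by (intro mult_strict_left_mono) auto
  then have "1 < N * (1 / p - 1)" using Na by (simp add: algebra_simps)
  then show "1 < real n * (1 / p - 1)" by (simp add: N_def)
  \<comment> \<open>The excess of n b_n over n a_n; in terms of \<open>k\<close> all four cases
    become linear in X and Y.\<close>
  define k where "k = (N - 1) / (N + 1)"
  have Nb: "N * b_exp n = (N + 1) / 2 + k"
  proof -
    have "N * b_exp n = N * ((N + 1) / (2 * N)) + N * ((N - 1) / (N * (N + 1)))"
      unfolding b_exp_def N_def[symmetric] by (simp add: power2_eq_square distrib_left)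
    then show ?thesis using N unfolding k_def by simp
  qed
  have Nb': "N * b_exp n = N / 2 + 1 / 2 + k" unfolding Nb by (simp add: add_divide_distrib)
  have k2: "N * (2 / (N + 1)) = 1 + k" unfolding k_def using N by (simp add: field_simps)
  have k4: "N * (4 / (N + 1)) = 2 + 2 * k" unfolding k_def using N by (simp add: field_simps)
  have kh: "N * ((N - 1) / (2 * N)) = N / 2 - 1 / 2" "N * ((N - 1) / N) = N - 1" using N by (auto simp: field_simps)
  define X Y where "X = N * (1 / p1)" and "Y = N * (1 / p2)"
  have lt: "N * a < N * b" if "a < b" for a b using that N by simp
  have "N * (1 / p1 + 1 / p2 - 1) \<le> N * alpha n p1 p2 - 1"
  proof -
    consider "1 / p1 < b_exp n" "1 / p2 < b_exp n" | "1 / p1 < b_exp n" "b_exp n \<le> 1 / p2"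
      | "b_exp n \<le> 1 / p1" "1 / p2 < b_exp n" | "b_exp n \<le> 1 / p1" "b_exp n \<le> 1 / p2" by linarith
    then show ?thesis
    proof cases
      case 1
      then have al: "alpha n p1 p2 = 4 / (N + 1)" using x y by (simp add: alpha_def N_def)
      have "X + Y < ((N + 1) / 2 + k) + ((N + 1) / 2 + k)"
        using lt[OF 1(1)] lt[OF 1(2)] unfolding Nb X_def Y_def by (rule add_strict_mono)
      also have "\<dots> = N + 1 + 2 * k" by (simp add: field_simps)
      finally have "X + Y < N + 1 + 2 * k" .
      then show ?thesis
        unfolding al distrib_left right_diff_distrib k4 X_def[symmetric] Y_def[symmetric] mult_1_right by linarith
    next
      case 2
      then have al: "alpha n p1 p2 = 2 / (N + 1) - (N - 1) / (2 * N) + 1 / p2" using x y by (simp add: alpha_def N_def)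
      show ?thesis using lt[OF 2(1)] unfolding al Nb' distrib_left right_diff_distrib k2 kh X_def[symmetric] Y_def[symmetric] mult_1_right by linarith
    next
      case 3
      then have al: "alpha n p1 p2 = 2 / (N + 1) - (N - 1) / (2 * N) + 1 / p1" using x y by (simp add: alpha_def N_def)
      show ?thesis using lt[OF 3(2)] unfolding al Nb' distrib_left right_diff_distrib k2 kh X_def[symmetric] Y_def[symmetric] mult_1_right by linarith
    next
      case 4
      then have al: "alpha n p1 p2 = 1 / p1 + 1 / p2 - (N - 1) / N" using x y by (simp add: alpha_def N_def)
      show ?thesis unfolding al distrib_left right_diff_distrib kh X_def[symmetric] Y_def[symmetric] mult_1_right by linarith
    qed
  qed
  then show "real n * (1 / p - 1) \<le> real n * alpha n p1 p2 - 1" unfolding p N_def .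
qed

section \<open>Dyadic decomposition\<close>

text \<open>For z = 1 - it one has |z|^2 = 1 + t^2, so the indicator selects r \<le> |z| < 2r and
  the power of 1 + t^2 is the modulus of the weight. Absolute values stand inside the integral:
  within a block no cancellation in t is used. The constant modulus e of exp(z) is accounted for
  separately.\<close>

definition dyadic_piece :: "real \<Rightarrow> (real ^ 'n \<Rightarrow> complex) \<Rightarrow> (real ^ 'n \<Rightarrow> complex) \<Rightarrow> real \<Rightarrow> real ^ 'n \<Rightarrow> real" where
  "dyadic_piece \<delta> f g r x = (\<integral>t. indicator {t. r\<^sup>2 \<le> 1 + t\<^sup>2 \<and> 1 + t\<^sup>2 < 4 * r\<^sup>2} t *
     ((1 + t\<^sup>2) powr (- (\<delta> + 1) / 2) *
      (norm (gauss_mult (1 - \<i> * of_real t) f x) * norm (gauss_mult (1 - \<i> * of_real t) g x))) \<partial>lborel)"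

lemma dyadic_piece_nonneg: "dyadic_piece \<delta> f g r x \<ge> 0"
  unfolding dyadic_piece_def by (intro integral_nonneg_AE) auto

lemma dyadic_piece_measurable:
  fixes f g :: "real ^ 'n \<Rightarrow> complex"
  assumes "f \<in> borel_measurable borel" "g \<in> borel_measurable borel"
  shows "dyadic_piece \<delta> f g r \<in> borel_measurable borel"
proof -
  define vf where "vf x t = gauss_mult (1 - \<i> * of_real t) f x" for x t
  define vg where "vg x t = gauss_mult (1 - \<i> * of_real t) g x" for x t
  have [measurable]: "case_prod vf \<in> borel_measurable (borel \<Otimes>\<^sub>M borel)"
    unfolding vf_def by (rule gauss_mult_measurable[OF assms(1)])
  have [measurable]: "case_prod vg \<in> borel_measurable (borel \<Otimes>\<^sub>M borel)"
    unfolding vg_def by (rule gauss_mult_measurable[OF assms(2)])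
  have [measurable]: "{t. r\<^sup>2 \<le> 1 + t\<^sup>2 \<and> 1 + t\<^sup>2 < 4 * r\<^sup>2} \<in> sets borel" by measurable
  show ?thesis
    unfolding dyadic_piece_def vf_def[symmetric] vg_def[symmetric] by measurable
qed

text \<open>The block lies in an interval of length 4r, and the weight is at most r to the power -s
  there. With s = \<delta> + 1 this leaves r to the power -\<delta>.\<close>

lemma dyadic_weight_integral_le:
  fixes r s :: real
  assumes r: "r \<ge> 1" and s: "s \<ge> 0"
  shows "(\<integral>\<^sup>+t. ennreal (indicator {t. r\<^sup>2 \<le> 1 + t\<^sup>2 \<and> 1 + t\<^sup>2 < 4 * r\<^sup>2} t * (1 + t\<^sup>2) powr (- s / 2)) \<partial>lborel)
    \<le> ennreal (4 * r powr (1 - s))"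
proof -
  have "indicator {t. r\<^sup>2 \<le> 1 + t\<^sup>2 \<and> 1 + t\<^sup>2 < 4 * r\<^sup>2} t * (1 + t\<^sup>2) powr (- s / 2) \<le> indicator {- 2 * r..2 * r} t * r powr (- s)" for t
  proof (cases "r\<^sup>2 \<le> 1 + t\<^sup>2 \<and> 1 + t\<^sup>2 < 4 * r\<^sup>2")
    case True
    then have "t\<^sup>2 \<le> (2 * r)\<^sup>2" by simp
    then have "\<bar>t\<bar>\<^sup>2 \<le> (2 * r)\<^sup>2" by (simp only: power2_abs)
    then have "\<bar>t\<bar> \<le> 2 * r" by (rule power2_le_imp_le) (use r in simp)
    then have "t \<in> {- 2 * r..2 * r}" by auto
    moreover have "(1 + t\<^sup>2) powr (- s / 2) \<le> (r\<^sup>2) powr (- s / 2)"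
      using True r s by (intro powr_mono2') auto
    moreover have "(r\<^sup>2) powr (- s / 2) = r powr (- s)"
    proof -
      have e: "r\<^sup>2 = r powr 2" using r by simp
      show ?thesis unfolding e powr_powr by simp
    qed
    ultimately show ?thesis using True by simp
  next
    case False
    then have "indicat_real {t. r\<^sup>2 \<le> 1 + t\<^sup>2 \<and> 1 + t\<^sup>2 < 4 * r\<^sup>2} t = 0" by auto
    then show ?thesis by simp
  qed
  then have "(\<integral>\<^sup>+t. ennreal (indicator {t. r\<^sup>2 \<le> 1 + t\<^sup>2 \<and> 1 + t\<^sup>2 < 4 * r\<^sup>2} t * (1 + t\<^sup>2) powr (- s / 2)) \<partial>lborel)
    \<le> (\<integral>\<^sup>+t. ennreal (r powr (- s)) * indicator {- 2 * r..2 * r} t \<partial>lborel)"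
  proof (intro nn_integral_mono)
    fix t
    assume le: "\<And>t. indicator {t. r\<^sup>2 \<le> 1 + t\<^sup>2 \<and> 1 + t\<^sup>2 < 4 * r\<^sup>2} t * (1 + t\<^sup>2) powr (- s / 2) \<le> indicator {- 2 * r..2 * r} t * r powr (- s)"
    have "ennreal (indicator {- 2 * r..2 * r} t * r powr (- s)) = ennreal (r powr (- s)) * indicator {- 2 * r..2 * r} t"
      by (simp split: split_indicator)
    then show "ennreal (indicator {t. r\<^sup>2 \<le> 1 + t\<^sup>2 \<and> 1 + t\<^sup>2 < 4 * r\<^sup>2} t * (1 + t\<^sup>2) powr (- s / 2))
       \<le> ennreal (r powr (- s)) * indicator {- 2 * r..2 * r} t"
      using ennreal_leI[OF le[of t]] by (simp only:)
  qed
  also have "\<dots> = ennreal (r powr (- s)) * ennreal (4 * r)"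
    using r by (subst nn_integral_cmult_indicator) auto
  also have "\<dots> = ennreal (4 * r powr (1 - s))"
    using r powr_mult_base[of r "- s"] by (simp add: ennreal_mult[symmetric] mult_ac)
  finally show ?thesis .
qed

section \<open>Gaussian averages and the estimate of one block\<close>

lemma nn_integral_gaussian_average:
  fixes F :: "real ^ 'n \<Rightarrow> real"
  assumes F: "integrable lborel F" and nn: "\<And>u. F u \<ge> 0" and s: "s > 0"
  shows "(\<integral>\<^sup>+x. ennreal (\<integral>u. F u * exp (- s * (norm (x - u))\<^sup>2) \<partial>lborel) \<partial>lborel)
    = ennreal (sqrt (pi / s) ^ CARD('n) * (\<integral>u. F u \<partial>lborel))"
proof -
  have [measurable]: "F \<in> borel_measurable borel" using F by auto
  have int: "integrable lborel (\<lambda>u. F u * exp (- s * (norm (x - u))\<^sup>2))" for x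
    by (rule Bochner_Integration.integrable_bound[OF F]) (use s nn in \<open>auto intro!: AE_I2 mult_left_le\<close>)
  have "(\<integral>\<^sup>+x. ennreal (\<integral>u. F u * exp (- s * (norm (x - u))\<^sup>2) \<partial>lborel) \<partial>lborel)
      = (\<integral>\<^sup>+x. \<integral>\<^sup>+u. ennreal (F u * exp (- s * (norm (x - u))\<^sup>2)) \<partial>lborel \<partial>lborel)"
    using nn by (intro nn_integral_cong nn_integral_eq_integral[symmetric] int) auto
  also have "\<dots> = (\<integral>\<^sup>+u. \<integral>\<^sup>+x. ennreal (F u * exp (- s * (norm (x - u))\<^sup>2)) \<partial>lborel \<partial>lborel)"
    by (rule lborel_pair.Fubini') measurable
  also have "\<dots> = (\<integral>\<^sup>+u. ennreal (F u) * ennreal (sqrt (pi / s) ^ CARD('n)) \<partial>lborel)"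
  proof (rule nn_integral_cong)
    fix u
    have "(\<integral>\<^sup>+x. ennreal (F u * exp (- s * (norm (x - u))\<^sup>2)) \<partial>lborel) = ennreal (F u) * (\<integral>\<^sup>+x. ennreal (exp (- s * (norm (x - u))\<^sup>2)) \<partial>lborel)"
      using nn by (simp add: ennreal_mult nn_integral_cmult)
    also have "(\<integral>\<^sup>+x. ennreal (exp (- s * (norm (x - u))\<^sup>2)) \<partial>lborel) = (\<integral>\<^sup>+(x::real^'n). ennreal (exp (- s * (norm x)\<^sup>2)) \<partial>lborel)"
      by (rule nn_integral_lborel_translate[where f = "\<lambda>x::real^'n. ennreal (exp (- s * (norm x)\<^sup>2))"]) measurable
    also have "\<dots> = ennreal (sqrt (pi / s) ^ CARD('n))"
      using nn_integral_gaussian[OF s, where 'a = "real ^ 'n"] by simp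
    finally show "(\<integral>\<^sup>+x. ennreal (F u * exp (- s * (norm (x - u))\<^sup>2)) \<partial>lborel) = ennreal (F u) * ennreal (sqrt (pi / s) ^ CARD('n))" .
  qed
  also have "\<dots> = (\<integral>\<^sup>+u. ennreal (F u) \<partial>lborel) * ennreal (sqrt (pi / s) ^ CARD('n))"
    by (rule nn_integral_multc) measurable
  also have "(\<integral>\<^sup>+u. ennreal (F u) \<partial>lborel) = ennreal (\<integral>u. F u \<partial>lborel)"
    using nn by (intro nn_integral_eq_integral F) auto
  also have "\<dots> * ennreal (sqrt (pi / s) ^ CARD('n)) = ennreal (sqrt (pi / s) ^ CARD('n) * (\<integral>u. F u \<partial>lborel))"
    using s nn by (simp add: ennreal_mult[symmetric] mult.commute integral_nonneg_AE)
  finally show ?thesis .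
qed

text \<open>Count of powers of r: the weight in t gives r^(-\<delta>), the normalised average
  r^(-n), and both are raised to the power p by Jensen; the integral over the centres x of the balls
  returns r^n. The total exponent is p (n (1/p - 1) - \<delta>).\<close>

lemma dyadic_piece_bound:
  fixes p1 p2 p \<delta> :: real
  assumes p1: "1 \<le> p1" "p1 \<le> 2" and p2: "1 \<le> p2" "p2 \<le> 2" and p: "0 < p" "1 / p = 1 / p1 + 1 / p2" and \<delta>: "\<delta> \<ge> 0"
  shows "\<exists>C\<ge>0. \<forall>(f :: real ^ 'n \<Rightarrow> complex) g r. integrable lborel f \<longrightarrow> integrable lborel g \<longrightarrow>
     integrable lborel (\<lambda>u. norm (f u) powr p1) \<longrightarrow> integrable lborel (\<lambda>u. norm (g u) powr p2) \<longrightarrow> r \<ge> 1 \<longrightarrow>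
     (\<integral>\<^sup>+x. ennreal (dyadic_piece \<delta> f g r x powr p) \<partial>lborel)
      \<le> ennreal (C * r powr (p * (real CARD('n) * (1 / p - 1) - \<delta>)) *
          ((\<integral>u. norm (f u) powr p1 \<partial>lborel) powr (p / p1) * (\<integral>u. norm (g u) powr p2 \<partial>lborel) powr (p / p2)))"
proof -
  define n where "n = CARD('n)"
  obtain C where C: "C \<ge> 0" and loc: "\<And>(f :: real ^ 'n \<Rightarrow> complex) q z x A B. integrable lborel f \<Longrightarrow> 1 \<le> q \<Longrightarrow> q \<le> 2 \<Longrightarrow>
     integrable lborel (\<lambda>u. norm (f u) powr q) \<Longrightarrow> Re z = 1 \<Longrightarrow> 0 \<le> B \<Longrightarrow> B \<le> pi\<^sup>2 / (norm z)\<^sup>2 \<Longrightarrow> pi\<^sup>2 / (norm z)\<^sup>2 \<le> A \<Longrightarrow>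
     (\<integral>\<^sup>+y. ennreal (exp (- 2 * A * (norm (x - y))\<^sup>2) * (norm (gauss_mult z f y))\<^sup>2) \<partial>lborel)
      \<le> ennreal (C * (\<integral>u. norm (f u) powr q * exp (- (B / 2) * (norm (x - u))\<^sup>2) \<partial>lborel) powr (2 / q))"
    using gauss_mult_local_bound[where 'n = 'n] by blast
  have pp: "p / p1 + p / p2 = 1" using p by (simp add: field_simps)
  have "1 / p \<ge> 1"
  proof -
    have "1 / p1 \<ge> 1 / 2" "1 / p2 \<ge> 1 / 2" using p1 p2 by (auto simp: field_simps)
    then show ?thesis using p by linarith
  qed
  then have p_le: "p \<le> 1" using p(1) by (simp add: field_simps)
  \<comment> \<open>Here 4 comes from the length of the block, C from the local estimate, sqrt(2
    pi)^n from normalising the weight, and sqrt(8/pi)^n from the integral of the wide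
    Gaussian.\<close>
  define K where "K = (4 * C * sqrt (2 * pi) ^ n) powr p * sqrt (8 / pi) ^ n"
  have main: "(\<integral>\<^sup>+x. ennreal (dyadic_piece \<delta> f g r x powr p) \<partial>lborel)
      \<le> ennreal (K * r powr (p * (real n * (1 / p - 1) - \<delta>)) *
          ((\<integral>u. norm (f u) powr p1 \<partial>lborel) powr (p / p1) * (\<integral>u. norm (g u) powr p2 \<partial>lborel) powr (p / p2)))"
    if f: "integrable lborel f" and g: "integrable lborel g" and fp: "integrable lborel (\<lambda>u. norm (f u) powr p1)"
      and gp: "integrable lborel (\<lambda>u. norm (g u) powr p2)" and r: "r \<ge> 1" for f g :: "real ^ 'n \<Rightarrow> complex" and r
  proof -
    have [measurable]: "f \<in> borel_measurable borel" "g \<in> borel_measurable borel" using f g by auto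
    define D where "D = {t::real. r\<^sup>2 \<le> 1 + t\<^sup>2 \<and> 1 + t\<^sup>2 < 4 * r\<^sup>2}"
    have [measurable]: "D \<in> sets borel" unfolding D_def by measurable
    define \<gamma> where "\<gamma> t = indicator D t * (1 + t\<^sup>2) powr (- (\<delta> + 1) / 2)" for t :: real
    have [measurable]: "\<gamma> \<in> borel_measurable borel" unfolding \<gamma>_def by measurable
    have \<gamma>0: "\<gamma> t \<ge> 0" for t by (simp add: \<gamma>_def)
    define vf where "vf x t = norm (gauss_mult (1 - \<i> * of_real t) f x)" for x t
    define vg where "vg x t = norm (gauss_mult (1 - \<i> * of_real t) g x)" for x t
    have mf: "(\<lambda>(x, t). gauss_mult (1 - \<i> * of_real t) f x) \<in> borel_measurable (borel \<Otimes>\<^sub>M borel)"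
      by (rule gauss_mult_measurable) measurable
    have mg: "(\<lambda>(x, t). gauss_mult (1 - \<i> * of_real t) g x) \<in> borel_measurable (borel \<Otimes>\<^sub>M borel)"
      by (rule gauss_mult_measurable) measurable
    have [measurable]: "case_prod vf \<in> borel_measurable (borel \<Otimes>\<^sub>M borel)"
      using measurable_compose[OF mf borel_measurable_norm] unfolding vf_def case_prod_unfold .
    have [measurable]: "case_prod vg \<in> borel_measurable (borel \<Otimes>\<^sub>M borel)"
      using measurable_compose[OF mg borel_measurable_norm] unfolding vg_def case_prod_unfold .
    have v0: "vf x t \<ge> 0" "vg x t \<ge> 0" for x t by (auto simp: vf_def vg_def)
    define H where "H = dyadic_piece \<delta> f g r"
    have H_eq: "H x = (\<integral>t. \<gamma> t * (vf x t * vg x t) \<partial>lborel)" for x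
      unfolding H_def dyadic_piece_def \<gamma>_def D_def vf_def vg_def by (simp only: mult.assoc)
    have [measurable]: "H \<in> borel_measurable borel" unfolding H_def by (rule dyadic_piece_measurable) measurable
    have H0: "H x \<ge> 0" for x unfolding H_def by (rule dyadic_piece_nonneg)
    \<comment> \<open>On the block |z|^2 lies between r^2 and 4 r^2, so pi^2/|z|^2 lies between A/4
      and A.\<close>
    define A where "A = pi\<^sup>2 / r\<^sup>2"
    define B where "B = A / 4"
    have A: "A > 0" and B: "B > 0" using r by (auto simp: A_def B_def)
    have AB: "B \<le> pi\<^sup>2 / (norm (1 - \<i> * of_real t))\<^sup>2" "pi\<^sup>2 / (norm (1 - \<i> * of_real t))\<^sup>2 \<le> A" if "t \<in> D" for t
    proof -
      have n2: "(norm (1 - \<i> * of_real t))\<^sup>2 = 1 + t\<^sup>2" by (simp add: cmod_power2)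
      have "pi\<^sup>2 / (4 * r\<^sup>2) \<le> pi\<^sup>2 / (1 + t\<^sup>2)" using that r unfolding D_def by (intro divide_left_mono) (auto simp: add_pos_nonneg)
      then show "B \<le> pi\<^sup>2 / (norm (1 - \<i> * of_real t))\<^sup>2" unfolding n2 B_def A_def by simp
      show "pi\<^sup>2 / (norm (1 - \<i> * of_real t))\<^sup>2 \<le> A"
        unfolding n2 A_def using that r unfolding D_def by (intro divide_left_mono) (auto simp: add_pos_nonneg)
    qed
    \<comment> \<open>The factor that gives \<omega> total mass 1, as Jensen's inequality and the
      averaging identity require.\<close>
    define W where "W = (sqrt (2 * pi) / r) ^ n"
    have W: "W > 0" using r by (simp add: W_def)
    define \<omega> where "\<omega> v = W * exp (- (2 * A) * (norm v)\<^sup>2)" for v :: "real ^ 'n"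
    have [measurable]: "\<omega> \<in> borel_measurable borel" unfolding \<omega>_def by measurable
    have \<omega>0: "\<omega> v \<ge> 0" for v using W by (simp add: \<omega>_def)
    have "(\<integral>\<^sup>+v. ennreal (\<omega> v) \<partial>lborel) = ennreal W * ennreal (sqrt (pi / (2 * A)) ^ n)"
      using W nn_integral_gaussian[of "2 * A", where 'a = "real ^ 'n"] A unfolding \<omega>_def
      by (simp add: ennreal_mult nn_integral_cmult n_def)
    also have "\<dots> = 1"
    proof -
      have "sqrt (pi / (2 * A)) = r / sqrt (2 * pi)"
        using r unfolding A_def by (simp add: real_sqrt_divide real_sqrt_mult field_simps power2_eq_square)
      then have "W * sqrt (pi / (2 * A)) ^ n = 1" using r unfolding W_def by (simp add: power_mult_distrib[symmetric])
      then show ?thesis using W A by (simp add: ennreal_mult[symmetric])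
    qed
    finally have \<omega>1: "(\<integral>\<^sup>+v. ennreal (\<omega> v) \<partial>lborel) = 1" .
    define U where "U x = (\<integral>u. norm (f u) powr p1 * exp (- (B / 2) * (norm (x - u))\<^sup>2) \<partial>lborel)" for x
    define V where "V x = (\<integral>u. norm (g u) powr p2 * exp (- (B / 2) * (norm (x - u))\<^sup>2) \<partial>lborel)" for x
    have [measurable]: "U \<in> borel_measurable borel" "V \<in> borel_measurable borel" unfolding U_def V_def by measurable
    have U0: "U x \<ge> 0" and V0: "V x \<ge> 0" for x unfolding U_def V_def by (auto intro!: integral_nonneg_AE)
    define Fu where "Fu = (\<integral>u. norm (f u) powr p1 \<partial>lborel)"
    define Fv where "Fv = (\<integral>u. norm (g u) powr p2 \<partial>lborel)"
    have Fu0: "Fu \<ge> 0" and Fv0: "Fv \<ge> 0" unfolding Fu_def Fv_def by (auto intro!: integral_nonneg_AE)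
    define E where "E = sqrt (pi / (B / 2)) ^ n"
    have E0: "E > 0" using B by (simp add: E_def)
    have UI: "(\<integral>\<^sup>+x. ennreal (U x) \<partial>lborel) = ennreal (E * Fu)"
      unfolding U_def E_def n_def Fu_def by (rule nn_integral_gaussian_average[OF fp]) (use B in auto)
    have VI: "(\<integral>\<^sup>+x. ennreal (V x) \<partial>lborel) = ennreal (E * Fv)"
      unfolding V_def E_def n_def Fv_def by (rule nn_integral_gaussian_average[OF gp]) (use B in auto)
    define Q where "Q x = W * C * (U x powr (1 / p1) * V x powr (1 / p2))" for x
    have Q0: "Q x \<ge> 0" for x using W C by (simp add: Q_def)
    \<comment> \<open>Cauchy-Schwarz with \<omega> split into two square roots; each factor falls
      under the local L^2 estimate, with q = p1 and q = p2. The resulting bound is the same for all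
      t of the block.\<close>
    have inner: "(\<integral>\<^sup>+y. ennreal (\<omega> (x - y) * (vf y t * vg y t)) \<partial>lborel) \<le> ennreal (Q x)" if t: "t \<in> D" for x t
    proof (rule ennreal_power2_le_imp_le[OF _ Q0])
      have one: "(\<integral>\<^sup>+y. (ennreal (sqrt (\<omega> (x - y)) * norm (gauss_mult (1 - \<i> * of_real t) h y)))\<^sup>2 \<partial>lborel)
         \<le> ennreal (W * (C * (\<integral>u. norm (h u) powr q * exp (- (B / 2) * (norm (x - u))\<^sup>2) \<partial>lborel) powr (2 / q)))"
        if [measurable]: "(\<lambda>y. gauss_mult (1 - \<i> * of_real t) h y) \<in> borel_measurable borel" and h: "integrable lborel h" "1 \<le> q" "q \<le> 2" "integrable lborel (\<lambda>u. norm (h u) powr q)" for h :: "real ^ 'n \<Rightarrow> complex" and q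
      proof -
        have "(\<integral>\<^sup>+y. (ennreal (sqrt (\<omega> (x - y)) * norm (gauss_mult (1 - \<i> * of_real t) h y)))\<^sup>2 \<partial>lborel)
          = (\<integral>\<^sup>+y. ennreal W * ennreal (exp (- 2 * A * (norm (x - y))\<^sup>2) * (norm (gauss_mult (1 - \<i> * of_real t) h y))\<^sup>2) \<partial>lborel)"
          using W \<omega>0 by (intro nn_integral_cong) (simp add: ennreal_power power_mult_distrib \<omega>_def ennreal_mult[symmetric] mult.assoc)
        also have "\<dots> = ennreal W * (\<integral>\<^sup>+y. ennreal (exp (- 2 * A * (norm (x - y))\<^sup>2) * (norm (gauss_mult (1 - \<i> * of_real t) h y))\<^sup>2) \<partial>lborel)"
          by (rule nn_integral_cmult) measurable
        also have "\<dots> \<le> ennreal W * ennreal (C * (\<integral>u. norm (h u) powr q * exp (- (B / 2) * (norm (x - u))\<^sup>2) \<partial>lborel) powr (2 / q))"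
          by (intro mult_left_mono loc h AB t) (use B in auto)
        finally show ?thesis using W C by (simp add: ennreal_mult)
      qed
      have m: "(\<lambda>y. gauss_mult (1 - \<i> * of_real t) h y) \<in> borel_measurable borel" if "h \<in> borel_measurable borel" for h :: "real ^ 'n \<Rightarrow> complex"
        using measurable_compose[OF measurable_Pair2'[of t borel borel] gauss_mult_measurable[OF that]] by simp
      have "(\<integral>\<^sup>+y. ennreal (\<omega> (x - y) * (vf y t * vg y t)) \<partial>lborel)
        = (\<integral>\<^sup>+y. ennreal (sqrt (\<omega> (x - y)) * vf y t) * ennreal (sqrt (\<omega> (x - y)) * vg y t) \<partial>lborel)"
      proof (rule nn_integral_cong)
        fix y
        have "sqrt (\<omega> (x - y)) * sqrt (\<omega> (x - y)) = \<omega> (x - y)" using \<omega>0 by simp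
        moreover have "(c * a) * (c * b) = (c * c) * (a * b)" for a b c :: real by simp
        ultimately have "\<omega> (x - y) * (vf y t * vg y t) = (sqrt (\<omega> (x - y)) * vf y t) * (sqrt (\<omega> (x - y)) * vg y t)"
          by simp
        then show "ennreal (\<omega> (x - y) * (vf y t * vg y t)) = ennreal (sqrt (\<omega> (x - y)) * vf y t) * ennreal (sqrt (\<omega> (x - y)) * vg y t)"
          using v0 \<omega>0 by (simp only: ennreal_mult mult_nonneg_nonneg real_sqrt_ge_zero)
      qed
      then have "(\<integral>\<^sup>+y. ennreal (\<omega> (x - y) * (vf y t * vg y t)) \<partial>lborel)\<^sup>2
        \<le> (\<integral>\<^sup>+y. (ennreal (sqrt (\<omega> (x - y)) * vf y t))\<^sup>2 \<partial>lborel) * (\<integral>\<^sup>+y. (ennreal (sqrt (\<omega> (x - y)) * vg y t))\<^sup>2 \<partial>lborel)"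
        by (simp only:) (rule Cauchy_Schwarz_nn_integral; measurable)
      also have "\<dots> \<le> ennreal (W * (C * U x powr (2 / p1))) * ennreal (W * (C * V x powr (2 / p2)))"
        unfolding vf_def vg_def U_def V_def by (intro mult_mono one f g fp gp p1 p2 m) auto
      also have "\<dots> = ennreal ((Q x)\<^sup>2)"
      proof -
        have "U x powr (2 / p1) = (U x powr (1 / p1))\<^sup>2" "V x powr (2 / p2) = (V x powr (1 / p2))\<^sup>2"
          by (simp_all add: power2_eq_square flip: powr_add)
        then show ?thesis
          using W C unfolding Q_def by (simp add: ennreal_mult[symmetric] power_mult_distrib) (simp add: power2_eq_square mult_ac)
      qed
      finally show "(\<integral>\<^sup>+y. ennreal (\<omega> (x - y) * (vf y t * vg y t)) \<partial>lborel)\<^sup>2 \<le> ennreal ((Q x)\<^sup>2)" .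
    qed
    \<comment> \<open>This is where L^1 pays off: after exchanging the integrals, the bound on the
      y-integral does not depend on t, and only the mass of the weight \<gamma> remains.\<close>
    have avg: "(\<integral>\<^sup>+y. ennreal (\<omega> (x - y) * H y) \<partial>lborel) \<le> ennreal (4 * r powr (- \<delta>) * Q x)" for x
    proof -
      have "(\<integral>\<^sup>+y. ennreal (\<omega> (x - y) * H y) \<partial>lborel) \<le> (\<integral>\<^sup>+y. \<integral>\<^sup>+t. ennreal (\<gamma> t) * ennreal (\<omega> (x - y) * (vf y t * vg y t)) \<partial>lborel \<partial>lborel)"
      proof (rule nn_integral_mono)
        fix y
        have "ennreal (\<omega> (x - y) * H y) \<le> ennreal (\<omega> (x - y)) * (\<integral>\<^sup>+t. ennreal (\<gamma> t * (vf y t * vg y t)) \<partial>lborel)"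
          unfolding H_eq using \<omega>0 \<gamma>0 v0
          by (subst ennreal_mult) (auto intro!: integral_nonneg_AE mult_left_mono ennreal_integral_le_nn_integral)
        also have "\<dots> = (\<integral>\<^sup>+t. ennreal (\<gamma> t) * ennreal (\<omega> (x - y) * (vf y t * vg y t)) \<partial>lborel)"
          using \<omega>0 \<gamma>0 v0 by (subst nn_integral_cmult[symmetric]) (auto simp: ennreal_mult[symmetric] mult_ac intro!: nn_integral_cong)
        finally show "ennreal (\<omega> (x - y) * H y) \<le> (\<integral>\<^sup>+t. ennreal (\<gamma> t) * ennreal (\<omega> (x - y) * (vf y t * vg y t)) \<partial>lborel)" .
      qed
      also have "\<dots> = (\<integral>\<^sup>+t. \<integral>\<^sup>+y. ennreal (\<gamma> t) * ennreal (\<omega> (x - y) * (vf y t * vg y t)) \<partial>lborel \<partial>lborel)"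
        by (rule lborel_pair.Fubini') measurable
      also have "\<dots> \<le> (\<integral>\<^sup>+t. ennreal (\<gamma> t) * ennreal (Q x) \<partial>lborel)"
      proof (rule nn_integral_mono)
        fix t
        have "(\<integral>\<^sup>+y. ennreal (\<gamma> t) * ennreal (\<omega> (x - y) * (vf y t * vg y t)) \<partial>lborel)
           = ennreal (\<gamma> t) * (\<integral>\<^sup>+y. ennreal (\<omega> (x - y) * (vf y t * vg y t)) \<partial>lborel)"
          by (rule nn_integral_cmult) measurable
        also have "\<dots> \<le> ennreal (\<gamma> t) * ennreal (Q x)"
        proof (cases "t \<in> D")
          case True
          then show ?thesis by (intro mult_left_mono inner) auto
        qed (simp add: \<gamma>_def)
        finally show "(\<integral>\<^sup>+y. ennreal (\<gamma> t) * ennreal (\<omega> (x - y) * (vf y t * vg y t)) \<partial>lborel) \<le> ennreal (\<gamma> t) * ennreal (Q x)" .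
      qed
      also have "\<dots> = (\<integral>\<^sup>+t. ennreal (\<gamma> t) \<partial>lborel) * ennreal (Q x)"
        by (rule nn_integral_multc) measurable
      also have "\<dots> \<le> ennreal (4 * r powr (1 - (\<delta> + 1))) * ennreal (Q x)"
        unfolding \<gamma>_def D_def using \<delta> by (intro mult_right_mono dyadic_weight_integral_le r) auto
      also have "\<dots> = ennreal (4 * r powr (- \<delta>) * Q x)"
        using Q0 by (simp add: ennreal_mult)
      finally show ?thesis .
    qed
    \<comment> \<open>As \<omega> has mass 1, the integral of H^p equals that of its averages. This
      localises H to scale r, and Jensen then applies around each centre x.\<close>
    have "(\<integral>\<^sup>+x. ennreal (H x powr p) \<partial>lborel) = (\<integral>\<^sup>+y. \<integral>\<^sup>+x. ennreal (\<omega> (x - y) * H y powr p) \<partial>lborel \<partial>lborel)"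
    proof (rule nn_integral_cong)
      fix y
      have "(\<integral>\<^sup>+x. ennreal (\<omega> (x - y) * H y powr p) \<partial>lborel) = (\<integral>\<^sup>+x. ennreal (\<omega> (x - y)) \<partial>lborel) * ennreal (H y powr p)"
        using \<omega>0 by (simp add: ennreal_mult nn_integral_multc)
      also have "(\<integral>\<^sup>+x. ennreal (\<omega> (x - y)) \<partial>lborel) = 1"
        using nn_integral_lborel_translate[of "\<lambda>x. ennreal (\<omega> x)" y] \<omega>1 by simp
      finally show "ennreal (H y powr p) = (\<integral>\<^sup>+x. ennreal (\<omega> (x - y) * H y powr p) \<partial>lborel)" by simp
    qed
    also have "\<dots> = (\<integral>\<^sup>+x. \<integral>\<^sup>+y. ennreal (\<omega> (x - y) * H y powr p) \<partial>lborel \<partial>lborel)"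
      by (rule lborel_pair.Fubini') measurable
    also have "\<dots> \<le> (\<integral>\<^sup>+x. ennreal ((4 * r powr (- \<delta>) * Q x) powr p) \<partial>lborel)"
    proof (intro nn_integral_mono Jensen_powr_nn_integral avg H0 \<omega>0 p p_le)
      show "(\<integral>\<^sup>+y. ennreal (\<omega> (x - y)) \<partial>lborel) = 1" for x
        using nn_integral_lborel_reflect[of "\<lambda>x. ennreal (\<omega> x)" x] \<omega>1 by simp
      show "0 \<le> 4 * r powr (- \<delta>) * Q x" for x using Q0[of x] by simp
    qed measurable
    also have "\<dots> = (\<integral>\<^sup>+x. ennreal ((4 * r powr (- \<delta>) * (W * C)) powr p) * ennreal (U x powr (p / p1) * V x powr (p / p2)) \<partial>lborel)"
    proof (rule nn_integral_cong)
      fix x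
      have "(4 * r powr (- \<delta>) * Q x) powr p = ((4 * r powr (- \<delta>) * (W * C)) * (U x powr (1 / p1) * V x powr (1 / p2))) powr p"
        unfolding Q_def by (simp only: mult.assoc)
      also have "\<dots> = (4 * r powr (- \<delta>) * (W * C)) powr p * (U x powr (p / p1) * V x powr (p / p2))"
        using W C by (subst powr_mult) (auto simp: powr_mult powr_powr)
      finally show "ennreal ((4 * r powr (- \<delta>) * Q x) powr p) = ennreal ((4 * r powr (- \<delta>) * (W * C)) powr p) * ennreal (U x powr (p / p1) * V x powr (p / p2))"
        by (simp only: ennreal_mult powr_ge_zero mult_nonneg_nonneg)
    qed
    also have "\<dots> = ennreal ((4 * r powr (- \<delta>) * (W * C)) powr p) * (\<integral>\<^sup>+x. ennreal (U x powr (p / p1) * V x powr (p / p2)) \<partial>lborel)"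
      by (rule nn_integral_cmult) measurable
    \<comment> \<open>Hoelder with weights p/p1 and p/p2, which sum to 1. Globally integrating U and
      V recovers the full norms at the price of the factor E.\<close>
    also have "\<dots> \<le> ennreal ((4 * r powr (- \<delta>) * (W * C)) powr p) * ennreal ((E * Fu) powr (p / p1) * (E * Fv) powr (p / p2))"
      using p p1 p2 E0 Fu0 Fv0 by (intro mult_left_mono Hoelder_nn_integral_powr U0 V0 UI VI pp) auto
    also have "\<dots> = ennreal ((4 * r powr (- \<delta>) * (W * C)) powr p * ((E * Fu) powr (p / p1) * (E * Fv) powr (p / p2)))"
      by (simp add: ennreal_mult)
    also have "(4 * r powr (- \<delta>) * (W * C)) powr p * ((E * Fu) powr (p / p1) * (E * Fv) powr (p / p2))
       = K * r powr (p * (real n * (1 / p - 1) - \<delta>)) * (Fu powr (p / p1) * Fv powr (p / p2))"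
    proof -
      have Wr: "W = sqrt (2 * pi) ^ n * r powr (- real n)"
        using r unfolding W_def by (simp add: power_mult_distrib power_inverse powr_minus powr_realpow divide_inverse)
      have Er: "E = sqrt (8 / pi) ^ n * r powr (real n)"
      proof -
        have "pi / (B / 2) = (8 / pi) * r\<^sup>2" using r unfolding B_def A_def by (simp add: power2_eq_square)
        then have "sqrt (pi / (B / 2)) = sqrt (8 / pi) * r"
          using r by (simp only: real_sqrt_mult real_sqrt_abs)
        then show ?thesis using r unfolding E_def by (simp add: power_mult_distrib powr_realpow)
      qed
      have r2: "r powr (- \<delta>) * r powr (- real n) = r powr (- \<delta> - real n)"
        by (simp flip: powr_add)
      have r3: "4 * r powr (- \<delta>) * (W * C) = (4 * C * sqrt (2 * pi) ^ n) * r powr (- \<delta> - real n)"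
        unfolding Wr r2[symmetric] by (simp only: mult_ac)
      have "(X * r powr s) powr p = X powr p * r powr (p * s)" if "X \<ge> 0" for X s
        using that by (simp add: powr_mult powr_powr mult.commute)
      then have 1: "(4 * r powr (- \<delta>) * (W * C)) powr p = (4 * C * sqrt (2 * pi) ^ n) powr p * r powr (p * (- \<delta> - real n))"
        unfolding r3 using C by (meson mult_nonneg_nonneg real_sqrt_ge_zero zero_le_numeral zero_le_power pi_ge_zero)
      have "(E * Fu) powr (p / p1) * (E * Fv) powr (p / p2) = (E powr (p / p1) * E powr (p / p2)) * (Fu powr (p / p1) * Fv powr (p / p2))"
        using E0 Fu0 Fv0 by (simp add: powr_mult)
      also have "E powr (p / p1) * E powr (p / p2) = E" using E0 pp by (simp flip: powr_add)
      finally have 2: "(E * Fu) powr (p / p1) * (E * Fv) powr (p / p2) = E * (Fu powr (p / p1) * Fv powr (p / p2))" .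
      \<comment> \<open>The factor E enters to the power p/p1 + p/p2 = 1, which is why n appears
        here without the factor p.\<close>
      have e: "p * (- \<delta> - real n) + real n = p * (real n * (1 / p - 1) - \<delta>)" using p(1) by (simp add: field_simps)
      have 3: "r powr (p * (- \<delta> - real n)) * r powr real n = r powr (p * (real n * (1 / p - 1) - \<delta>))"
        unfolding e[symmetric] powr_add ..
      have "(a * R1) * ((b * R2) * F) = a * b * (R1 * R2) * F" for a b R1 R2 F :: real by simp
      then show ?thesis unfolding 1 2 unfolding Er K_def 3[symmetric] .
    qed
    finally show ?thesis unfolding H_def Fu_def Fv_def .
  qed
  have "K \<ge> 0" by (simp add: K_def)
  then show ?thesis using main unfolding n_def by blast
qed

text \<open>A pointwise inequality: |S(f, g)| is at most a constant times the sum of the dyadic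
  pieces, and subadditivity of the p-th power separates them before any integration in x. Summing
  the pieces in the quasi-norm of L^p would not be possible directly.\<close>

lemma bochner_riesz_norm_powr_le:
  fixes f g :: "real ^ 'n \<Rightarrow> complex"
  assumes f: "integrable lborel f" and g: "integrable lborel g" and \<delta>: "\<delta> \<ge> 1" and p: "0 < p" "p \<le> 1"
  shows "ennreal (norm (bochner_riesz \<delta> f g x) powr p)
    \<le> ennreal ((Gamma (\<delta> + 1) / (2 * pi) * exp 1) powr p) * (\<Sum>j. ennreal (dyadic_piece \<delta> f g (2 ^ j) x powr p))"
proof -
  have [measurable]: "f \<in> borel_measurable borel" "g \<in> borel_measurable borel" using f g by auto
  define c where "c = Gamma (\<delta> + 1) / (2 * pi) * exp 1"
  have Gpos: "Gamma (\<delta> + 1) > 0" using \<delta> by (intro Gamma_real_pos) simp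
  then have c: "c > 0" by (simp add: c_def)
  define vf where "vf t = gauss_mult (1 - \<i> * of_real t) f x" for t
  define vg where "vg t = gauss_mult (1 - \<i> * of_real t) g x" for t
  have [measurable]: "vf \<in> borel_measurable borel"
    using measurable_compose[OF measurable_Pair1'[of x borel borel] gauss_mult_measurable[of f]] unfolding vf_def by simp
  have [measurable]: "vg \<in> borel_measurable borel"
    using measurable_compose[OF measurable_Pair1'[of x borel borel] gauss_mult_measurable[of g]] unfolding vg_def by simp
  define w where "w t = (1 + t\<^sup>2) powr (- (\<delta> + 1) / 2) * (norm (vf t) * norm (vg t))" for t
  have w0: "w t \<ge> 0" for t by (simp add: w_def)
  have [measurable]: "w \<in> borel_measurable borel" unfolding w_def by measurable
  define Bf where "Bf = (\<integral>\<xi>. exp (- (norm (\<xi> :: real ^ 'n))\<^sup>2) \<partial>lborel) * (\<integral>x. norm (f x) \<partial>lborel)"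
  define Bg where "Bg = (\<integral>\<xi>. exp (- (norm (\<xi> :: real ^ 'n))\<^sup>2) \<partial>lborel) * (\<integral>x. norm (g x) \<partial>lborel)"
  have Bf: "norm (vf t) \<le> Bf" and Bg: "norm (vg t) \<le> Bg" for t
    unfolding vf_def vg_def Bf_def Bg_def by (rule norm_gauss_mult_le, simp)+
  have w_int: "integrable lborel w"
  proof (rule Bochner_Integration.integrable_bound)
    show "integrable lborel (\<lambda>t. (Bf * Bg) * norm ((1 - \<i> * of_real t) powr of_real (- (\<delta> + 1))))"
      by (intro integrable_mult_right integrable_norm integrable_one_minus_ii_powr \<delta>)
    have "w t \<le> (Bf * Bg) * norm ((1 - \<i> * of_real t) powr of_real (- (\<delta> + 1)))" for t
      unfolding w_def norm_one_minus_ii_powr mult.commute[of "Bf * Bg"]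
      by (intro mult_left_mono mult_mono Bf Bg order_trans[OF norm_ge_zero Bf]) auto
    then show "AE t in lborel. norm (w t) \<le> norm ((Bf * Bg) * norm ((1 - \<i> * of_real t) powr of_real (- (\<delta> + 1))))"
      unfolding real_norm_def using w0 by (intro AE_I2) (simp only: abs_of_nonneg, rule order_trans[OF _ abs_ge_self])
  qed measurable
  define D where "D j = {t::real. ((2::real) ^ j)\<^sup>2 \<le> 1 + t\<^sup>2 \<and> 1 + t\<^sup>2 < 4 * (2 ^ j)\<^sup>2}" for j :: nat
  have [measurable]: "D j \<in> sets borel" for j unfolding D_def by measurable
  have piece: "dyadic_piece \<delta> f g (2 ^ j) x = (\<integral>t. indicator (D j) t * w t \<partial>lborel)" for j
    unfolding dyadic_piece_def D_def w_def vf_def vg_def ..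
  \<comment> \<open>The index sought is one less than the least m with 1 + t^2 < 4^m; m is not 0
    because 1 + t^2 \<ge> 1. Starting at r = 1 therefore leaves no gap around t = 0.\<close>
  have cover: "\<exists>j. t \<in> D j" for t
  proof -
    have "eventually (\<lambda>k. 1 + t\<^sup>2 < 4 ^ k) sequentially" 
      by real_asymp
    then obtain k where k: "1 + t\<^sup>2 < 4 ^ k" by (auto simp: eventually_sequentially)
    define m where "m = (LEAST k. 1 + t\<^sup>2 < (4::real) ^ k)"
    have m: "1 + t\<^sup>2 < 4 ^ m" unfolding m_def by (rule LeastI[of _ k]) (rule k)
    then obtain j where j: "m = Suc j" by (cases m) (auto simp: add_increasing2 not_less)
    then have "j < (LEAST k. 1 + t\<^sup>2 < (4::real) ^ k)" unfolding m_def by simp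
    then have "\<not> (1 + t\<^sup>2 < 4 ^ j)" by (rule not_less_Least)
    moreover have "((2::real) ^ j)\<^sup>2 = 4 ^ j" by (simp add: power2_eq_square flip: power_mult_distrib)
    ultimately show ?thesis using m j by (intro exI[of _ j]) (simp add: D_def)
  qed
  have le: "norm (bochner_riesz \<delta> f g x) \<le> c * (\<integral>t. w t \<partial>lborel)"
  proof -
    have "norm (bochner_riesz \<delta> f g x) = Gamma (\<delta> + 1) / (2 * pi) * norm (\<integral>t. (1 - \<i> * of_real t) powr of_real (- (\<delta> + 1)) * exp (1 - \<i> * of_real t)
       * (vf t * vg t) \<partial>lborel)"
      unfolding bochner_riesz_eq_gauss_mult_integral[OF f g \<delta>] norm_mult[of "of_real (Gamma (\<delta> + 1) / (2 * pi))"] norm_of_real vf_def vg_def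
      using Gpos by simp
    also have "\<dots> \<le> Gamma (\<delta> + 1) / (2 * pi) * (\<integral>t. norm ((1 - \<i> * of_real t) powr of_real (- (\<delta> + 1)) * exp (1 - \<i> * of_real t)
       * (vf t * vg t)) \<partial>lborel)"
      using Gpos by (intro mult_left_mono integral_norm_bound) auto
    also have "(\<integral>t. norm ((1 - \<i> * of_real t) powr of_real (- (\<delta> + 1)) * exp (1 - \<i> * of_real t)
       * (vf t * vg t)) \<partial>lborel) = (\<integral>t. exp 1 * w t \<partial>lborel)"
    proof (intro Bochner_Integration.integral_cong refl)
      fix t
      have "a * e * b = e * (a * b)" for a e b :: real by simp
      moreover have "norm (exp (1 - \<i> * of_real t)) = exp 1" by (simp add: norm_exp_eq_Re)
      ultimately show "norm ((1 - \<i> * of_real t) powr of_real (- (\<delta> + 1)) * exp (1 - \<i> * of_real t) * (vf t * vg t)) = exp 1 * w t"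
        unfolding norm_mult norm_one_minus_ii_powr w_def by simp
    qed
    finally show ?thesis by (simp add: c_def)
  qed
  \<comment> \<open>Dividing by c keeps the series free of constants; c returns, raised to the power
    p, at the end.\<close>
  define S where "S = norm (bochner_riesz \<delta> f g x) / c"
  have S0: "S \<ge> 0" using c by (simp add: S_def)
  have "S \<le> (\<integral>t. w t \<partial>lborel)" using le c by (simp add: S_def field_simps)
  then have "ennreal S \<le> ennreal (\<integral>t. w t \<partial>lborel)" by (rule ennreal_leI)
  also have "\<dots> = (\<integral>\<^sup>+t. ennreal (w t) \<partial>lborel)"
    using w0 by (intro nn_integral_eq_integral[symmetric] w_int) auto
  also have "\<dots> \<le> (\<integral>\<^sup>+t. (\<Sum>j. ennreal (indicator (D j) t * w t)) \<partial>lborel)"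
  proof (rule nn_integral_mono)
    fix t
    obtain j where "t \<in> D j" using cover by blast
    then have "ennreal (w t) = (\<Sum>i\<in>{j}. ennreal (indicator (D i) t * w t))" by simp
    also have "\<dots> \<le> (\<Sum>j. ennreal (indicator (D j) t * w t))" by (intro sum_le_suminf) auto
    finally show "ennreal (w t) \<le> (\<Sum>j. ennreal (indicator (D j) t * w t))" .
  qed
  also have "\<dots> = (\<Sum>j. \<integral>\<^sup>+t. ennreal (indicator (D j) t * w t) \<partial>lborel)"
    by (rule nn_integral_suminf) measurable
  also have "\<dots> = (\<Sum>j. ennreal (dyadic_piece \<delta> f g (2 ^ j) x))"
  proof (intro suminf_cong)
    fix j
    have "integrable lborel (\<lambda>t. indicator (D j) t *\<^sub>R w t)"
      by (rule integrable_mult_indicator[OF _ w_int]) simp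
    then show "(\<integral>\<^sup>+t. ennreal (indicator (D j) t * w t) \<partial>lborel) = ennreal (dyadic_piece \<delta> f g (2 ^ j) x)"
      unfolding piece using w0 by (intro nn_integral_eq_integral) auto
  qed
  finally have "ennreal (S powr p) \<le> (\<Sum>j. ennreal (dyadic_piece \<delta> f g (2 ^ j) x powr p))"
    by (intro powr_suminf_le_suminf_powr dyadic_piece_nonneg S0 p)
  then have "ennreal (c powr p) * ennreal (S powr p) \<le> ennreal (c powr p) * (\<Sum>j. ennreal (dyadic_piece \<delta> f g (2 ^ j) x powr p))"
    by (intro mult_left_mono) auto
  moreover have "norm (bochner_riesz \<delta> f g x) powr p = c powr p * S powr p"
    using c S0 by (simp add: S_def powr_divide)
  ultimately show ?thesis unfolding c_def[symmetric] by (simp add: ennreal_mult)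
qed

text \<open>The blocks r = 2^j contribute a geometric series whose ratio is below 1 precisely
  because \<delta> exceeds n (1/p - 1).\<close>

lemma nn_integral_bochner_riesz_powr_le:
  fixes p1 p2 p \<delta> :: real
  assumes p1: "1 \<le> p1" "p1 \<le> 2" and p2: "1 \<le> p2" "p2 \<le> 2" and p: "0 < p" "1 / p = 1 / p1 + 1 / p2"
    and \<delta>: "\<delta> \<ge> 1" "\<delta> > real CARD('n) * (1 / p - 1)"
  shows "\<exists>K\<ge>0. \<forall>f g :: real ^ 'n \<Rightarrow> complex. integrable lborel f \<longrightarrow> integrable lborel g \<longrightarrow>
     integrable lborel (\<lambda>u. norm (f u) powr p1) \<longrightarrow> integrable lborel (\<lambda>u. norm (g u) powr p2) \<longrightarrow>
     (\<integral>\<^sup>+x. ennreal (norm (bochner_riesz \<delta> f g x) powr p) \<partial>lborel)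
      \<le> ennreal (K * ((\<integral>u. norm (f u) powr p1 \<partial>lborel) powr (p / p1) * (\<integral>u. norm (g u) powr p2 \<partial>lborel) powr (p / p2)))"
proof -
  have "\<delta> \<ge> 0" using \<delta> by simp
  define e where "e = p * (real CARD('n) * (1 / p - 1) - \<delta>)"
  obtain C where C: "C \<ge> 0" and block: "\<And>(f :: real ^ 'n \<Rightarrow> complex) g r. integrable lborel f \<Longrightarrow> integrable lborel g \<Longrightarrow>
     integrable lborel (\<lambda>u. norm (f u) powr p1) \<Longrightarrow> integrable lborel (\<lambda>u. norm (g u) powr p2) \<Longrightarrow> r \<ge> 1 \<Longrightarrow>
     (\<integral>\<^sup>+x. ennreal (dyadic_piece \<delta> f g r x powr p) \<partial>lborel)
      \<le> ennreal (C * r powr e * ((\<integral>u. norm (f u) powr p1 \<partial>lborel) powr (p / p1) * (\<integral>u. norm (g u) powr p2 \<partial>lborel) powr (p / p2)))"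
    using dyadic_piece_bound[OF p1 p2 p \<open>\<delta> \<ge> 0\<close>, where 'n = 'n] unfolding e_def by blast
  have "1 / p \<ge> 1"
  proof -
    have "1 / p1 \<ge> 1 / 2" "1 / p2 \<ge> 1 / 2" using p1 p2 by (auto simp: field_simps)
    then show ?thesis using p by linarith
  qed
  then have p_le: "p \<le> 1" using p(1) by (simp add: field_simps)
  define \<rho> where "\<rho> = 2 powr e"
  have "e < 0" unfolding e_def using p(1) \<delta> by (intro mult_pos_neg) auto
  then have \<rho>: "0 < \<rho>" "\<rho> < 1" using powr_less_mono[of e 0 2] by (auto simp: \<rho>_def)
  define c where "c = (Gamma (\<delta> + 1) / (2 * pi) * exp 1) powr p"
  define K where "K = c * (C / (1 - \<rho>))"
  have K: "K \<ge> 0" using C \<rho> by (simp add: K_def c_def)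
  have main: "(\<integral>\<^sup>+x. ennreal (norm (bochner_riesz \<delta> f g x) powr p) \<partial>lborel)
      \<le> ennreal (K * ((\<integral>u. norm (f u) powr p1 \<partial>lborel) powr (p / p1) * (\<integral>u. norm (g u) powr p2 \<partial>lborel) powr (p / p2)))"
    if f: "integrable lborel f" and g: "integrable lborel g" and fp: "integrable lborel (\<lambda>u. norm (f u) powr p1)"
      and gp: "integrable lborel (\<lambda>u. norm (g u) powr p2)" for f g :: "real ^ 'n \<Rightarrow> complex"
  proof -
    have [measurable]: "f \<in> borel_measurable borel" "g \<in> borel_measurable borel" using f g by auto
    have [measurable]: "dyadic_piece \<delta> f g r \<in> borel_measurable borel" for r
      by (rule dyadic_piece_measurable) measurable
    define F where "F = (\<integral>u. norm (f u) powr p1 \<partial>lborel) powr (p / p1) * (\<integral>u. norm (g u) powr p2 \<partial>lborel) powr (p / p2)"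
    have F0: "F \<ge> 0" by (simp add: F_def)
    have "(\<integral>\<^sup>+x. ennreal (norm (bochner_riesz \<delta> f g x) powr p) \<partial>lborel)
      \<le> (\<integral>\<^sup>+x. ennreal c * (\<Sum>j. ennreal (dyadic_piece \<delta> f g (2 ^ j) x powr p)) \<partial>lborel)"
      unfolding c_def by (intro nn_integral_mono bochner_riesz_norm_powr_le f g \<delta> p p_le)
    also have "\<dots> = ennreal c * (\<Sum>j. \<integral>\<^sup>+x. ennreal (dyadic_piece \<delta> f g (2 ^ j) x powr p) \<partial>lborel)"
      by (simp add: nn_integral_cmult nn_integral_suminf)
    also have "\<dots> \<le> ennreal c * (\<Sum>j. ennreal (C * F * \<rho> ^ j))"
    proof (intro mult_left_mono suminf_le)
      fix j
      have "(\<integral>\<^sup>+x. ennreal (dyadic_piece \<delta> f g (2 ^ j) x powr p) \<partial>lborel) \<le> ennreal (C * (2 ^ j) powr e * F)"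
        unfolding F_def by (intro block f g fp gp) simp
      also have "(2 ^ j) powr e = \<rho> ^ j"
        unfolding \<rho>_def by (simp add: powr_powr mult.commute flip: powr_realpow)
      finally show "(\<integral>\<^sup>+x. ennreal (dyadic_piece \<delta> f g (2 ^ j) x powr p) \<partial>lborel) \<le> ennreal (C * F * \<rho> ^ j)"
        by (simp add: mult_ac)
    qed auto
    also have "(\<Sum>j. ennreal (C * F * \<rho> ^ j)) = ennreal (C * F * (1 / (1 - \<rho>)))"
      using C F0 \<rho> by (intro suminf_ennreal_eq sums_mult geometric_sums) auto
    also have "ennreal c * ennreal (C * F * (1 / (1 - \<rho>))) = ennreal (K * F)"
      using C F0 \<rho> by (simp add: K_def c_def ennreal_mult[symmetric] mult_ac)
    finally show ?thesis unfolding F_def .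
  qed
  show ?thesis by (rule exI[of _ K]) (use K main in blast)
qed

section \<open>From p-th power integrals to norms\<close>

lemma Lp_norm_eq:
  fixes f :: "real ^ 'n \<Rightarrow> complex"
  assumes "integrable lborel (\<lambda>x. norm (f x) powr p)"
  shows "Lp_norm p f = ennreal ((\<integral>x. norm (f x) powr p \<partial>lborel) powr (1 / p))"
proof -
  have "(\<integral>\<^sup>+x. ennreal (norm (f x) powr p) \<partial>lborel) = ennreal (\<integral>x. norm (f x) powr p \<partial>lborel)"
    by (rule nn_integral_eq_integral[OF assms]) auto
  then show ?thesis
    unfolding Lp_norm_def Let_def by (simp add: integral_nonneg_AE)
qed

lemma Lp_norm_le:
  fixes f :: "real ^ 'n \<Rightarrow> complex"
  assumes "(\<integral>\<^sup>+x. ennreal (norm (f x) powr p) \<partial>lborel) \<le> ennreal M" "M \<ge> 0" "p > 0"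
  shows "Lp_norm p f \<le> ennreal (M powr (1 / p))"
proof (cases "\<integral>\<^sup>+x. ennreal (norm (f x) powr p) \<partial>lborel")
  case (real r)
  then have "r \<le> M" using assms by simp
  then have "r powr (1 / p) \<le> M powr (1 / p)" using real assms by (intro powr_mono2) auto
  then show ?thesis unfolding Lp_norm_def Let_def real(2) using real(1) by (simp add: ennreal_leI)
next
  case top
  then show ?thesis using assms by (simp add: top_unique)
qed

theorem theorem4p3:
  fixes n :: nat and p1 p2 p \<delta> :: real
  assumes "n = CARD('n::finite)" and "n \<ge> 2"
    and "1 \<le> p1" and "p1 < 2 * real n / (real n + 1)"
    and "1 \<le> p2" and "p2 < 2 * real n / (real n + 1)"
    and "0 < p" and "1 / p = 1 / p1 + 1 / p2"
    and "\<delta> \<ge> 0" and "\<delta> > real n * alpha n p1 p2 - 1"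
  shows "Lp_bounded
           (bochner_riesz \<delta> :: (real ^ 'n \<Rightarrow> complex) \<Rightarrow> (real ^ 'n \<Rightarrow> complex) \<Rightarrow> real ^ 'n \<Rightarrow> complex)
           p1 p2 p"
proof -
  have crit: "real n * (1 / p - 1) \<le> real n * alpha n p1 p2 - 1" "1 < real n * (1 / p - 1)"
    using alpha_lower_bound[of n p1 p2 p] assms by auto
  \<comment> \<open>The threshold itself exceeds 1, so the order condition for absolutely convergent
    Laplace inversion comes for free.\<close>
  have \<delta>: "\<delta> \<ge> 1" "\<delta> > real CARD('n) * (1 / p - 1)" using crit assms by auto
  have lt2: "2 * real n / (real n + 1) < 2" by (simp add: field_simps)
  have le2: "p1 \<le> 2" "p2 \<le> 2" using lt2 assms by linarith+
  obtain K where K: "K \<ge> 0" and bound: "\<And>f g :: real ^ 'n \<Rightarrow> complex. integrable lborel f \<Longrightarrow> integrable lborel g \<Longrightarrow>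
     integrable lborel (\<lambda>u. norm (f u) powr p1) \<Longrightarrow> integrable lborel (\<lambda>u. norm (g u) powr p2) \<Longrightarrow>
     (\<integral>\<^sup>+x. ennreal (norm (bochner_riesz \<delta> f g x) powr p) \<partial>lborel)
      \<le> ennreal (K * ((\<integral>u. norm (f u) powr p1 \<partial>lborel) powr (p / p1) * (\<integral>u. norm (g u) powr p2 \<partial>lborel) powr (p / p2)))"
    using nn_integral_bochner_riesz_powr_le[OF assms(3) le2(1) assms(5) le2(2) assms(7,8) \<delta>] by blast
  show ?thesis
    unfolding Lp_bounded_def
  proof (intro exI[of _ "K powr (1 / p)"] conjI allI impI)
    fix f g :: "real ^ 'n \<Rightarrow> complex"
    assume f: "schwartz f" and g: "schwartz g"
    define F G where "F = (\<integral>u. norm (f u) powr p1 \<partial>lborel)" and "G = (\<integral>u. norm (g u) powr p2 \<partial>lborel)"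
    have FG: "F \<ge> 0" "G \<ge> 0" unfolding F_def G_def by (auto intro!: integral_nonneg_AE)
    note fp = schwartz_integrable(2)[OF f assms(3)] and gp = schwartz_integrable(2)[OF g assms(5)]
    \<comment> \<open>Taking p-th roots turns the exponents p/p1 and p/p2 into 1/p1 and 1/p2, which
      are those of the norms of f and g.\<close>
    have "Lp_norm p (bochner_riesz \<delta> f g) \<le> ennreal ((K * (F powr (p / p1) * G powr (p / p2))) powr (1 / p))"
      using bound[OF schwartz_integrable(1)[OF f] schwartz_integrable(1)[OF g] fp gp] K assms(7)
      unfolding F_def G_def by (intro Lp_norm_le) auto
    also have "(K * (F powr (p / p1) * G powr (p / p2))) powr (1 / p) = K powr (1 / p) * F powr (1 / p1) * G powr (1 / p2)"
      using K FG assms(7) by (simp add: powr_mult powr_powr mult.assoc)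
    also have "ennreal \<dots> = ennreal (K powr (1 / p)) * Lp_norm p1 f * Lp_norm p2 g"
      unfolding Lp_norm_eq[OF fp] Lp_norm_eq[OF gp] F_def[symmetric] G_def[symmetric] by (simp add: ennreal_mult)
    finally show "Lp_norm p (bochner_riesz \<delta> f g) \<le> ennreal (K powr (1 / p)) * Lp_norm p1 f * Lp_norm p2 g" .
  qed simp
qed

end
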